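(* The compact projective objects in the category of condensed sets are exactly the extremally disconnected compact Hausdorff spaces. That is, a condensed set $T$ is both compact and projective in the category of condensed sets if and only if $T$ is isomorphic to $\underline{S}=\mathrm{Hom}_{\mathrm{Top}}(\cdot,S)$ for some extremally disconnected compact Hausdorff space $S$.
   Context: $\mathrm{ExtrDisc}$ is the category of extremally disconnected compact Hausdorff spaces (the closure of every open subset is open) and continuous maps. A condensed set is a functor $T\colon\mathrm{ExtrDisc}^{\mathrm{op}}\to\mathrm{Set}$ with $T(\emptyset)=\ast$ such that $T(S_1\amalg S_2)\to T(S_1)\times T(S_2)$ is a bijection for all $S_1,S_2$; morphisms are natural transformations. Since $\mathrm{ExtrDisc}$ is large, functors on it are implicitly assumed small (left Kan extended from the $\kappa$-small extremally disconnected sets for some uncountable strong limit cardinal $\kappa$). A compact Hausdorff space $S$ is regarded as the condensed set $\underline{S}=\mathrm{Hom}_{\mathrm{Top}}(\cdot,S)$. In a category $\mathcal{C}$ with all small colimits, an object $X$ is compact if $\mathrm{Hom}_{\mathcal{C}}(X,\cdot)$ commutes with filtered colimits, and projective if $\mathrm{Hom}_{\mathcal{C}}(X,\cdot)$ commutes with reflexive coequalizers, i.e. coequalizers of parallel arrows $Y\rightrightarrows Z$ having a simultaneous section $Z\to Y$. *)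

theory Defs
  imports "HOL-Analysis.Sum_Topology" "HOL-Analysis.T1_Spaces" "HOL-Library.FuncSet"
begin

unbundle cardinal_syntax

section \<open>Categories, functors, colimits\<close>

text \<open>
  Hom-sets are indexed by source and target and need not be disjoint, so identities and
  composition take the objects as arguments: for \<open>f : X \<rightarrow> Y\<close> and \<open>g : Y \<rightarrow> Z\<close> the composite
  is \<open>Comp C X Y Z g f\<close>.
\<close>

record ('o, 'm) cat =
  Obj :: "'o set"
  Hom :: "'o \<Rightarrow> 'o \<Rightarrow> 'm set"
  Ident :: "'o \<Rightarrow> 'm"
  Comp :: "'o \<Rightarrow> 'o \<Rightarrow> 'o \<Rightarrow> 'm \<Rightarrow> 'm \<Rightarrow> 'm"

definition category :: "('o, 'm) cat \<Rightarrow> bool" where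
  "category C \<longleftrightarrow>
     (\<forall>X\<in>Obj C. Ident C X \<in> Hom C X X) \<and>
     (\<forall>X\<in>Obj C. \<forall>Y\<in>Obj C. \<forall>Z\<in>Obj C. \<forall>f\<in>Hom C X Y. \<forall>g\<in>Hom C Y Z.
        Comp C X Y Z g f \<in> Hom C X Z) \<and>
     (\<forall>X\<in>Obj C. \<forall>Y\<in>Obj C. \<forall>f\<in>Hom C X Y.
        Comp C X X Y f (Ident C X) = f \<and> Comp C X Y Y (Ident C Y) f = f) \<and>
     (\<forall>W\<in>Obj C. \<forall>X\<in>Obj C. \<forall>Y\<in>Obj C. \<forall>Z\<in>Obj C.
        \<forall>f\<in>Hom C W X. \<forall>g\<in>Hom C X Y. \<forall>h\<in>Hom C Y Z.
        Comp C W Y Z h (Comp C W X Y g f) = Comp C W X Z (Comp C X Y Z h g) f)"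

definition op_cat :: "('o, 'm) cat \<Rightarrow> ('o, 'm) cat" where
  "op_cat C = \<lparr>Obj = Obj C, Hom = (\<lambda>X Y. Hom C Y X), Ident = Ident C,
               Comp = (\<lambda>X Y Z g f. Comp C Z Y X f g)\<rparr>"

definition full_subcat :: "('o, 'm) cat \<Rightarrow> ('o \<Rightarrow> bool) \<Rightarrow> ('o, 'm) cat" where
  "full_subcat C P = C\<lparr>Obj := {X \<in> Obj C. P X}\<rparr>"

definition isomorphic_in :: "('o, 'm) cat \<Rightarrow> 'o \<Rightarrow> 'o \<Rightarrow> bool" where
  "isomorphic_in C X Y \<longleftrightarrow> X \<in> Obj C \<and> Y \<in> Obj C \<and>
     (\<exists>f\<in>Hom C X Y. \<exists>g\<in>Hom C Y X. Comp C X Y X g f = Ident C X \<and> Comp C Y X Y f g = Ident C Y)"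

record ('o, 'm, 'p, 'n) func =
  FObj :: "'o \<Rightarrow> 'p"
  FArr :: "'o \<Rightarrow> 'o \<Rightarrow> 'm \<Rightarrow> 'n"

definition is_functor :: "('o, 'm) cat \<Rightarrow> ('p, 'n) cat \<Rightarrow> ('o, 'm, 'p, 'n) func \<Rightarrow> bool" where
  "is_functor C D F \<longleftrightarrow>
     (\<forall>X\<in>Obj C. FObj F X \<in> Obj D) \<and>
     (\<forall>X\<in>Obj C. \<forall>Y\<in>Obj C. \<forall>f\<in>Hom C X Y. FArr F X Y f \<in> Hom D (FObj F X) (FObj F Y)) \<and>
     (\<forall>X\<in>Obj C. FArr F X X (Ident C X) = Ident D (FObj F X)) \<and>
     (\<forall>X\<in>Obj C. \<forall>Y\<in>Obj C. \<forall>Z\<in>Obj C. \<forall>f\<in>Hom C X Y. \<forall>g\<in>Hom C Y Z.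
        FArr F X Z (Comp C X Y Z g f) =
        Comp D (FObj F X) (FObj F Y) (FObj F Z) (FArr F Y Z g) (FArr F X Y f))"

definition comp_func ::
  "('p, 'n, 'q, 'l) func \<Rightarrow> ('o, 'm, 'p, 'n) func \<Rightarrow> ('o, 'm, 'q, 'l) func" where
  "comp_func G F = \<lparr>FObj = (\<lambda>X. FObj G (FObj F X)),
                    FArr = (\<lambda>X Y f. FArr G (FObj F X) (FObj F Y) (FArr F X Y f))\<rparr>"

definition nat_trans ::
  "('o, 'm) cat \<Rightarrow> ('p, 'n) cat \<Rightarrow> ('o, 'm, 'p, 'n) func \<Rightarrow> ('o, 'm, 'p, 'n) func \<Rightarrow> ('o \<Rightarrow> 'n) set" where
  "nat_trans C D F G = {\<eta> \<in> (\<Pi>\<^sub>E X\<in>Obj C. Hom D (FObj F X) (FObj G X)).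
     \<forall>X\<in>Obj C. \<forall>Y\<in>Obj C. \<forall>f\<in>Hom C X Y.
       Comp D (FObj F X) (FObj F Y) (FObj G Y) (\<eta> Y) (FArr F X Y f) =
       Comp D (FObj F X) (FObj G X) (FObj G Y) (FArr G X Y f) (\<eta> X)}"

definition functor_cat ::
  "('o, 'm) cat \<Rightarrow> ('p, 'n) cat \<Rightarrow> (('o, 'm, 'p, 'n) func, 'o \<Rightarrow> 'n) cat" where
  "functor_cat C D = \<lparr>
     Obj = {F. is_functor C D F},
     Hom = nat_trans C D,
     Ident = (\<lambda>F. \<lambda>X\<in>Obj C. Ident D (FObj F X)),
     Comp = (\<lambda>F G H \<beta> \<alpha>. \<lambda>X\<in>Obj C. Comp D (FObj F X) (FObj G X) (FObj H X) (\<beta> X) (\<alpha> X))\<rparr>"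

definition is_cocone ::
  "('j, 'a) cat \<Rightarrow> ('o, 'm) cat \<Rightarrow> ('j, 'a, 'o, 'm) func \<Rightarrow> 'o \<Rightarrow> ('j \<Rightarrow> 'm) \<Rightarrow> bool" where
  "is_cocone J C F c \<iota> \<longleftrightarrow> c \<in> Obj C \<and>
     (\<forall>j\<in>Obj J. \<iota> j \<in> Hom C (FObj F j) c) \<and>
     (\<forall>i\<in>Obj J. \<forall>j\<in>Obj J. \<forall>u\<in>Hom J i j.
        Comp C (FObj F i) (FObj F j) c (\<iota> j) (FArr F i j u) = \<iota> i)"

definition is_colimit ::
  "('j, 'a) cat \<Rightarrow> ('o, 'm) cat \<Rightarrow> ('j, 'a, 'o, 'm) func \<Rightarrow> 'o \<Rightarrow> ('j \<Rightarrow> 'm) \<Rightarrow> bool" where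
  "is_colimit J C F c \<iota> \<longleftrightarrow> is_cocone J C F c \<iota> \<and>
     (\<forall>d \<delta>. is_cocone J C F d \<delta> \<longrightarrow>
        (\<exists>!h. h \<in> Hom C c d \<and> (\<forall>j\<in>Obj J. Comp C (FObj F j) c d h (\<iota> j) = \<delta> j)))"

definition is_coequalizer ::
  "('o, 'm) cat \<Rightarrow> 'o \<Rightarrow> 'o \<Rightarrow> 'm \<Rightarrow> 'm \<Rightarrow> 'o \<Rightarrow> 'm \<Rightarrow> bool" where
  "is_coequalizer C Y Z f g Q q \<longleftrightarrow>
     Q \<in> Obj C \<and> q \<in> Hom C Z Q \<and> Comp C Y Z Q q f = Comp C Y Z Q q g \<and>
     (\<forall>W\<in>Obj C. \<forall>r\<in>Hom C Z W. Comp C Y Z W r f = Comp C Y Z W r g \<longrightarrow>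
        (\<exists>!h. h \<in> Hom C Q W \<and> Comp C Z Q W h q = r))"

definition filtered_cat :: "('j, 'a) cat \<Rightarrow> bool" where
  "filtered_cat J \<longleftrightarrow> category J \<and> Obj J \<noteq> {} \<and>
     (\<forall>i\<in>Obj J. \<forall>j\<in>Obj J. \<exists>k\<in>Obj J. Hom J i k \<noteq> {} \<and> Hom J j k \<noteq> {}) \<and>
     (\<forall>i\<in>Obj J. \<forall>j\<in>Obj J. \<forall>u\<in>Hom J i j. \<forall>v\<in>Hom J i j.
        \<exists>k\<in>Obj J. \<exists>w\<in>Hom J j k. Comp J i j k w u = Comp J i j k w v)"

text \<open>The category with objects the members of \<open>U\<close> and all maps between them.\<close>

definition set_cat :: "'a set set \<Rightarrow> ('a set, 'a \<Rightarrow> 'a) cat" where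
  "set_cat U = \<lparr>Obj = U, Hom = (\<lambda>A B. A \<rightarrow>\<^sub>E B), Ident = (\<lambda>A. \<lambda>x\<in>A. x),
                Comp = (\<lambda>A B D g f. compose A g f)\<rparr>"

definition hom_functor :: "('o, 'm) cat \<Rightarrow> 'o \<Rightarrow> ('o, 'm, 'm set, 'm \<Rightarrow> 'm) func" where
  "hom_functor C X = \<lparr>FObj = (\<lambda>Y. Hom C X Y),
                      FArr = (\<lambda>Y Z g. \<lambda>f\<in>Hom C X Y. Comp C X Y Z g f)\<rparr>"


section \<open>Size\<close>

definition uncountable_strong_limit :: "'a rel \<Rightarrow> bool" where
  "uncountable_strong_limit k \<longleftrightarrow>
     Card_order k \<and> natLeq <o k \<and> (\<forall>A :: 'a set. |A| <o k \<longrightarrow> |Pow A| <o k)"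

definition inaccessible :: "'a rel \<Rightarrow> bool" where
  "inaccessible k \<longleftrightarrow> uncountable_strong_limit k \<and> regularCard k"

text \<open>
  The type \<open>'u\<close> plays the role of the universe: when its cardinality is inaccessible, the sets
  with fewer than \<open>|UNIV :: 'u set|\<close> elements are, up to bijection, the sets of a Grothendieck
  universe. They can be taken in any type that is at least as large as \<open>'u\<close>.
\<close>

definition small :: "'u itself \<Rightarrow> 'a set \<Rightarrow> bool" where
  "small _ A \<longleftrightarrow> |A| <o |UNIV :: 'u set|"

definition small_cat :: "'u itself \<Rightarrow> ('j, 'a) cat \<Rightarrow> bool" where
  "small_cat TU J \<longleftrightarrow> category J \<and> small TU (Obj J) \<and> (\<forall>i\<in>Obj J. \<forall>j\<in>Obj J. small TU (Hom J i j))"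


section \<open>Compact and projective objects\<close>

text \<open>
  The functor \<open>Hom(X, -)\<close> is taken with values in all sets of morphisms. A cocone of small
  sets over a small diagram is a colimit there iff it is one among the small sets.
  Index categories live on the type \<open>'u\<close>, which contains a copy of each small category.
\<close>

definition compact_object :: "'u itself \<Rightarrow> ('o, 'm) cat \<Rightarrow> 'o \<Rightarrow> bool" where
  "compact_object TU C X \<longleftrightarrow> X \<in> Obj C \<and>
     (\<forall>(J :: ('u, 'u) cat) F c \<iota>.
        small_cat TU J \<and> filtered_cat J \<and> is_functor J C F \<and> is_colimit J C F c \<iota> \<longrightarrow>
        is_colimit J (set_cat UNIV) (comp_func (hom_functor C X) F)
          (FObj (hom_functor C X) c) (\<lambda>j. FArr (hom_functor C X) (FObj F j) c (\<iota> j)))"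

definition projective_object :: "('o, 'm) cat \<Rightarrow> 'o \<Rightarrow> bool" where
  "projective_object C X \<longleftrightarrow> X \<in> Obj C \<and>
     (\<forall>Y\<in>Obj C. \<forall>Z\<in>Obj C. \<forall>f\<in>Hom C Y Z. \<forall>g\<in>Hom C Y Z. \<forall>Q q.
        (\<exists>s\<in>Hom C Z Y. Comp C Z Y Z f s = Ident C Z \<and> Comp C Z Y Z g s = Ident C Z) \<and>
        is_coequalizer C Y Z f g Q q \<longrightarrow>
        is_coequalizer (set_cat UNIV)
          (FObj (hom_functor C X) Y) (FObj (hom_functor C X) Z)
          (FArr (hom_functor C X) Y Z f) (FArr (hom_functor C X) Y Z g)
          (FObj (hom_functor C X) Q) (FArr (hom_functor C X) Z Q q))"


section \<open>Left Kan extension from a full subcategory\<close>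

text \<open>The comma category of arrows \<open>a \<rightarrow> c\<close> with \<open>a\<close> in the set of objects \<open>A\<close>.\<close>

definition over_cat :: "('o, 'm) cat \<Rightarrow> 'o set \<Rightarrow> 'o \<Rightarrow> ('o \<times> 'm, 'm) cat" where
  "over_cat C A c = \<lparr>
     Obj = (SIGMA a:A. Hom C a c),
     Hom = (\<lambda>(a, f) (b, g). {h \<in> Hom C a b. Comp C a b c g h = f}),
     Ident = (\<lambda>(a, f). Ident C a),
     Comp = (\<lambda>x y z. Comp C (fst x) (fst y) (fst z))\<rparr>"

definition over_proj :: "('o \<times> 'm, 'm, 'o, 'm) func" where
  "over_proj = \<lparr>FObj = fst, FArr = (\<lambda>x y h. h)\<rparr>"

text \<open>
  \<open>F : C \<rightarrow> D\<close> is left Kan extended from the full subcategory on \<open>A\<close> if each \<open>F(c)\<close> is the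
  colimit of \<open>F(a)\<close> over the arrows \<open>a \<rightarrow> c\<close> with \<open>a\<close> in \<open>A\<close>.
\<close>

definition left_kan_extended_from ::
  "('o, 'm) cat \<Rightarrow> ('p, 'n) cat \<Rightarrow> 'o set \<Rightarrow> ('o, 'm, 'p, 'n) func \<Rightarrow> bool" where
  "left_kan_extended_from C D A F \<longleftrightarrow>
     (\<forall>c\<in>Obj C. is_colimit (over_cat C A c) D (comp_func F over_proj)
        (FObj F c) (\<lambda>(a, f). FArr F a c f))"


section \<open>Condensed sets\<close>

definition extremally_disconnected_space :: "'a topology \<Rightarrow> bool" where
  "extremally_disconnected_space S \<longleftrightarrow> (\<forall>U. openin S U \<longrightarrow> openin S (S closure_of U))"

text \<open>Continuous maps, made unique as HOL functions by requiring extensionality.\<close>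

definition cmaps :: "'a topology \<Rightarrow> 'b topology \<Rightarrow> ('a \<Rightarrow> 'b) set" where
  "cmaps X Y = {f \<in> extensional (topspace X). continuous_map X Y f}"

definition ExtrDisc :: "('u topology, 'u \<Rightarrow> 'u) cat" where
  "ExtrDisc = \<lparr>
     Obj = {S. small TYPE('u) (topspace S) \<and> compact_space S \<and> Hausdorff_space S \<and>
               extremally_disconnected_space S},
     Hom = cmaps,
     Ident = (\<lambda>S. \<lambda>x\<in>topspace S. x),
     Comp = (\<lambda>R S T g f. compose (topspace R) g f)\<rparr>"

text \<open>
  Presheaves take values in the small sets of elements of type \<open>'u \<Rightarrow> 'u\<close>, so that
  \<open>Hom(-, S)\<close> is itself such a presheaf.
\<close>

type_synonym 'u presheaf = "('u topology, 'u \<Rightarrow> 'u, ('u \<Rightarrow> 'u) set, ('u \<Rightarrow> 'u) \<Rightarrow> ('u \<Rightarrow> 'u)) func"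

definition small_sets :: "(('u \<Rightarrow> 'u) set, ('u \<Rightarrow> 'u) \<Rightarrow> ('u \<Rightarrow> 'u)) cat" where
  "small_sets = set_cat {A. small TYPE('u) A}"

text \<open>Here \<open>\<kappa>\<close> is a small cardinal, and \<open>\<kappa>\<close>-small means having fewer than \<open>\<kappa>\<close> points.\<close>

definition small_presheaf :: "'u presheaf \<Rightarrow> bool" where
  "small_presheaf T \<longleftrightarrow>
     (\<exists>\<kappa> :: 'u rel. uncountable_strong_limit \<kappa> \<and> \<kappa> <o |UNIV :: 'u set| \<and>
        left_kan_extended_from (op_cat ExtrDisc) small_sets
          {S \<in> Obj ExtrDisc. |topspace S| <o \<kappa>} T)"

text \<open>
  A disjoint union of \<open>S1\<close> and \<open>S2\<close> inside \<open>'u\<close> is any space \<open>S\<close> with a homeomorphism \<open>h\<close>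
  from their topological sum; \<open>i1\<close> and \<open>i2\<close> are the inclusions of the summands.
\<close>

definition condensed_set :: "'u presheaf \<Rightarrow> bool" where
  "condensed_set T \<longleftrightarrow>
     is_functor (op_cat ExtrDisc) small_sets T \<and>
     small_presheaf T \<and>
     (\<exists>x. FObj T (discrete_topology {}) = {x}) \<and>
     (\<forall>S1\<in>Obj ExtrDisc. \<forall>S2\<in>Obj ExtrDisc. \<forall>S\<in>Obj ExtrDisc. \<forall>h.
        homeomorphic_map (sum_topology (\<lambda>b. if b then S2 else S1) UNIV) S h \<longrightarrow>
        (let i1 = (\<lambda>s\<in>topspace S1. h (False, s)); i2 = (\<lambda>s\<in>topspace S2. h (True, s))
         in bij_betw (\<lambda>x. (FArr T S S1 i1 x, FArr T S S2 i2 x))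
              (FObj T S) (FObj T S1 \<times> FObj T S2)))"

definition CondSet :: "('u presheaf, 'u topology \<Rightarrow> ('u \<Rightarrow> 'u) \<Rightarrow> ('u \<Rightarrow> 'u)) cat" where
  "CondSet = full_subcat (functor_cat (op_cat ExtrDisc) small_sets) condensed_set"

definition underline :: "'u topology \<Rightarrow> 'u presheaf" where
  "underline S = \<lparr>FObj = (\<lambda>R. cmaps R S),
                  FArr = (\<lambda>R R' g. \<lambda>f\<in>cmaps R S. compose (topspace R') f g)\<rparr>"

end

theory Submission
  imports Defs
begin

text \<open>
  By the Yoneda lemma \<open>Hom(S, -)\<close> is evaluation at \<open>S\<close>, so extremally disconnected spaces are compact
  projective as soon as filtered colimits and reflexive coequalizers of condensed sets are computed
  pointwise. They are: both are pointwise quotients of a small family of condensed sets, and such a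
  quotient is again small, and takes coproducts to products because filtered and reflexive diagrams are
  sifted.

  Conversely, choose \<open>\<kappa>\<close> such that \<open>T\<close> is left Kan extended from the \<open>\<kappa>\<close>-small spaces, and let \<open>X\<close> be
  the topological coproduct of the \<open>\<kappa>\<close>-small spaces \<open>S\<close> indexed by all pairs of \<open>S\<close> and an element of
  \<open>T(S)\<close>. Then \<open>Hom(-, X)\<close> is a condensed set, and \<open>T\<close> is the reflexive coequalizer of two maps
  \<open>Hom(-, X') \<rightarrow> Hom(-, X)\<close>, with \<open>X'\<close> a coproduct of the same kind. Hence a projective \<open>T\<close> is a
  retract of \<open>Hom(-, X)\<close>, which is the filtered union of the \<open>Hom(-, K)\<close> for \<open>K\<close> compact open in
  \<open>X\<close>. So a compact projective \<open>T\<close> is a retract of some \<open>Hom(-, K)\<close>, and therefore is represented by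
  a retract of \<open>K\<close>.
\<close>

section \<open>Small sets\<close>

text \<open>A coproduct of infinitely many nonempty extremally disconnected spaces is not compact,
  so it is no object of \<open>ExtrDisc\<close>; the class \<open>locally_ED\<close> takes its
  place. For \<open>X\<close> in it Hom(-, X) is still condensed, because a map from a compact space
  stays inside a compact open part of \<open>X\<close>. Size is the main obstacle: every colimit
  that is built must again be left Kan extended from one \<open>\<kappa>\<close>. Regularity of
  \<open>|UNIV :: 'u set|\<close> keeps the sum of a small family of cutoffs small, the strong limit
  property keeps quotients and sets of maps small, and together they leave room for a cutoff above
  any small set. Colimits in \<open>CondSet\<close> are known only through their universal property;
  pointwise statements come from comparing them with an explicit quotient. In the converse,
  compactness and projectivity are used only through surjectivity: the identity of \<open>T\<close>
  is lifted along \<open>q\<close>, then its lift is pushed into one compact open set. Surjectivity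
  of a universal cocone of sets is read off from maps into a two-element set.\<close>

locale universe =
  fixes TU :: "'u itself"
  assumes inacc: "inaccessible |UNIV :: 'u set|"
begin

lemma infinite_univ: "infinite (UNIV :: 'u set)"
proof -
  have "natLeq <o |UNIV :: 'u set|"
    using inacc by (simp add: inaccessible_def uncountable_strong_limit_def)
  then show ?thesis
    by (meson infinite_iff_natLeq_ordLeq ordLess_imp_ordLeq)
qed

lemma stable_univ: "stable |UNIV :: 'u set|"
  using inacc infinite_univ card_of_Card_order
  by (intro regularCard_stable) (auto simp: inaccessible_def Field_card_of)

lemma small_nat: "small TYPE('u) (UNIV :: nat set)"
proof -
  have "natLeq <o |UNIV :: 'u set|"
    using inacc by (simp add: inaccessible_def uncountable_strong_limit_def)
  then show ?thesis
    unfolding small_def using card_of_nat ordIso_ordLess_trans by blast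
qed

lemma small_inj:
  assumes "inj_on f A" "f ` A \<subseteq> B" "small TYPE('u) B"
  shows "small TYPE('u) A"
  using assms unfolding small_def
  by (meson card_of_ordLeqI image_subset_iff ordLeq_ordLess_trans)

lemma small_subset: "A \<subseteq> B \<Longrightarrow> small TYPE('u) B \<Longrightarrow> small TYPE('u) A"
  using small_inj[of id A B] by simp

lemma small_image: "small TYPE('u) A \<Longrightarrow> small TYPE('u) (f ` A)"
  unfolding small_def using card_of_image ordLeq_ordLess_trans by blast

lemma small_finite: "finite A \<Longrightarrow> small TYPE('u) A"
  unfolding small_def using infinite_univ
  by (intro finite_ordLess_infinite) (simp_all add: card_of_well_order_on Field_card_of)

lemma small_iso:
  assumes "small TYPE('u) A"
  obtains f :: "'a \<Rightarrow> 'u" where "inj_on f A"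
  using assms unfolding small_def
  by (meson card_of_ordLeq ordLess_imp_ordLeq subset_UNIV)

lemma small_Pow:
  assumes "small TYPE('u) A"
  shows "small TYPE('u) (Pow A)"
proof -
  obtain f :: "_ \<Rightarrow> 'u" where f: "inj_on f A" using small_iso assms by blast
  have "|f ` A| <o |UNIV :: 'u set|"
    using small_image[OF assms, of f] by (simp add: small_def)
  then have "|Pow (f ` A)| <o |UNIV :: 'u set|"
    using inacc by (simp add: inaccessible_def uncountable_strong_limit_def)
  then show ?thesis
    by (intro small_inj[of "image f" "Pow A" "Pow (f ` A)"]) (auto simp: small_def f inj_on_image_Pow)
qed

lemma small_Sigma:
  assumes "small TYPE('u) A" "\<And>a. a \<in> A \<Longrightarrow> small TYPE('u) (B a)"
  shows "small TYPE('u) (Sigma A B)"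
  using stable_elim[OF stable_univ, of A B] assms by (simp add: small_def)

lemma small_Times: "small TYPE('u) A \<Longrightarrow> small TYPE('u) B \<Longrightarrow> small TYPE('u) (A \<times> B)"
  by (rule small_Sigma)

text \<open>Graphs embed the functions into the power set of a product, so the strong limit property
  bounds them.\<close>

lemma small_PiE:
  assumes "small TYPE('u) A" "small TYPE('u) B"
  shows "small TYPE('u) (A \<rightarrow>\<^sub>E B)"
proof (rule small_inj)
  show "inj_on (\<lambda>f. (\<lambda>x. (x, f x)) ` A) (A \<rightarrow>\<^sub>E B)"
  proof (rule inj_onI)
    fix f g assume fg: "f \<in> A \<rightarrow>\<^sub>E B" "g \<in> A \<rightarrow>\<^sub>E B" "(\<lambda>x. (x, f x)) ` A = (\<lambda>x. (x, g x)) ` A"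
    then have "f x = g x" if "x \<in> A" for x using that by auto
    with fg show "f = g" by (intro PiE_ext)
  qed
  show "(\<lambda>f. (\<lambda>x. (x, f x)) ` A) ` (A \<rightarrow>\<^sub>E B) \<subseteq> Pow (A \<times> B)" by auto
  show "small TYPE('u) (Pow (A \<times> B))" using assms by (intro small_Pow small_Times)
qed

text \<open>Presheaf values must be sets of elements of \<open>'u \<Rightarrow> 'u\<close>, so the
  classes of a quotient have to be coded in that type. There are few enough classes to be injected
  into \<open>'u\<close>, and constant functions carry them on to
  \<open>'u \<Rightarrow> 'u\<close>; \<open>\<pi>\<close> is the quotient map in this
  coding.\<close>

lemma small_quotient:
  assumes "small TYPE('u) D" "equiv D r"
  obtains \<pi> :: "'a \<Rightarrow> 'u \<Rightarrow> 'u" where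
    "small TYPE('u) (\<pi> ` D)" "\<And>x y. x \<in> D \<Longrightarrow> y \<in> D \<Longrightarrow> \<pi> x = \<pi> y \<longleftrightarrow> (x, y) \<in> r"
proof -
  have "D // r \<subseteq> Pow D" using assms(2) by (simp add: equiv_type quotient_def) (auto simp: equiv_def refl_on_def)
  then have "small TYPE('u) (D // r)" using assms small_Pow small_subset by blast
  then obtain f :: "_ \<Rightarrow> 'u" where f: "inj_on f (D // r)" using small_iso by blast
  define \<pi> where "\<pi> x = (\<lambda>_::'u. f (r `` {x}))" for x
  show ?thesis
  proof
    show "small TYPE('u) (\<pi> ` D)" using assms small_image by blast
    fix x y assume xy: "x \<in> D" "y \<in> D"
    have "\<pi> x = \<pi> y \<longleftrightarrow> f (r `` {x}) = f (r `` {y})" by (auto simp: \<pi>_def fun_eq_iff)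
    also have "\<dots> \<longleftrightarrow> r `` {x} = r `` {y}" using f xy by (simp add: inj_on_eq_iff quotientI)
    also have "\<dots> \<longleftrightarrow> (x, y) \<in> r" using eq_equiv_class_iff[OF assms(2)] xy by auto
    finally show "\<pi> x = \<pi> y \<longleftrightarrow> (x, y) \<in> r" .
  qed
qed

lemma ordLess_or_ordLeq_card: "|A| <o |B| \<or> |B| \<le>o |A|"
  by (meson card_of_Well_order not_ordLess_iff_ordLeq)

text \<open>The cardinal is \<open>beth_\<omega>(A)\<close>: the iterated power sets of \<open>A\<close> are cofinal below their union.\<close>

lemma exists_strong_limit:
  fixes A :: "'a set"
  assumes "small TYPE('u) A"
  obtains \<kappa> :: "'u rel" where "uncountable_strong_limit \<kappa>" "\<kappa> <o |UNIV :: 'u set|" "|A| <o \<kappa>"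
proof -
  \<comment> \<open>The copy of \<open>nat\<close> makes the starting set infinite, so that the
    cardinal is uncountable; the copy of \<open>A\<close> makes it exceed
    \<open>|A|\<close>.\<close>
  have "small TYPE('u) (Inl ` A :: ('a + nat) set)" "small TYPE('u) (Inr ` UNIV :: ('a + nat) set)"
    using assms small_nat by (auto intro: small_image)
  then have A_nat: "small TYPE('u) (A <+> (UNIV :: nat set))"
    unfolding Plus_def small_def using card_of_Un_ordLess_infinite[OF infinite_univ] by blast
  then obtain f0 :: "_ \<Rightarrow> 'u" where f0: "inj_on f0 (A <+> (UNIV :: nat set))" by (rule small_iso)
  \<comment> \<open>Iteration has to stay inside one type, so each power set is replaced by a chosen
    set in \<open>'u\<close> of at least its size.\<close>
  define step where "step B = (SOME C :: 'u set. small TYPE('u) C \<and> |Pow B| \<le>o |C| )" for B :: "'u set"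
  have step: "small TYPE('u) (step B)" "|Pow B| \<le>o |step B|" if B: "small TYPE('u) B" for B :: "'u set"
  proof -
    obtain g :: "_ \<Rightarrow> 'u" where g: "inj_on g (Pow B)" using small_iso small_Pow[OF B] by blast
    have "\<exists>C :: 'u set. small TYPE('u) C \<and> |Pow B| \<le>o |C|"
      using small_image[OF small_Pow[OF B], of g] g by (intro exI[of _ "g ` Pow B"]) (auto intro: card_of_ordLeqI)
    from someI_ex[OF this] show "small TYPE('u) (step B)" "|Pow B| \<le>o |step B|"
      unfolding step_def by auto
  qed
  define s where "s n = (step ^^ n) (f0 ` (A <+> UNIV))" for n
  have s0: "small TYPE('u) (s 0)" using A_nat by (simp add: s_def small_image)
  have ssm: "small TYPE('u) (s n)" for n
    by (induction n) (use s0 in \<open>auto simp: s_def intro: step\<close>)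
  have sS: "|Pow (s n)| \<le>o |s (Suc n)|" for n
    using step(2)[OF ssm] by (simp add: s_def)
  have sless: "|s n| <o |s (Suc n)|" for n
    using sS card_of_Pow ordLess_ordLeq_trans by blast
  have "small TYPE('u) (SIGMA n : UNIV. s n)" using ssm small_nat by (intro small_Sigma)
  then obtain g :: "_ \<Rightarrow> 'u" where g: "inj_on g (SIGMA n : UNIV. s n)" using small_iso by blast
  define \<kappa> where "\<kappa> = |g ` (SIGMA n : UNIV. s n)|"
  have \<kappa>iso: "\<kappa> =o |SIGMA n : UNIV. s n|"
    unfolding \<kappa>_def using g by (meson card_of_ordIsoI inj_on_imp_bij_betw ordIso_symmetric)
  have \<kappa>small: "\<kappa> <o |UNIV :: 'u set|"
    using small_image[OF \<open>small TYPE('u) (SIGMA n : UNIV. s n)\<close>, of g] by (simp add: \<kappa>_def small_def)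
  have sle: "|s n| \<le>o \<kappa>" for n
  proof -
    have "|s n| \<le>o |SIGMA n : UNIV. s n|"
      by (rule card_of_ordLeqI[of "Pair n"]) (auto simp: inj_on_def)
    then show ?thesis using \<kappa>iso ordIso_symmetric ordLeq_ordIso_trans by blast
  qed
  have slt: "|s n| <o \<kappa>" for n using sless sle ordLess_ordLeq_trans by blast
  have "|A <+> (UNIV :: nat set)| \<le>o |s 0|"
    using f0 by (auto simp: s_def intro: card_of_ordLeqI)
  then have A0: "|A| \<le>o |s 0|" "|UNIV :: nat set| \<le>o |s 0|"
    using card_of_Plus1 card_of_Plus2 ordLeq_transitive by blast+
  have N: "natLeq <o \<kappa>"
    using A0(2) slt[of 0] card_of_nat ordIso_symmetric
    by (meson ordIso_ordLeq_trans ordLeq_ordLess_trans)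
  have lim: "|Pow C| <o \<kappa>" if C: "|C| <o \<kappa>" for C :: "'u set"
  proof (cases "\<exists>n. |C| \<le>o |s n|")
    case True
    then obtain n where "|C| \<le>o |s n|" by blast
    then obtain h where h: "inj_on h C" "h ` C \<subseteq> s n" using card_of_ordLeq[of C "s n"] by blast
    then have "|Pow C| \<le>o |Pow (s n)|"
      by (intro card_of_ordLeqI[of "image h"]) (auto simp: inj_on_image_Pow)
    then show ?thesis using sS slt ordLeq_transitive ordLeq_ordLess_trans by blast
  next
    \<comment> \<open>This case is contradictory: a set larger than every \<open>s n\<close> is at
      least as large as their countable sum, which is \<open>\<kappa>\<close>.\<close>
    case False
    then have lt: "|s n| <o |C|" for n using ordLess_or_ordLeq_card by blast
    have inf: "infinite C"
    proof
      assume "finite C"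
      then have "finite (s 0)" using lt[of 0] card_of_ordLeq_finite ordLess_imp_ordLeq by blast
      then show False using A0(2) card_of_ordLeq_finite infinite_UNIV_nat by blast
    qed
    have "|SIGMA n : (UNIV :: nat set). s n| \<le>o |C|"
      using inf lt ordLess_imp_ordLeq by (intro card_of_Sigma_ordLeq_infinite) (auto simp: infinite_iff_card_of_nat)
    then have "\<kappa> \<le>o |C|" using \<kappa>iso ordIso_ordLeq_trans by blast
    then show ?thesis using C not_ordLess_ordLeq by blast
  qed
  show ?thesis
  proof
    show "uncountable_strong_limit \<kappa>"
      unfolding uncountable_strong_limit_def using N lim by (auto simp: \<kappa>_def card_of_Card_order)
    show "\<kappa> <o |UNIV :: 'u set|" by (rule \<kappa>small)
    show "|A| <o \<kappa>" using A0(1) slt[of 0] ordLeq_ordLess_trans by blast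
  qed
qed

end

section \<open>Condensed sets unfolded\<close>

lemma ex1_unique: "\<exists>!x. P x \<Longrightarrow> P a \<Longrightarrow> P b \<Longrightarrow> a = b"
  by blast

abbreviation ED :: "'u topology set" where "ED \<equiv> Obj ExtrDisc"

abbreviation presheaf :: "'u presheaf \<Rightarrow> bool" where
  "presheaf \<equiv> is_functor (op_cat ExtrDisc) small_sets"

abbreviation kan_from :: "'u topology set \<Rightarrow> 'u presheaf \<Rightarrow> bool" where
  "kan_from \<equiv> left_kan_extended_from (op_cat ExtrDisc) small_sets"

lemma ED_iff: "S \<in> Obj (ExtrDisc :: ('u topology, 'u \<Rightarrow> 'u) cat) \<longleftrightarrow>
    small TYPE('u) (topspace S) \<and> compact_space S \<and> Hausdorff_space S \<and>
    extremally_disconnected_space S"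
  by (simp add: ExtrDisc_def)

lemma cmaps_id: "(\<lambda>s\<in>topspace S. s) \<in> cmaps S S"
  unfolding cmaps_def using continuous_map_eq[OF continuous_map_id] by auto

lemma cmaps_comp:
  "f \<in> cmaps R S \<Longrightarrow> g \<in> cmaps S Q \<Longrightarrow> compose (topspace R) g f \<in> cmaps R Q"
  unfolding cmaps_def compose_def
  using continuous_map_eq[OF continuous_map_compose] by fastforce

lemma cmaps_in: "f \<in> cmaps R S \<Longrightarrow> x \<in> topspace R \<Longrightarrow> f x \<in> topspace S"
  by (auto simp: cmaps_def continuous_map_def)

lemma cmaps_ext:
  "f \<in> cmaps R S \<Longrightarrow> g \<in> cmaps R S' \<Longrightarrow> (\<And>x. x \<in> topspace R \<Longrightarrow> f x = g x) \<Longrightarrow> f = g"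
  unfolding cmaps_def by (auto intro: extensionalityI)

lemma cmaps_restrict: "continuous_map R S f \<Longrightarrow> restrict f (topspace R) \<in> cmaps R S"
  unfolding cmaps_def using continuous_map_eq by auto

lemma cmaps_assoc:
  "f \<in> cmaps R S \<Longrightarrow>
   compose (topspace R) h (compose (topspace R) g f) = compose (topspace R) (compose (topspace S) h g) f"
  by (auto simp: compose_def fun_eq_iff restrict_def dest: cmaps_in)

lemma cmaps_comp_id: "f \<in> cmaps R S \<Longrightarrow> compose (topspace R) f (\<lambda>s\<in>topspace R. s) = f"
  by (auto simp: compose_def fun_eq_iff restrict_def cmaps_def extensional_def)

lemma cmaps_id_comp: "f \<in> cmaps R S \<Longrightarrow> compose (topspace R) (\<lambda>s\<in>topspace S. s) f = f"
  by (auto simp: compose_def fun_eq_iff restrict_def cmaps_def extensional_def continuous_map_def)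

lemma presheaf_iff:
  fixes T :: "'u presheaf"
  shows "presheaf T \<longleftrightarrow>
    (\<forall>S\<in>ED. small TYPE('u) (FObj T S)) \<and>
    (\<forall>S\<in>ED. \<forall>R\<in>ED. \<forall>f\<in>cmaps R S. FArr T S R f \<in> FObj T S \<rightarrow>\<^sub>E FObj T R) \<and>
    (\<forall>S\<in>ED. FArr T S S (\<lambda>s\<in>topspace S. s) = (\<lambda>x\<in>FObj T S. x)) \<and>
    (\<forall>S\<in>ED. \<forall>R\<in>ED. \<forall>Q\<in>ED. \<forall>f\<in>cmaps R S. \<forall>g\<in>cmaps Q R.
       FArr T S Q (compose (topspace Q) f g) = compose (FObj T S) (FArr T R Q g) (FArr T S R f))"
  by (simp add: is_functor_def op_cat_def small_sets_def set_cat_def ExtrDisc_def)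

text \<open>The sheaf condition sees a decomposition only through its two inclusions, so the
  homeomorphism is hidden behind an existential.\<close>

definition disj_sum :: "'u topology \<Rightarrow> 'u topology \<Rightarrow> 'u topology \<Rightarrow> ('u \<Rightarrow> 'u) \<Rightarrow> ('u \<Rightarrow> 'u) \<Rightarrow> bool" where
  "disj_sum S1 S2 S i1 i2 \<longleftrightarrow> (\<exists>h.
     homeomorphic_map (sum_topology (\<lambda>b. if b then S2 else S1) UNIV) S h \<and>
     i1 = (\<lambda>s\<in>topspace S1. h (False, s)) \<and> i2 = (\<lambda>s\<in>topspace S2. h (True, s)))"

definition sum_cond :: "'u presheaf \<Rightarrow> bool" where
  "sum_cond T \<longleftrightarrow> (\<forall>S1\<in>ED. \<forall>S2\<in>ED. \<forall>S\<in>ED. \<forall>i1 i2. disj_sum S1 S2 S i1 i2 \<longrightarrow>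
     bij_betw (\<lambda>x. (FArr T S S1 i1 x, FArr T S S2 i2 x)) (FObj T S) (FObj T S1 \<times> FObj T S2))"

lemma condensed_iff:
  "condensed_set T \<longleftrightarrow> presheaf T \<and> small_presheaf T \<and>
     (\<exists>x. FObj T (discrete_topology {}) = {x}) \<and> sum_cond T"
  unfolding condensed_set_def sum_cond_def disj_sum_def Let_def by blast

lemma Obj_CondSet: "Obj CondSet = {T. condensed_set T}"
  by (auto simp: CondSet_def full_subcat_def functor_cat_def condensed_set_def)

lemma Hom_CondSet: "Hom CondSet F G = {\<eta> \<in> extensional ED.
    (\<forall>S\<in>ED. \<eta> S \<in> FObj F S \<rightarrow>\<^sub>E FObj G S) \<and>
    (\<forall>S\<in>ED. \<forall>R\<in>ED. \<forall>f\<in>cmaps R S. \<forall>x\<in>FObj F S. \<eta> R (FArr F S R f x) = FArr G S R f (\<eta> S x))}"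
proof -
  have E: "compose A f g = compose A f' g' \<longleftrightarrow> (\<forall>x\<in>A. f (g x) = f' (g' x))"
    for A :: "'x set" and f :: "'y \<Rightarrow> 'z" and g f' and g' :: "'x \<Rightarrow> 'w"
    by (auto simp: compose_def fun_eq_iff restrict_def)
  show ?thesis
    by (auto simp: CondSet_def full_subcat_def functor_cat_def nat_trans_def op_cat_def
        small_sets_def set_cat_def E PiE_def Pi_def ExtrDisc_def)
qed

lemma Comp_CondSet: "Comp CondSet F G H \<beta> \<alpha> = (\<lambda>S\<in>ED. compose (FObj F S) (\<beta> S) (\<alpha> S))"
  by (simp add: CondSet_def full_subcat_def functor_cat_def small_sets_def set_cat_def op_cat_def)

lemma Ident_CondSet: "Ident CondSet F = (\<lambda>S\<in>ED. \<lambda>x\<in>FObj F S. x)"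
  by (simp add: CondSet_def full_subcat_def functor_cat_def small_sets_def set_cat_def op_cat_def)

lemma Comp_CondSet_apply [simp]:
  "S \<in> ED \<Longrightarrow> x \<in> FObj F S \<Longrightarrow> Comp CondSet F G H \<beta> \<alpha> S x = \<beta> S (\<alpha> S x)"
  by (simp add: Comp_CondSet compose_def)

lemma Ident_CondSet_apply [simp]: "S \<in> ED \<Longrightarrow> x \<in> FObj F S \<Longrightarrow> Ident CondSet F S x = x"
  by (simp add: Ident_CondSet)

lemma hom_in: "\<eta> \<in> Hom CondSet F G \<Longrightarrow> S \<in> ED \<Longrightarrow> x \<in> FObj F S \<Longrightarrow> \<eta> S x \<in> FObj G S"
  by (auto simp: Hom_CondSet)

lemma hom_nat:
  "\<eta> \<in> Hom CondSet F G \<Longrightarrow> S \<in> ED \<Longrightarrow> R \<in> ED \<Longrightarrow> f \<in> cmaps R S \<Longrightarrow> x \<in> FObj F S \<Longrightarrow>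
   \<eta> R (FArr F S R f x) = FArr G S R f (\<eta> S x)"
  by (auto simp: Hom_CondSet)

lemma hom_ext:
  assumes "\<eta> \<in> Hom CondSet F G" "\<theta> \<in> Hom CondSet F G"
    and "\<And>S x. S \<in> ED \<Longrightarrow> x \<in> FObj F S \<Longrightarrow> \<eta> S x = \<theta> S x"
  shows "\<eta> = \<theta>"
proof (rule extensionalityI[of _ ED])
  fix S :: "'a topology" assume S: "S \<in> ED"
  show "\<eta> S = \<theta> S"
    by (rule extensionalityI[of _ "FObj F S"]) (use assms S in \<open>auto simp: Hom_CondSet PiE_def\<close>)
qed (use assms in \<open>auto simp: Hom_CondSet\<close>)

text \<open>Members of \<open>Hom CondSet\<close> are extensional both in the space and in the
  element; this cuts an arbitrary family down to that form.\<close>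

definition mk_hom :: "'u presheaf \<Rightarrow> ('u topology \<Rightarrow> ('u \<Rightarrow> 'u) \<Rightarrow> ('u \<Rightarrow> 'u)) \<Rightarrow>
    'u topology \<Rightarrow> ('u \<Rightarrow> 'u) \<Rightarrow> ('u \<Rightarrow> 'u)" where
  "mk_hom F \<eta> = (\<lambda>S\<in>ED. \<lambda>x\<in>FObj F S. \<eta> S x)"

lemma mk_hom_apply [simp]: "S \<in> ED \<Longrightarrow> x \<in> FObj F S \<Longrightarrow> mk_hom F \<eta> S x = \<eta> S x"
  by (simp add: mk_hom_def)

lemma presheaf_small:
  fixes F :: "'u presheaf"
  assumes "presheaf F" "S \<in> ED"
  shows "small TYPE('u) (FObj F S)"
  using assms by (auto simp: presheaf_iff)

lemma arr_in:
  fixes F :: "'u presheaf"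
  assumes "presheaf F"
    "S \<in> ED" "R \<in> ED" "f \<in> cmaps R S" "x \<in> FObj F S"
  shows "FArr F S R f x \<in> FObj F R"
  using assms unfolding presheaf_iff by blast

lemma arr_id:
  fixes F :: "'u presheaf"
  assumes "presheaf F" "S \<in> ED" "x \<in> FObj F S"
  shows "FArr F S S (\<lambda>s\<in>topspace S. s) x = x"
  using assms by (simp add: presheaf_iff)

lemma arr_comp:
  fixes F :: "'u presheaf"
  assumes "presheaf F"
    "S \<in> ED" "R \<in> ED" "Q \<in> ED" "f \<in> cmaps R S" "g \<in> cmaps Q R" "x \<in> FObj F S"
  shows "FArr F R Q g (FArr F S R f x) = FArr F S Q (compose (topspace Q) f g) x"
  using assms by (simp add: presheaf_iff compose_def)

lemma mk_hom:
  assumes F: "presheaf F"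
    and "\<And>S x. S \<in> ED \<Longrightarrow> x \<in> FObj F S \<Longrightarrow> \<eta> S x \<in> FObj G S"
    and "\<And>S R f x. S \<in> ED \<Longrightarrow> R \<in> ED \<Longrightarrow> f \<in> cmaps R S \<Longrightarrow> x \<in> FObj F S \<Longrightarrow>
           \<eta> R (FArr F S R f x) = FArr G S R f (\<eta> S x)"
  shows "mk_hom F \<eta> \<in> Hom CondSet F G"
  using assms by (auto simp: Hom_CondSet mk_hom_def arr_in[OF F])

lemma hom_comp:
  assumes F: "presheaf F"
    and "\<alpha> \<in> Hom CondSet F G" "\<beta> \<in> Hom CondSet G H"
  shows "Comp CondSet F G H \<beta> \<alpha> \<in> Hom CondSet F H"
proof -
  have "Comp CondSet F G H \<beta> \<alpha> = mk_hom F (\<lambda>S x. \<beta> S (\<alpha> S x))"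
    by (simp add: Comp_CondSet mk_hom_def compose_def)
  also have "\<dots> \<in> Hom CondSet F H"
    using assms by (intro mk_hom) (auto simp: hom_in hom_nat)
  finally show ?thesis .
qed

lemma hom_ident:
  assumes F: "presheaf F"
  shows "Ident CondSet F \<in> Hom CondSet F F"
proof -
  have "Ident CondSet F = mk_hom F (\<lambda>S x. x)" by (simp add: Ident_CondSet mk_hom_def)
  also have "\<dots> \<in> Hom CondSet F F" using F by (intro mk_hom) auto
  finally show ?thesis .
qed

lemma hom_assoc:
  assumes F: "presheaf F"
    and "\<alpha> \<in> Hom CondSet F G" 
  shows "Comp CondSet F G K (Comp CondSet G H K \<gamma> \<beta>) \<alpha> = Comp CondSet F H K \<gamma> (Comp CondSet F G H \<beta> \<alpha>)"
  using assms by (auto simp: Comp_CondSet compose_def fun_eq_iff restrict_def hom_in)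


section \<open>Left Kan extensions of presheaves\<close>

context universe begin

text \<open>Maps into a set with two elements detect whether a universal cocone is jointly
  surjective; the two elements are needed in the type of presheaf values.\<close>

lemma two_set:
  obtains b0 b1 :: "'u \<Rightarrow> 'u" where "b0 \<noteq> b1"
proof -
  obtain u v :: 'u where "u \<noteq> v" using infinite_univ
    by (metis finite.emptyI finite_insert UNIV_eq_I insertCI)
  then have "(\<lambda>_::'u. u) \<noteq> (\<lambda>_. v)" by (auto simp: fun_eq_iff)
  then show ?thesis using that by blast
qed

text \<open>In the opposite category an arrow from a member \<open>a\<close> of \<open>A\<close> to
  \<open>c\<close> is a continuous map \<open>c \<rightarrow> a\<close>. So the condition reads:
  \<open>T(c)\<close> is the colimit of the \<open>T(a)\<close> over all maps from \<open>c\<close>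
  to spaces in \<open>A\<close>, transition maps being restrictions along
  \<open>h : b \<rightarrow> a\<close>.\<close>

lemma kan_unfold:
  fixes T :: "'u presheaf"
  assumes T: "presheaf T" and A: "A \<subseteq> ED"
  shows "kan_from A T \<longleftrightarrow>
    (\<forall>c\<in>ED. \<forall>W :: ('u \<Rightarrow> 'u) set. small TYPE('u) W \<longrightarrow> (\<forall>\<delta>.
       (\<forall>a\<in>A. \<forall>f\<in>cmaps c a. \<delta> (a, f) \<in> FObj T a \<rightarrow>\<^sub>E W) \<and>
       (\<forall>a\<in>A. \<forall>b\<in>A. \<forall>g\<in>cmaps c b. \<forall>h\<in>cmaps b a. \<forall>x\<in>FObj T a.
          \<delta> (b, g) (FArr T a b h x) = \<delta> (a, compose (topspace c) h g) x) \<longrightarrow>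
       (\<exists>!h. h \<in> FObj T c \<rightarrow>\<^sub>E W \<and>
          (\<forall>a\<in>A. \<forall>f\<in>cmaps c a. \<forall>x\<in>FObj T a. h (FArr T a c f x) = \<delta> (a, f) x))))"
    (is "?L \<longleftrightarrow> (\<forall>c\<in>ED. ?R c)")
proof -
  let ?J = "over_cat (op_cat ExtrDisc) A"
  let ?F = "comp_func T over_proj"
  have cocone: "is_cocone (?J c) small_sets ?F W \<delta> \<longleftrightarrow> small TYPE('u) W \<and>
       (\<forall>a\<in>A. \<forall>f\<in>cmaps c a. \<delta> (a, f) \<in> FObj T a \<rightarrow>\<^sub>E W) \<and>
       (\<forall>a\<in>A. \<forall>b\<in>A. \<forall>g\<in>cmaps c b. \<forall>h\<in>cmaps b a. \<forall>x\<in>FObj T a.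
          \<delta> (b, g) (FArr T a b h x) = \<delta> (a, compose (topspace c) h g) x)"
    (is "_ \<longleftrightarrow> ?C c W \<delta>") if c: "c \<in> ED" for c W \<delta>
  proof -
    have *: "is_cocone (?J c) small_sets ?F W \<delta> \<longleftrightarrow> small TYPE('u) W \<and>
       (\<forall>a\<in>A. \<forall>f\<in>cmaps c a. \<delta> (a, f) \<in> FObj T a \<rightarrow>\<^sub>E W) \<and>
       (\<forall>a\<in>A. \<forall>f\<in>cmaps c a. \<forall>b\<in>A. \<forall>g\<in>cmaps c b. \<forall>h\<in>cmaps b a. compose (topspace c) h g = f \<longrightarrow>
          compose (FObj T a) (\<delta> (b, g)) (FArr T a b h) = \<delta> (a, f))"
      by (auto simp: is_cocone_def over_cat_def over_proj_def comp_func_def small_sets_def set_cat_def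
          op_cat_def ExtrDisc_def)
    also have "\<dots> \<longleftrightarrow> ?C c W \<delta>"
    proof (intro conj_cong refl iffI ballI impI)
      fix a b g h x
      assume "\<forall>a\<in>A. \<forall>f\<in>cmaps c a. \<forall>b\<in>A. \<forall>g\<in>cmaps c b. \<forall>h\<in>cmaps b a. compose (topspace c) h g = f \<longrightarrow>
          compose (FObj T a) (\<delta> (b, g)) (FArr T a b h) = \<delta> (a, f)"
        "a \<in> A" "b \<in> A" "g \<in> cmaps c b" "h \<in> cmaps b a" "x \<in> FObj T a"
      then have "compose (FObj T a) (\<delta> (b, g)) (FArr T a b h) = \<delta> (a, compose (topspace c) h g)"
        using cmaps_comp by blast
      from fun_cong[OF this, of x] show "\<delta> (b, g) (FArr T a b h x) = \<delta> (a, compose (topspace c) h g) x"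
        using \<open>x \<in> FObj T a\<close> by (simp add: compose_def)
    next
      fix a f b g h
      assume "\<forall>a\<in>A. \<forall>f\<in>cmaps c a. \<delta> (a, f) \<in> FObj T a \<rightarrow>\<^sub>E W"
        "\<forall>a\<in>A. \<forall>b\<in>A. \<forall>g\<in>cmaps c b. \<forall>h\<in>cmaps b a. \<forall>x\<in>FObj T a.
          \<delta> (b, g) (FArr T a b h x) = \<delta> (a, compose (topspace c) h g) x"
        "a \<in> A" "f \<in> cmaps c a" "b \<in> A" "g \<in> cmaps c b" "h \<in> cmaps b a" "compose (topspace c) h g = f"
      then show "compose (FObj T a) (\<delta> (b, g)) (FArr T a b h) = \<delta> (a, f)"
        by (intro extensionalityI[of _ "FObj T a"]) (auto simp: PiE_def compose_def)
    qed
    finally show ?thesis .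
  qed
  \<comment> \<open>Functoriality alone makes the restriction maps a cocone, so only universality
    remains as a condition.\<close>
  have self: "?C c (FObj T c) (\<lambda>(a, f). FArr T a c f)" if c: "c \<in> ED" for c
  proof (intro conjI ballI)
    show "small TYPE('u) (FObj T c)" using presheaf_small[OF T c] .
  next
    fix a f assume "a \<in> A" "f \<in> cmaps c a"
    then show "(\<lambda>(a, f). FArr T a c f) (a, f) \<in> FObj T a \<rightarrow>\<^sub>E FObj T c"
      using T[unfolded presheaf_iff] A c by (metis (no_types, lifting) case_prod_conv subsetD)
  next
    fix a b g h x assume "a \<in> A" "b \<in> A" "g \<in> cmaps c b" "h \<in> cmaps b a" "x \<in> FObj T a"
    then show "(\<lambda>(a, f). FArr T a c f) (b, g) (FArr T a b h x) =
        (\<lambda>(a, f). FArr T a c f) (a, compose (topspace c) h g) x"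
      using A c by (auto simp: arr_comp[OF T] subset_iff)
  qed
  have ex1: "(\<exists>!h. h \<in> Hom small_sets (FObj T c) W \<and> (\<forall>j\<in>Obj (?J c).
       Comp small_sets (FObj ?F j) (FObj T c) W h ((\<lambda>(a, f). FArr T a c f) j) = \<delta> j)) \<longleftrightarrow>
     (\<exists>!h. h \<in> FObj T c \<rightarrow>\<^sub>E W \<and>
          (\<forall>a\<in>A. \<forall>f\<in>cmaps c a. \<forall>x\<in>FObj T a. h (FArr T a c f x) = \<delta> (a, f) x))"
    if "c \<in> ED" "?C c W \<delta>" for c W \<delta>
  proof (rule arg_cong[where f = Ex1], rule ext, rule conj_cong)
    fix h
    have "compose (FObj T a) h (FArr T a c f) = \<delta> (a, f) \<longleftrightarrow> (\<forall>x\<in>FObj T a. h (FArr T a c f x) = \<delta> (a, f) x)"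
      if "a \<in> A" "f \<in> cmaps c a" for a f
      using \<open>?C c W \<delta>\<close> that
      by (auto simp: compose_def fun_eq_iff PiE_def restrict_def extensional_def)
    then show "(\<forall>j\<in>Obj (?J c). Comp small_sets (FObj ?F j) (FObj T c) W h ((\<lambda>(a, f). FArr T a c f) j) = \<delta> j)
      \<longleftrightarrow> (\<forall>a\<in>A. \<forall>f\<in>cmaps c a. \<forall>x\<in>FObj T a. h (FArr T a c f x) = \<delta> (a, f) x)"
      by (auto simp: over_cat_def over_proj_def comp_func_def small_sets_def set_cat_def
          op_cat_def ExtrDisc_def)
  qed (simp add: small_sets_def set_cat_def)
  have "is_colimit (?J c) small_sets ?F (FObj T c) (\<lambda>(a, f). FArr T a c f) \<longleftrightarrow> ?R c" if c: "c \<in> ED" for c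
  proof -
    have 1: "is_cocone (?J c) small_sets ?F (FObj T c) (\<lambda>(a, f). FArr T a c f)"
      unfolding cocone[OF c] using self[OF c] .
    have 2: "(is_cocone (?J c) small_sets ?F W \<delta> \<longrightarrow> (\<exists>!h. h \<in> Hom small_sets (FObj T c) W \<and> (\<forall>j\<in>Obj (?J c).
       Comp small_sets (FObj ?F j) (FObj T c) W h ((\<lambda>(a, f). FArr T a c f) j) = \<delta> j))) \<longleftrightarrow>
      (?C c W \<delta> \<longrightarrow> (\<exists>!h. h \<in> FObj T c \<rightarrow>\<^sub>E W \<and>
          (\<forall>a\<in>A. \<forall>f\<in>cmaps c a. \<forall>x\<in>FObj T a. h (FArr T a c f x) = \<delta> (a, f) x)))" for W \<delta>
      unfolding cocone[OF c] using ex1[OF c, of W \<delta>] by (intro imp_cong refl)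
    have "?R c \<longleftrightarrow> (\<forall>W \<delta>. ?C c W \<delta> \<longrightarrow> (\<exists>!h. h \<in> FObj T c \<rightarrow>\<^sub>E W \<and>
          (\<forall>a\<in>A. \<forall>f\<in>cmaps c a. \<forall>x\<in>FObj T a. h (FArr T a c f x) = \<delta> (a, f) x)))"
      by (simp only: imp_conjL all_simps)
    then show ?thesis unfolding is_colimit_def 2 using 1 by (simp only: simp_thms)
  qed
  then show ?thesis
    unfolding left_kan_extended_from_def by (simp add: op_cat_def)
qed

lemma kan_ex1:
  fixes T :: "'u presheaf"
  assumes T: "presheaf T" and A: "A \<subseteq> ED"
    and kan: "kan_from A T"
    and c: "c \<in> ED" and W: "small TYPE('u) (W :: ('u \<Rightarrow> 'u) set)"
    and "\<forall>a\<in>A. \<forall>f\<in>cmaps c a. \<delta> (a, f) \<in> FObj T a \<rightarrow>\<^sub>E W"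
    and "\<forall>a\<in>A. \<forall>b\<in>A. \<forall>g\<in>cmaps c b. \<forall>h\<in>cmaps b a. \<forall>x\<in>FObj T a.
          \<delta> (b, g) (FArr T a b h x) = \<delta> (a, compose (topspace c) h g) x"
  shows "\<exists>!h. h \<in> FObj T c \<rightarrow>\<^sub>E W \<and>
          (\<forall>a\<in>A. \<forall>f\<in>cmaps c a. \<forall>x\<in>FObj T a. h (FArr T a c f x) = \<delta> (a, f) x)"
  using kan[unfolded kan_unfold[OF T A], THEN bspec, OF c, THEN spec, THEN mp, OF W, THEN spec, THEN mp,
      OF conjI, OF assms(6,7)] .

text \<open>The constant map \<open>b0\<close> and the map that takes the value \<open>b1\<close>
  exactly off the joint image both extend the constant cocone. By uniqueness they coincide, so
  nothing lies off the image.\<close>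

lemma kan_surj:
  fixes T :: "'u presheaf"
  assumes T: "presheaf T" and A: "A \<subseteq> ED"
    and kan: "kan_from A T"
    and c: "c \<in> ED" "y \<in> FObj T c"
  shows "\<exists>a\<in>A. \<exists>f\<in>cmaps c a. \<exists>x\<in>FObj T a. FArr T a c f x = y"
proof -
  obtain b0 b1 :: "'u \<Rightarrow> 'u" where b: "b0 \<noteq> b1" using two_set .
  let ?P = "\<lambda>y. \<exists>a\<in>A. \<exists>f\<in>cmaps c a. \<exists>x\<in>FObj T a. FArr T a c f x = y"
  let ?\<delta> = "\<lambda>(a, f). \<lambda>x\<in>FObj T a. b0"
  have 1: "\<exists>!h. h \<in> FObj T c \<rightarrow>\<^sub>E {b0, b1} \<and>
          (\<forall>a\<in>A. \<forall>f\<in>cmaps c a. \<forall>x\<in>FObj T a. h (FArr T a c f x) = ?\<delta> (a, f) x)"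
  proof (rule kan_ex1[OF T A kan c(1)])
    show "\<forall>a\<in>A. \<forall>b\<in>A. \<forall>g\<in>cmaps c b. \<forall>h\<in>cmaps b a. \<forall>x\<in>FObj T a.
          ?\<delta> (b, g) (FArr T a b h x) = ?\<delta> (a, compose (topspace c) h g) x"
      using A by (auto simp: arr_in[OF T] subset_iff)
  qed (auto simp: small_finite)
  have 2: "(\<lambda>y\<in>FObj T c. b0) \<in> FObj T c \<rightarrow>\<^sub>E {b0, b1} \<and>
          (\<forall>a\<in>A. \<forall>f\<in>cmaps c a. \<forall>x\<in>FObj T a. (\<lambda>y\<in>FObj T c. b0) (FArr T a c f x) = ?\<delta> (a, f) x)"
    using A c by (auto simp: arr_in[OF T] subset_iff)
  have 3: "(\<lambda>y\<in>FObj T c. if ?P y then b0 else b1) \<in> FObj T c \<rightarrow>\<^sub>E {b0, b1} \<and>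
          (\<forall>a\<in>A. \<forall>f\<in>cmaps c a. \<forall>x\<in>FObj T a. (\<lambda>y\<in>FObj T c. if ?P y then b0 else b1) (FArr T a c f x) = ?\<delta> (a, f) x)"
    using A c by (auto simp: arr_in[OF T] subset_iff)
  have "(\<lambda>y\<in>FObj T c. b0) = (\<lambda>y\<in>FObj T c. if ?P y then b0 else b1)"
    by (rule ex1_unique[OF 1, OF 2 3])
  from fun_cong[OF this, of y] show ?thesis using c b by (auto split: if_splits)
qed

lemma kan_ex:
  fixes T :: "'u presheaf"
  assumes T: "presheaf T" and A: "A \<subseteq> ED"
    and kan: "kan_from A T"
    and c: "c \<in> ED" and W: "small TYPE('u) (W :: ('u \<Rightarrow> 'u) set)"
    and \<delta>: "\<And>a f x. a \<in> A \<Longrightarrow> f \<in> cmaps c a \<Longrightarrow> x \<in> FObj T a \<Longrightarrow> \<delta> a f x \<in> W"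
    and compat: "\<And>a b g h x. a \<in> A \<Longrightarrow> b \<in> A \<Longrightarrow> g \<in> cmaps c b \<Longrightarrow> h \<in> cmaps b a \<Longrightarrow> x \<in> FObj T a \<Longrightarrow>
          \<delta> b g (FArr T a b h x) = \<delta> a (compose (topspace c) h g) x"
  shows "\<exists>h. (\<forall>y\<in>FObj T c. h y \<in> W) \<and>
    (\<forall>a\<in>A. \<forall>f\<in>cmaps c a. \<forall>x\<in>FObj T a. h (FArr T a c f x) = \<delta> a f x)"
proof -
  let ?\<delta> = "\<lambda>(a, f). \<lambda>x\<in>FObj T a. \<delta> a f x"
  have "\<exists>!h. h \<in> FObj T c \<rightarrow>\<^sub>E W \<and>
          (\<forall>a\<in>A. \<forall>f\<in>cmaps c a. \<forall>x\<in>FObj T a. h (FArr T a c f x) = ?\<delta> (a, f) x)"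
  proof (rule kan_ex1[OF T A kan c W])
    show "\<forall>a\<in>A. \<forall>b\<in>A. \<forall>g\<in>cmaps c b. \<forall>h\<in>cmaps b a. \<forall>x\<in>FObj T a.
          ?\<delta> (b, g) (FArr T a b h x) = ?\<delta> (a, compose (topspace c) h g) x"
      using A compat by (auto simp: arr_in[OF T] subset_iff)
  qed (use \<delta> in auto)
  then obtain h where "h \<in> FObj T c \<rightarrow>\<^sub>E W"
    "\<forall>a\<in>A. \<forall>f\<in>cmaps c a. \<forall>x\<in>FObj T a. h (FArr T a c f x) = ?\<delta> (a, f) x"
    by blast
  then show ?thesis by (intro exI[of _ h]) auto
qed

text \<open>Joint surjectivity forces uniqueness of the mediating map and also puts its values into
  \<open>W\<close>. What is left to supply is some function with the right values on
  restrictions.\<close>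

lemma kanI:
  fixes T :: "'u presheaf"
  assumes T: "presheaf T" and A: "A \<subseteq> ED"
    and surj: "\<And>c y. c \<in> ED \<Longrightarrow> y \<in> FObj T c \<Longrightarrow> \<exists>a\<in>A. \<exists>f\<in>cmaps c a. \<exists>x\<in>FObj T a. FArr T a c f x = y"
    and ex: "\<And>c (W :: ('u \<Rightarrow> 'u) set) \<delta>. c \<in> ED \<Longrightarrow> small TYPE('u) W \<Longrightarrow>
      (\<And>a f x. a \<in> A \<Longrightarrow> f \<in> cmaps c a \<Longrightarrow> x \<in> FObj T a \<Longrightarrow> \<delta> a f x \<in> W) \<Longrightarrow>
      (\<And>a b g h x. a \<in> A \<Longrightarrow> b \<in> A \<Longrightarrow> g \<in> cmaps c b \<Longrightarrow> h \<in> cmaps b a \<Longrightarrow> x \<in> FObj T a \<Longrightarrow>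
          \<delta> b g (FArr T a b h x) = \<delta> a (compose (topspace c) h g) x) \<Longrightarrow>
      \<exists>h. (\<forall>a\<in>A. \<forall>f\<in>cmaps c a. \<forall>x\<in>FObj T a. h (FArr T a c f x) = \<delta> a f x)"
  shows "kan_from A T"
  unfolding kan_unfold[OF T A]
proof (intro ballI allI impI)
  fix c :: "'u topology" and W :: "('u \<Rightarrow> 'u) set" and \<delta>
  assume c: "c \<in> ED" and W: "small TYPE('u) W"
    and *: "(\<forall>a\<in>A. \<forall>f\<in>cmaps c a. \<delta> (a, f) \<in> FObj T a \<rightarrow>\<^sub>E W) \<and>
       (\<forall>a\<in>A. \<forall>b\<in>A. \<forall>g\<in>cmaps c b. \<forall>h\<in>cmaps b a. \<forall>x\<in>FObj T a.
          \<delta> (b, g) (FArr T a b h x) = \<delta> (a, compose (topspace c) h g) x)"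
  have "\<exists>h. (\<forall>a\<in>A. \<forall>f\<in>cmaps c a. \<forall>x\<in>FObj T a. h (FArr T a c f x) = \<delta> (a, f) x)"
    by (rule ex[OF c W, of "\<lambda>a f. \<delta> (a, f)"]) (use * in blast)+
  then obtain h where h: "\<And>a f x. a \<in> A \<Longrightarrow> f \<in> cmaps c a \<Longrightarrow> x \<in> FObj T a \<Longrightarrow> h (FArr T a c f x) = \<delta> (a, f) x"
    by blast
  have hW: "h y \<in> W" if y: "y \<in> FObj T c" for y
  proof -
    obtain a f x where "a \<in> A" "f \<in> cmaps c a" "x \<in> FObj T a" "FArr T a c f x = y"
      using surj[OF c y] by blast
    then have "h y = \<delta> (a, f) x" "\<delta> (a, f) \<in> FObj T a \<rightarrow>\<^sub>E W" using h * by blast+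
    then show ?thesis using \<open>x \<in> FObj T a\<close> by auto
  qed
  show "\<exists>!h. h \<in> FObj T c \<rightarrow>\<^sub>E W \<and>
          (\<forall>a\<in>A. \<forall>f\<in>cmaps c a. \<forall>x\<in>FObj T a. h (FArr T a c f x) = \<delta> (a, f) x)"
  proof (rule ex1I[of _ "restrict h (FObj T c)"])
    show "restrict h (FObj T c) \<in> FObj T c \<rightarrow>\<^sub>E W \<and>
          (\<forall>a\<in>A. \<forall>f\<in>cmaps c a. \<forall>x\<in>FObj T a. restrict h (FObj T c) (FArr T a c f x) = \<delta> (a, f) x)"
      using hW h A c by (auto simp: arr_in[OF T] subset_iff)
  next
    fix k assume k: "k \<in> FObj T c \<rightarrow>\<^sub>E W \<and>
          (\<forall>a\<in>A. \<forall>f\<in>cmaps c a. \<forall>x\<in>FObj T a. k (FArr T a c f x) = \<delta> (a, f) x)"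
    show "k = restrict h (FObj T c)"
    proof (rule extensionalityI[of _ "FObj T c"])
      fix y assume y: "y \<in> FObj T c"
      obtain a f x where "a \<in> A" "f \<in> cmaps c a" "x \<in> FObj T a" "FArr T a c f x = y"
        using surj[OF c y] by blast
      then have "h y = \<delta> (a, f) x" "k y = \<delta> (a, f) x" using h k by blast+
      then show "k y = restrict h (FObj T c) y" using y by simp
    qed (use k in \<open>auto simp: PiE_def\<close>)
  qed
qed

text \<open>Serves to raise \<open>\<kappa>\<close>. An element over \<open>b\<close> in
  \<open>B\<close> is itself restricted from some \<open>a\<close> in \<open>A\<close> along
  \<open>p : b \<rightarrow> a\<close>, so the compatibility of a cocone over \<open>B\<close>
  determines its value there from its part over \<open>A\<close>.\<close>

lemma kan_superset:
  fixes T :: "'u presheaf"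
  assumes T: "presheaf T" and B: "B \<subseteq> ED" and AB: "A \<subseteq> B"
    and kan: "kan_from A T"
  shows "kan_from B T"
proof (rule kanI[OF T B])
  have A: "A \<subseteq> ED" using B AB by blast
  fix c y assume "c \<in> ED" "y \<in> FObj T c"
  then have "\<exists>a\<in>A. \<exists>f\<in>cmaps c a. \<exists>x\<in>FObj T a. FArr T a c f x = y"
    by (rule kan_surj[OF T A kan])
  then show "\<exists>a\<in>B. \<exists>f\<in>cmaps c a. \<exists>x\<in>FObj T a. FArr T a c f x = y"
    using AB by blast
next
  have A: "A \<subseteq> ED" using B AB by blast
  fix c and W :: "('u \<Rightarrow> 'u) set" and \<delta> :: "'u topology \<Rightarrow> ('u \<Rightarrow> 'u) \<Rightarrow> ('u \<Rightarrow> 'u) \<Rightarrow> 'u \<Rightarrow> 'u"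
  assume c: "c \<in> ED" and W: "small TYPE('u) W"
    and \<delta>: "\<And>a f x. a \<in> B \<Longrightarrow> f \<in> cmaps c a \<Longrightarrow> x \<in> FObj T a \<Longrightarrow> \<delta> a f x \<in> W"
    and compat: "\<And>a b g h x. a \<in> B \<Longrightarrow> b \<in> B \<Longrightarrow> g \<in> cmaps c b \<Longrightarrow> h \<in> cmaps b a \<Longrightarrow> x \<in> FObj T a \<Longrightarrow>
          \<delta> b g (FArr T a b h x) = \<delta> a (compose (topspace c) h g) x"
  obtain h where h: "\<And>a f x. a \<in> A \<Longrightarrow> f \<in> cmaps c a \<Longrightarrow> x \<in> FObj T a \<Longrightarrow> h (FArr T a c f x) = \<delta> a f x"
  proof -
    have 1: "\<delta> a f x \<in> W" if "a \<in> A" "f \<in> cmaps c a" "x \<in> FObj T a" for a f x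
      using \<delta> that AB by blast
    have 2: "\<delta> b g (FArr T a b h x) = \<delta> a (compose (topspace c) h g) x"
      if "a \<in> A" "b \<in> A" "g \<in> cmaps c b" "h \<in> cmaps b a" "x \<in> FObj T a" for a b g h x
      using compat that AB by blast
    show ?thesis using kan_ex[OF T A kan c W, of \<delta>, OF 1 2] that by blast
  qed
  have "h (FArr T b c f x) = \<delta> b f x" if b: "b \<in> B" "f \<in> cmaps c b" "x \<in> FObj T b" for b f x
  proof -
    obtain a p z where a: "a \<in> A" "p \<in> cmaps b a" "z \<in> FObj T a" "FArr T a b p z = x"
      using kan_surj[OF T A kan, of b x] b B by blast
    have "FArr T b c f x = FArr T a c (compose (topspace c) p f) z"
      using a b c A B by (auto simp: arr_comp[OF T] subset_iff)
    then have "h (FArr T b c f x) = \<delta> a (compose (topspace c) p f) z"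
      using h[OF a(1) cmaps_comp[OF b(2) a(2)] a(3)] by simp
    also have "\<dots> = \<delta> b f x" using compat[OF _ b(1,2) a(2,3)] a(1,4) AB by auto
    finally show ?thesis .
  qed
  then show "\<exists>h. \<forall>a\<in>B. \<forall>f\<in>cmaps c a. \<forall>x\<in>FObj T a. h (FArr T a c f x) = \<delta> a f x" by blast
qed

definition small_ED :: "'u rel \<Rightarrow> 'u topology set" where
  "small_ED \<kappa> = {S \<in> ED. |topspace S| <o \<kappa>}"

lemma small_ED_subset: "small_ED \<kappa> \<subseteq> ED"
  by (auto simp: small_ED_def)

lemma small_presheaf_iff:
  "small_presheaf T \<longleftrightarrow> (\<exists>\<kappa> :: 'u rel. uncountable_strong_limit \<kappa> \<and> \<kappa> <o |UNIV :: 'u set| \<and>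
     kan_from (small_ED \<kappa>) T)"
  by (simp add: small_presheaf_def small_ED_def)

end

section \<open>Pointwise quotients of families of condensed sets\<close>

lemma disj_sum_cmaps:
  assumes "disj_sum S1 S2 S i1 i2"
  shows "i1 \<in> cmaps S1 S" "i2 \<in> cmaps S2 S"
proof -
  obtain h where h: "homeomorphic_map (sum_topology (\<lambda>b. if b then S2 else S1) UNIV) S h"
    and i: "i1 = (\<lambda>s\<in>topspace S1. h (False, s))" "i2 = (\<lambda>s\<in>topspace S2. h (True, s))"
    using assms unfolding disj_sum_def by blast
  note c = continuous_map_compose[OF continuous_map_component_injection homeomorphic_imp_continuous_map[OF h]]
  show "i1 \<in> cmaps S1 S" using c[of False] cmaps_restrict unfolding i by (fastforce simp: o_def)
  show "i2 \<in> cmaps S2 S" using c[of True] cmaps_restrict unfolding i by (fastforce simp: o_def)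
qed

lemma sum_cond_ex:
  assumes "sum_cond T" "S1 \<in> ED" "S2 \<in> ED" "S \<in> ED" "disj_sum S1 S2 S i1 i2"
    "x1 \<in> FObj T S1" "x2 \<in> FObj T S2"
  shows "\<exists>x\<in>FObj T S. FArr T S S1 i1 x = x1 \<and> FArr T S S2 i2 x = x2"
proof -
  have "bij_betw (\<lambda>x. (FArr T S S1 i1 x, FArr T S S2 i2 x)) (FObj T S) (FObj T S1 \<times> FObj T S2)"
    using assms unfolding sum_cond_def by blast
  then have "(x1, x2) \<in> (\<lambda>x. (FArr T S S1 i1 x, FArr T S S2 i2 x)) ` FObj T S"
    using assms(6,7) unfolding bij_betw_def by (elim conjE) simp
  then show ?thesis by auto
qed

lemma sum_cond_unique:
  assumes "sum_cond T" "S1 \<in> ED" "S2 \<in> ED" "S \<in> ED" "disj_sum S1 S2 S i1 i2"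
    "x \<in> FObj T S" "y \<in> FObj T S"
    "FArr T S S1 i1 x = FArr T S S1 i1 y" "FArr T S S2 i2 x = FArr T S S2 i2 y"
  shows "x = y"
proof -
  have "bij_betw (\<lambda>x. (FArr T S S1 i1 x, FArr T S S2 i2 x)) (FObj T S) (FObj T S1 \<times> FObj T S2)"
    using assms unfolding sum_cond_def by blast
  then have "inj_on (\<lambda>x. (FArr T S S1 i1 x, FArr T S S2 i2 x)) (FObj T S)"
    by (rule bij_betw_imp_inj_on)
  then show ?thesis using assms(6-9) by (auto dest: inj_onD)
qed

lemma CondSet_functor: "T \<in> Obj CondSet \<Longrightarrow> presheaf T"
  by (simp add: Obj_CondSet condensed_iff)

lemma CondSet_sum: "T \<in> Obj CondSet \<Longrightarrow> sum_cond T"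
  by (simp add: Obj_CondSet condensed_iff)

lemma CondSet_small: "T \<in> Obj CondSet \<Longrightarrow> small_presheaf T"
  by (simp add: Obj_CondSet condensed_iff)

lemma CondSet_empty: "T \<in> Obj CondSet \<Longrightarrow> \<exists>x. FObj T (discrete_topology {}) = {x}"
  by (simp add: Obj_CondSet condensed_iff)

lemma (in universe) empty_ED: "(discrete_topology {} :: 'u topology) \<in> ED"
  by (simp add: ED_iff small_finite extremally_disconnected_space_def)

lemma (in universe) common_kappa:
  fixes F :: "'i \<Rightarrow> 'u presheaf"
  assumes I: "small TYPE('u) I" and F: "\<And>i. i \<in> I \<Longrightarrow> F i \<in> Obj CondSet"
  shows "\<exists>\<kappa> :: 'u rel. uncountable_strong_limit \<kappa> \<and> \<kappa> <o |UNIV :: 'u set| \<and>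
     (\<forall>i\<in>I. kan_from (small_ED \<kappa>) (F i))"
proof -
  have "\<forall>i\<in>I. \<exists>\<kappa> :: 'u rel. uncountable_strong_limit \<kappa> \<and> \<kappa> <o |UNIV :: 'u set| \<and>
     kan_from (small_ED \<kappa>) (F i)"
    using CondSet_small[OF F] unfolding small_presheaf_iff by blast
  then obtain k :: "'i \<Rightarrow> 'u rel" where
    k: "\<And>i. i \<in> I \<Longrightarrow> uncountable_strong_limit (k i)" "\<And>i. i \<in> I \<Longrightarrow> k i <o |UNIV :: 'u set|"
      "\<And>i. i \<in> I \<Longrightarrow> kan_from (small_ED (k i)) (F i)"
    by metis
  have iso: "|Field (k i)| =o k i" if "i \<in> I" for i
    using k(1)[OF that] by (simp add: uncountable_strong_limit_def card_of_Field_ordIso)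
  have "small TYPE('u) (Field (k i))" if "i \<in> I" for i
    unfolding small_def using iso k(2) that ordIso_ordLess_trans by blast
  then have "small TYPE('u) (SIGMA i:I. Field (k i))" using I by (rule small_Sigma[rotated])
  then obtain \<kappa> :: "'u rel" where \<kappa>: "uncountable_strong_limit \<kappa>" "\<kappa> <o |UNIV :: 'u set|"
    "|SIGMA i:I. Field (k i)| <o \<kappa>"
    using exists_strong_limit by blast
  have "kan_from (small_ED \<kappa>) (F i)" if i: "i \<in> I" for i
  proof (rule kan_superset[OF CondSet_functor[OF F[OF i]] small_ED_subset _ k(3)[OF i]])
    have "|Field (k i)| \<le>o |SIGMA i:I. Field (k i)|"
      by (rule card_of_ordLeqI[of "Pair i"]) (use i in \<open>auto simp: inj_on_def\<close>)
    then have "k i <o \<kappa>"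
      using iso[OF i] \<kappa>(3) ordIso_symmetric ordIso_ordLeq_trans ordLeq_ordLess_trans by blast
    then show "small_ED (k i) \<subseteq> small_ED \<kappa>"
      unfolding small_ED_def using ordLess_transitive by blast
  qed
  then show ?thesis using \<kappa> by blast
qed

text \<open>Common frame for filtered colimits (\<open>I\<close> the objects of the index category)
  and coequalizers (\<open>I\<close> a point). \<open>D S\<close> collects all elements over
  \<open>S\<close>, \<open>\<rho>\<close> generates the identifications and \<open>r\<close> is the
  resulting equivalence. \<open>rho_descends\<close> says that generating pairs are restricted from
  pairs over \<open>\<kappa>\<close>-small spaces, which makes the quotient left Kan extended.
  \<open>r_sum_surj\<close> and \<open>r_sum_inj\<close> express siftedness on elements: two
  elements over different summands can be moved to a common index, and equivalence over both
  summands implies equivalence over the sum.\<close>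

locale presheaf_quotient = universe TU for TU :: "'u itself" +
  fixes I :: "'i set" and F :: "'i \<Rightarrow> 'u presheaf" and \<kappa> :: "'u rel"
    and D :: "'u topology \<Rightarrow> ('i \<times> ('u \<Rightarrow> 'u)) set"
    and \<rho> r :: "'u topology \<Rightarrow> (('i \<times> ('u \<Rightarrow> 'u)) \<times> ('i \<times> ('u \<Rightarrow> 'u))) set"
  assumes I_small: "small TYPE('u) I" and I_ne: "I \<noteq> {}"
    and D_def: "D = (\<lambda>S. SIGMA i:I. FObj (F i) S)"
    and F: "\<And>i. i \<in> I \<Longrightarrow> F i \<in> Obj CondSet"
    and kappa: "uncountable_strong_limit \<kappa>" "\<kappa> <o |UNIV :: 'u set|"
    and kan: "\<And>i. i \<in> I \<Longrightarrow> kan_from (small_ED \<kappa>) (F i)"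
    and r_equiv: "\<And>S. S \<in> ED \<Longrightarrow> equiv (D S) (r S)"
    and r_arr: "\<And>S R f i x j y. S \<in> ED \<Longrightarrow> R \<in> ED \<Longrightarrow> f \<in> cmaps R S \<Longrightarrow> ((i, x), (j, y)) \<in> r S \<Longrightarrow>
      ((i, FArr (F i) S R f x), (j, FArr (F j) S R f y)) \<in> r R"
    and r_gen: "\<And>S. S \<in> ED \<Longrightarrow> r S \<subseteq> (\<rho> S \<union> (\<rho> S)\<inverse>)\<^sup>*"
    and rho_r: "\<And>S. S \<in> ED \<Longrightarrow> \<rho> S \<subseteq> r S"
    and rho_descends: "\<And>c i z j z'. c \<in> ED \<Longrightarrow> ((i, z), (j, z')) \<in> \<rho> c \<Longrightarrow>
      \<exists>a\<in>small_ED \<kappa>. \<exists>f\<in>cmaps c a. \<exists>w w'. ((i, w), (j, w')) \<in> \<rho> a \<and>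
        z = FArr (F i) a c f w \<and> z' = FArr (F j) a c f w'"
    and r_empty: "\<And>x y. x \<in> D (discrete_topology {}) \<Longrightarrow> y \<in> D (discrete_topology {}) \<Longrightarrow>
      (x, y) \<in> r (discrete_topology {})"
    and r_sum_surj: "\<And>S1 S2 i x j y. S1 \<in> ED \<Longrightarrow> S2 \<in> ED \<Longrightarrow> (i, x) \<in> D S1 \<Longrightarrow> (j, y) \<in> D S2 \<Longrightarrow>
      \<exists>k z z'. ((i, x), (k, z)) \<in> r S1 \<and> ((j, y), (k, z')) \<in> r S2"
    and r_sum_inj: "\<And>S1 S2 S i1 i2 i x j y. S1 \<in> ED \<Longrightarrow> S2 \<in> ED \<Longrightarrow> S \<in> ED \<Longrightarrow> disj_sum S1 S2 S i1 i2 \<Longrightarrow>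
      (i, x) \<in> D S \<Longrightarrow> (j, y) \<in> D S \<Longrightarrow>
      ((i, FArr (F i) S S1 i1 x), (j, FArr (F j) S S1 i1 y)) \<in> r S1 \<Longrightarrow>
      ((i, FArr (F i) S S2 i2 x), (j, FArr (F j) S S2 i2 y)) \<in> r S2 \<Longrightarrow>
      ((i, x), (j, y)) \<in> r S"
begin

lemmas Ff = CondSet_functor[OF F]

lemma D_iff: "(i, x) \<in> D S \<longleftrightarrow> i \<in> I \<and> x \<in> FObj (F i) S"
  by (auto simp: D_def)

lemma D_small: "S \<in> ED \<Longrightarrow> small TYPE('u) (D S)"
  unfolding D_def by (intro small_Sigma I_small presheaf_small[OF Ff])

lemma r_D: "S \<in> ED \<Longrightarrow> (p, q) \<in> r S \<Longrightarrow> p \<in> D S \<and> q \<in> D S"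
  using r_equiv by (metis equiv_class_eq_iff)

lemma arr_D: "S \<in> ED \<Longrightarrow> R \<in> ED \<Longrightarrow> f \<in> cmaps R S \<Longrightarrow> (i, x) \<in> D S \<Longrightarrow> (i, FArr (F i) S R f x) \<in> D R"
  by (auto simp: D_iff arr_in[OF Ff])

text \<open>A simultaneous choice, for all spaces, of codes in \<open>'u \<Rightarrow> 'u\<close>
  for the classes of \<open>r\<close>.\<close>

definition cls :: "'u topology \<Rightarrow> 'i \<times> ('u \<Rightarrow> 'u) \<Rightarrow> ('u \<Rightarrow> 'u)" where
  "cls = (SOME \<pi>. \<forall>S\<in>ED. small TYPE('u) (\<pi> S ` D S) \<and>
     (\<forall>p\<in>D S. \<forall>q\<in>D S. \<pi> S p = \<pi> S q \<longleftrightarrow> (p, q) \<in> r S))"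

lemma cls: "\<forall>S\<in>ED. small TYPE('u) (cls S ` D S) \<and>
     (\<forall>p\<in>D S. \<forall>q\<in>D S. cls S p = cls S q \<longleftrightarrow> (p, q) \<in> r S)"
proof -
  have "\<forall>S\<in>ED. \<exists>\<pi> :: _ \<Rightarrow> 'u \<Rightarrow> 'u. small TYPE('u) (\<pi> ` D S) \<and>
     (\<forall>p\<in>D S. \<forall>q\<in>D S. \<pi> p = \<pi> q \<longleftrightarrow> (p, q) \<in> r S)"
    using small_quotient[OF D_small r_equiv] by metis
  from someI_ex[OF bchoice[OF this]] show ?thesis unfolding cls_def .
qed

lemma cls_eq: "S \<in> ED \<Longrightarrow> p \<in> D S \<Longrightarrow> q \<in> D S \<Longrightarrow> cls S p = cls S q \<longleftrightarrow> (p, q) \<in> r S"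
  using cls by blast

lemma cls_eqI: "S \<in> ED \<Longrightarrow> (p, q) \<in> r S \<Longrightarrow> cls S p = cls S q"
  using cls_eq r_D by blast

definition L :: "'u presheaf" where
  "L = \<lparr>FObj = (\<lambda>S. cls S ` D S),
        FArr = (\<lambda>S R f. \<lambda>y\<in>cls S ` D S.
          let p = inv_into (D S) (cls S) y in cls R (fst p, FArr (F (fst p)) S R f (snd p)))\<rparr>"

lemma L_obj: "FObj L S = cls S ` D S"
  by (simp add: L_def)

text \<open>By \<open>r_arr\<close> the class of the restriction does not depend on the
  representative that \<open>inv_into\<close> picks.\<close>

lemma L_arr:
  assumes "S \<in> ED" "R \<in> ED" "f \<in> cmaps R S" "(i, x) \<in> D S"
  shows "FArr L S R f (cls S (i, x)) = cls R (i, FArr (F i) S R f x)"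
proof -
  define p where "p = inv_into (D S) (cls S) (cls S (i, x))"
  have p: "p \<in> D S" "cls S p = cls S (i, x)"
    unfolding p_def using assms by (auto intro: inv_into_into f_inv_into_f)
  obtain j y where jy: "p = (j, y)" by fastforce
  have "((j, y), (i, x)) \<in> r S" using p assms by (simp add: cls_eq jy)
  from cls_eqI[OF assms(2) r_arr[OF assms(1-3) this]] show ?thesis
    using assms by (simp add: L_def Let_def p_def[symmetric] jy)
qed

lemma L_functor: "presheaf L"
  unfolding presheaf_iff
proof (intro conjI ballI)
  fix S :: "'u topology" assume S: "S \<in> ED"
  show "small TYPE('u) (FObj L S)" using cls S by (simp add: L_obj)
  show "FArr L S S (\<lambda>s\<in>topspace S. s) = (\<lambda>x\<in>FObj L S. x)"
  proof (rule extensionalityI[of _ "FObj L S"])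
    fix y assume "y \<in> FObj L S"
    then show "FArr L S S (\<lambda>s\<in>topspace S. s) y = (\<lambda>x\<in>FObj L S. x) y"
      using S by (auto simp: L_obj L_arr cmaps_id arr_id[OF Ff] D_iff)
  qed (auto simp: L_def)
next
  fix S R :: "'u topology" and f assume "S \<in> ED" "R \<in> ED" "f \<in> cmaps R S"
  then show "FArr L S R f \<in> FObj L S \<rightarrow>\<^sub>E FObj L R"
    by (intro PiE_I) (auto simp: L_obj L_arr arr_D, auto simp: L_def)
next
  fix S R Q :: "'u topology" and f g assume *: "S \<in> ED" "R \<in> ED" "Q \<in> ED" "f \<in> cmaps R S" "g \<in> cmaps Q R"
  show "FArr L S Q (compose (topspace Q) f g) = compose (FObj L S) (FArr L R Q g) (FArr L S R f)"
  proof (rule extensionalityI[of _ "FObj L S"])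
    fix y assume "y \<in> FObj L S"
    then obtain i x where "y = cls S (i, x)" "(i, x) \<in> D S" by (auto simp: L_obj)
    then show "FArr L S Q (compose (topspace Q) f g) y = compose (FObj L S) (FArr L R Q g) (FArr L S R f) y"
      using L_arr[OF *(1,2,4)] L_arr[OF *(2,3,5) arr_D[OF *(1,2,4)]] L_arr[OF *(1,3) cmaps_comp[OF *(5,4)]] *
      by (auto simp: compose_def L_obj D_iff arr_comp[OF Ff])
  qed (auto simp: L_def compose_def)
qed

lemma respects:
  assumes S: "S \<in> ED" and h: "\<And>p q. (p, q) \<in> \<rho> S \<Longrightarrow> h p = h q" and pq: "(p, q) \<in> r S"
  shows "h p = h q"
proof -
  have "(p, q) \<in> (\<rho> S \<union> (\<rho> S)\<inverse>)\<^sup>*" using r_gen S pq by blast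
  then show ?thesis by (induction rule: rtrancl_induct) (auto simp: h)
qed

text \<open>A cocone on \<open>L\<close> pulls back along the class maps to a cocone on each
  \<open>F i\<close>, which extends to a map \<open>H i\<close> because \<open>F i\<close> is Kan
  extended. A generating pair over \<open>c\<close> is restricted from a generating pair over a
  small space, where both elements have the same class; hence the maps \<open>H i\<close> agree on
  it and descend to the quotient.\<close>

lemma L_kan: "kan_from (small_ED \<kappa>) L"
proof (rule kanI[OF L_functor small_ED_subset])
  fix c :: "'u topology" and y assume c: "c \<in> ED" and "y \<in> FObj L c"
  then obtain i x where i: "y = cls c (i, x)" "(i, x) \<in> D c" by (auto simp: L_obj)
  then have I: "i \<in> I" "x \<in> FObj (F i) c" by (auto simp: D_iff)
  obtain a f w where a: "a \<in> small_ED \<kappa>" "f \<in> cmaps c a" "w \<in> FObj (F i) a" "FArr (F i) a c f w = x"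
    using kan_surj[OF Ff[OF I(1)] small_ED_subset kan[OF I(1)] c I(2)] by blast
  have aw: "a \<in> ED" "(i, w) \<in> D a" using a I small_ED_subset by (auto simp: D_iff)
  have "FArr L a c f (cls a (i, w)) = y" using L_arr[OF aw(1) c a(2) aw(2)] a(4) i by simp
  moreover have "cls a (i, w) \<in> FObj L a" using aw by (simp add: L_obj)
  ultimately show "\<exists>a\<in>small_ED \<kappa>. \<exists>f\<in>cmaps c a. \<exists>x\<in>FObj L a. FArr L a c f x = y"
    using a(1,2) by blast
next
  fix c and W :: "('u \<Rightarrow> 'u) set" and \<delta> :: "'u topology \<Rightarrow> ('u \<Rightarrow> 'u) \<Rightarrow> ('u \<Rightarrow> 'u) \<Rightarrow> 'u \<Rightarrow> 'u"
  assume c: "c \<in> ED" and W: "small TYPE('u) W"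
    and \<delta>: "\<And>a f x. a \<in> small_ED \<kappa> \<Longrightarrow> f \<in> cmaps c a \<Longrightarrow> x \<in> FObj L a \<Longrightarrow> \<delta> a f x \<in> W"
    and compat: "\<And>a b g h x. a \<in> small_ED \<kappa> \<Longrightarrow> b \<in> small_ED \<kappa> \<Longrightarrow> g \<in> cmaps c b \<Longrightarrow> h \<in> cmaps b a \<Longrightarrow>
          x \<in> FObj L a \<Longrightarrow> \<delta> b g (FArr L a b h x) = \<delta> a (compose (topspace c) h g) x"
  have "\<exists>h. (\<forall>y\<in>FObj (F i) c. h y \<in> W) \<and> (\<forall>a\<in>small_ED \<kappa>. \<forall>f\<in>cmaps c a. \<forall>x\<in>FObj (F i) a.
      h (FArr (F i) a c f x) = \<delta> a f (cls a (i, x)))" if i: "i \<in> I" for i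
  proof (rule kan_ex[OF Ff[OF i] small_ED_subset kan[OF i] c W])
    show "\<delta> a f (cls a (i, x)) \<in> W" if "a \<in> small_ED \<kappa>" "f \<in> cmaps c a" "x \<in> FObj (F i) a" for a f x
      using that i by (auto intro!: \<delta> simp: L_obj D_iff)
    show "\<delta> b g (cls b (i, FArr (F i) a b h x)) = \<delta> a (compose (topspace c) h g) (cls a (i, x))"
      if "a \<in> small_ED \<kappa>" "b \<in> small_ED \<kappa>" "g \<in> cmaps c b" "h \<in> cmaps b a" "x \<in> FObj (F i) a" for a b g h x
    proof -
      have ab: "a \<in> ED" "b \<in> ED" using that small_ED_subset by auto
      have D: "(i, x) \<in> D a" using i that by (simp add: D_iff)
      then have "cls a (i, x) \<in> FObj L a" by (simp add: L_obj)
      from compat[OF that(1-4) this] show ?thesis using L_arr[OF ab that(4) D] by simp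
    qed
  qed
  then have "\<forall>i\<in>I. \<exists>h. \<forall>a\<in>small_ED \<kappa>. \<forall>f\<in>cmaps c a. \<forall>x\<in>FObj (F i) a.
      h (FArr (F i) a c f x) = \<delta> a f (cls a (i, x))" by blast
  from bchoice[OF this] obtain H where H: "\<And>i a f x. i \<in> I \<Longrightarrow> a \<in> small_ED \<kappa> \<Longrightarrow> f \<in> cmaps c a \<Longrightarrow> x \<in> FObj (F i) a \<Longrightarrow>
      H i (FArr (F i) a c f x) = \<delta> a f (cls a (i, x))"
    by blast
  have Hr: "case_prod H p = case_prod H q" if "(p, q) \<in> r c" for p q
  proof (rule respects[OF c _ that])
    fix p q assume pq: "(p, q) \<in> \<rho> c"
    obtain i z j z' where ij: "p = (i, z)" "q = (j, z')" by fastforce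
    obtain a f w w' where a: "a \<in> small_ED \<kappa>" "f \<in> cmaps c a" "((i, w), (j, w')) \<in> \<rho> a"
        "z = FArr (F i) a c f w" "z' = FArr (F j) a c f w'"
      using rho_descends[OF c pq[unfolded ij]] by blast
    have aE: "a \<in> ED" using a small_ED_subset by blast
    have "((i, w), (j, w')) \<in> r a" using rho_r[OF aE] a(3) by blast
    then have "cls a (i, w) = cls a (j, w')" "i \<in> I" "j \<in> I" "w \<in> FObj (F i) a" "w' \<in> FObj (F j) a"
      using cls_eqI[OF aE] r_D[OF aE] by (auto simp: D_iff)
    then show "case_prod H p = case_prod H q" using H a ij by simp
  qed
  define h where "h y = case_prod H (inv_into (D c) (cls c) y)" for y
  have h: "h (cls c p) = case_prod H p" if "p \<in> D c" for p
  proof -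
    have "inv_into (D c) (cls c) (cls c p) \<in> D c" "cls c (inv_into (D c) (cls c) (cls c p)) = cls c p"
      using that by (auto intro: inv_into_into f_inv_into_f)
    then have "(inv_into (D c) (cls c) (cls c p), p) \<in> r c" using cls_eq[OF c] that by blast
    from Hr[OF this] show ?thesis by (simp add: h_def)
  qed
  have "h (FArr L a c f x) = \<delta> a f x" if asm: "a \<in> small_ED \<kappa>" "f \<in> cmaps c a" "x \<in> FObj L a" for a f x
  proof -
    obtain i w where i: "x = cls a (i, w)" "(i, w) \<in> D a" using asm(3) by (auto simp: L_obj)
    have a: "a \<in> ED" using asm small_ED_subset by blast
    show ?thesis
      using i a c asm by (simp add: L_arr h arr_D) (simp add: H D_iff)
  qed
  then show "\<exists>h. \<forall>a\<in>small_ED \<kappa>. \<forall>f\<in>cmaps c a. \<forall>x\<in>FObj L a. h (FArr L a c f x) = \<delta> a f x" by blast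
qed

text \<open>For surjectivity \<open>r_sum_surj\<close> moves both components into the same
  \<open>F k\<close>, whose own sum condition glues them. Injectivity is
  \<open>r_sum_inj\<close>.\<close>

lemma L_sum: "sum_cond L"
  unfolding sum_cond_def
proof (intro ballI allI impI)
  fix S1 S2 S :: "'u topology" and i1 i2
  assume S: "S1 \<in> ED" "S2 \<in> ED" "S \<in> ED" and d: "disj_sum S1 S2 S i1 i2"
  note ic = disj_sum_cmaps[OF d]
  show "bij_betw (\<lambda>x. (FArr L S S1 i1 x, FArr L S S2 i2 x)) (FObj L S) (FObj L S1 \<times> FObj L S2)"
    unfolding bij_betw_def
  proof (intro conjI inj_onI subset_antisym subsetI)
    fix x y assume xy: "x \<in> FObj L S" "y \<in> FObj L S"
      "(FArr L S S1 i1 x, FArr L S S2 i2 x) = (FArr L S S1 i1 y, FArr L S S2 i2 y)"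
    obtain i u where i: "x = cls S (i, u)" "(i, u) \<in> D S" using xy(1) by (auto simp: L_obj)
    obtain j v where j: "y = cls S (j, v)" "(j, v) \<in> D S" using xy(2) by (auto simp: L_obj)
    have "((i, FArr (F i) S S1 i1 u), (j, FArr (F j) S S1 i1 v)) \<in> r S1"
      "((i, FArr (F i) S S2 i2 u), (j, FArr (F j) S S2 i2 v)) \<in> r S2"
      using xy(3) i j S ic by (simp_all add: L_arr cls_eq arr_D)
    from r_sum_inj[OF S d i(2) j(2) this] show "x = y" using cls_eqI S i j by simp
  next
    fix z assume "z \<in> (\<lambda>x. (FArr L S S1 i1 x, FArr L S S2 i2 x)) ` FObj L S"
    then show "z \<in> FObj L S1 \<times> FObj L S2"
      using arr_in[OF L_functor] S ic by auto
  next
    fix z assume "z \<in> FObj L S1 \<times> FObj L S2"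
    then obtain i u j v where z: "z = (cls S1 (i, u), cls S2 (j, v))" "(i, u) \<in> D S1" "(j, v) \<in> D S2"
      by (auto simp: L_obj)
    obtain k w w' where k: "((i, u), (k, w)) \<in> r S1" "((j, v), (k, w')) \<in> r S2"
      using r_sum_surj[OF S(1,2) z(2,3)] by blast
    then have kD: "k \<in> I" "w \<in> FObj (F k) S1" "w' \<in> FObj (F k) S2"
      using r_D S by (auto simp: D_iff)
    obtain t where t: "t \<in> FObj (F k) S" "FArr (F k) S S1 i1 t = w" "FArr (F k) S S2 i2 t = w'"
      using sum_cond_ex[OF CondSet_sum[OF F[OF kD(1)]] S d kD(2,3)] by blast
    have "(k, t) \<in> D S" using t kD by (simp add: D_iff)
    then have "cls S (k, t) \<in> FObj L S" "(FArr L S S1 i1 (cls S (k, t)), FArr L S S2 i2 (cls S (k, t))) = z"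
      using t z k S ic cls_eqI by (auto simp: L_arr L_obj)
    then show "z \<in> (\<lambda>x. (FArr L S S1 i1 x, FArr L S S2 i2 x)) ` FObj L S" by blast
  qed
qed

lemma L_CondSet: "L \<in> Obj CondSet"
  unfolding Obj_CondSet condensed_iff mem_Collect_eq
proof (intro conjI L_functor L_sum)
  show "small_presheaf L" unfolding small_presheaf_iff using kappa L_kan by blast
  obtain i where i: "i \<in> I" using I_ne by blast
  obtain x where "FObj (F i) (discrete_topology {}) = {x}" using CondSet_empty[OF F[OF i]] by blast
  then have ix: "(i, x) \<in> D (discrete_topology {})" using i by (simp add: D_iff)
  have "FObj L (discrete_topology {}) = {cls (discrete_topology {}) (i, x)}"
    unfolding L_obj using ix cls_eqI[OF empty_ED r_empty[OF _ ix]] by blast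
  then show "\<exists>x. FObj L (discrete_topology {}) = {x}" by blast
qed

definition lam :: "'i \<Rightarrow> 'u topology \<Rightarrow> ('u \<Rightarrow> 'u) \<Rightarrow> ('u \<Rightarrow> 'u)" where
  "lam i = mk_hom (F i) (\<lambda>S x. cls S (i, x))"

lemma lam_apply: "i \<in> I \<Longrightarrow> S \<in> ED \<Longrightarrow> x \<in> FObj (F i) S \<Longrightarrow> lam i S x = cls S (i, x)"
  by (simp add: lam_def)

lemma lam_hom: "i \<in> I \<Longrightarrow> lam i \<in> Hom CondSet (F i) L"
  unfolding lam_def by (rule mk_hom[OF Ff]) (auto simp: L_obj D_iff L_arr)

lemma lam_surj: "S \<in> ED \<Longrightarrow> y \<in> FObj L S \<Longrightarrow> \<exists>i\<in>I. \<exists>x\<in>FObj (F i) S. lam i S x = y"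
  by (force simp: L_obj D_iff lam_apply)

lemma lam_eq: "i \<in> I \<Longrightarrow> j \<in> I \<Longrightarrow> S \<in> ED \<Longrightarrow> x \<in> FObj (F i) S \<Longrightarrow> y \<in> FObj (F j) S \<Longrightarrow>
   lam i S x = lam j S y \<longleftrightarrow> ((i, x), (j, y)) \<in> r S"
  by (simp add: lam_apply cls_eq D_iff)

text \<open>A family that is constant on generators is constant on classes by
  \<open>respects\<close>, so it factors through \<open>cls\<close>; naturality is checked on
  representatives.\<close>

lemma L_universal:
  assumes W: "W \<in> Obj CondSet" and \<alpha>: "\<And>i. i \<in> I \<Longrightarrow> \<alpha> i \<in> Hom CondSet (F i) W"
    and resp: "\<And>S i x j y. S \<in> ED \<Longrightarrow> ((i, x), (j, y)) \<in> \<rho> S \<Longrightarrow> \<alpha> i S x = \<alpha> j S y"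
  shows "\<exists>h\<in>Hom CondSet L W. \<forall>i\<in>I. Comp CondSet (F i) L W h (lam i) = \<alpha> i"
proof -
  define a where "a S p = \<alpha> (fst p) S (snd p)" for S p
  have ar: "a S p = a S q" if "S \<in> ED" "(p, q) \<in> r S" for S p q
    by (rule respects[OF that(1) _ that(2)]) (use resp that in \<open>auto simp: a_def\<close>)
  define h where "h = mk_hom L (\<lambda>S y. a S (inv_into (D S) (cls S) y))"
  have h: "h S (cls S p) = a S p" if "S \<in> ED" "p \<in> D S" for S p
  proof -
    have "inv_into (D S) (cls S) (cls S p) \<in> D S" "cls S (inv_into (D S) (cls S) (cls S p)) = cls S p"
      using that by (auto intro: inv_into_into f_inv_into_f)
    then have "(inv_into (D S) (cls S) (cls S p), p) \<in> r S" using cls_eq that by blast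
    from ar[OF that(1) this] show ?thesis using that by (simp add: h_def L_obj)
  qed
  have hH: "h \<in> Hom CondSet L W"
  proof -
    have hh: "h = mk_hom L h" by (auto simp: h_def mk_hom_def fun_eq_iff)
    have "mk_hom L h \<in> Hom CondSet L W"
    proof (rule mk_hom[OF L_functor])
      fix S :: "'u topology" and y assume S: "S \<in> ED" and "y \<in> FObj L S"
      then obtain i x where y: "y = cls S (i, x)" "(i, x) \<in> D S" by (auto simp: L_obj)
      then have i: "i \<in> I" "x \<in> FObj (F i) S" by (auto simp: D_iff)
      have hy: "h S y = \<alpha> i S x" using h[OF S y(2)] y(1) by (simp add: a_def)
      show "h S y \<in> FObj W S" unfolding hy by (rule hom_in[OF \<alpha>[OF i(1)] S i(2)])
      fix R :: "'u topology" and f assume R: "R \<in> ED" "f \<in> cmaps R S"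
      have "h R (FArr L S R f y) = \<alpha> i R (FArr (F i) S R f x)"
        using h[OF R(1) arr_D[OF S R y(2)]] L_arr[OF S R y(2)] y(1) by (simp add: a_def)
      also have "\<dots> = FArr W S R f (\<alpha> i S x)" by (rule hom_nat[OF \<alpha>[OF i(1)] S R i(2)])
      finally show "h R (FArr L S R f y) = FArr W S R f (h S y)" using hy by simp
    qed
    then show ?thesis using hh by simp
  qed
  show ?thesis
  proof (intro bexI[OF _ hH] ballI)
    fix i assume i: "i \<in> I"
    show "Comp CondSet (F i) L W h (lam i) = \<alpha> i"
      by (rule hom_ext[OF hom_comp[OF Ff[OF i] lam_hom[OF i] hH] \<alpha>[OF i]])
        (simp add: i lam_apply h D_iff a_def)
  qed
qed

end

section \<open>Filtered colimits and reflexive coequalizers of condensed sets\<close>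

text \<open>\<open>C\<close> is any object with the universal property, given here only by the two
  consequences \<open>ex\<close> and \<open>uniq\<close>, so that colimits and coequalizers both
  fit. The map \<open>h : C \<rightarrow> L\<close> from the universal property and
  \<open>k : L \<rightarrow> C\<close> from \<open>L_universal\<close> satisfy k h = id by
  uniqueness. Since \<open>h\<close> takes \<open>\<gamma>\<close> to \<open>lam\<close> and
  \<open>k\<close> takes \<open>lam\<close> to \<open>\<gamma>\<close>, joint surjectivity and the
  kernel of \<open>lam\<close> pass to \<open>\<gamma>\<close>.\<close>

lemma (in presheaf_quotient) colimit_pointwise:
  assumes C: "C \<in> Obj CondSet" and \<gamma>: "\<And>i. i \<in> I \<Longrightarrow> \<gamma> i \<in> Hom CondSet (F i) C"
    and resp: "\<And>S i x j y. S \<in> ED \<Longrightarrow> ((i, x), (j, y)) \<in> \<rho> S \<Longrightarrow> \<gamma> i S x = \<gamma> j S y"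
    and ex: "\<exists>h\<in>Hom CondSet C L. \<forall>i\<in>I. Comp CondSet (F i) C L h (\<gamma> i) = lam i"
    and uniq: "\<And>h. h \<in> Hom CondSet C C \<Longrightarrow> \<forall>i\<in>I. Comp CondSet (F i) C C h (\<gamma> i) = \<gamma> i \<Longrightarrow> h = Ident CondSet C"
    and S: "S \<in> ED"
  shows "y \<in> FObj C S \<Longrightarrow> \<exists>i\<in>I. \<exists>x\<in>FObj (F i) S. \<gamma> i S x = y"
    and "i \<in> I \<Longrightarrow> j \<in> I \<Longrightarrow> x \<in> FObj (F i) S \<Longrightarrow> x' \<in> FObj (F j) S \<Longrightarrow>
      \<gamma> i S x = \<gamma> j S x' \<Longrightarrow> ((i, x), (j, x')) \<in> r S"
proof -
  obtain h where h: "h \<in> Hom CondSet C L" "\<And>i. i \<in> I \<Longrightarrow> Comp CondSet (F i) C L h (\<gamma> i) = lam i"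
    using ex by blast
  have h\<gamma>: "h S (\<gamma> i S x) = lam i S x" if "i \<in> I" "S \<in> ED" "x \<in> FObj (F i) S" for i S x
    using Comp_CondSet_apply[of S x "F i" C L h "\<gamma> i"] h(2) that by simp
  obtain k where k: "k \<in> Hom CondSet L C" "\<And>i. i \<in> I \<Longrightarrow> Comp CondSet (F i) L C k (lam i) = \<gamma> i"
    using L_universal[OF C, of \<gamma>] \<gamma> resp by blast
  have klam: "k S (lam i S x) = \<gamma> i S x" if "i \<in> I" "S \<in> ED" "x \<in> FObj (F i) S" for i S x
    using Comp_CondSet_apply[of S x "F i" L C k "lam i"] k(2) that by simp
  note Cf = CondSet_functor[OF C]
  have kh: "Comp CondSet C L C k h = Ident CondSet C"
  proof (rule uniq[OF hom_comp[OF Cf h(1) k(1)]], intro ballI)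
    fix i assume i: "i \<in> I"
    show "Comp CondSet (F i) C C (Comp CondSet C L C k h) (\<gamma> i) = \<gamma> i"
      by (rule hom_ext[OF hom_comp[OF Ff[OF i] \<gamma>[OF i] hom_comp[OF Cf h(1) k(1)]] \<gamma>[OF i]])
        (simp add: i hom_in[OF \<gamma>[OF i]] h\<gamma> klam)
  qed
  show "\<exists>i\<in>I. \<exists>x\<in>FObj (F i) S. \<gamma> i S x = y" if y: "y \<in> FObj C S"
  proof -
    obtain i x where i: "i \<in> I" "x \<in> FObj (F i) S" "lam i S x = h S y"
      using lam_surj[OF S hom_in[OF h(1) S y]] by blast
    have "k S (h S y) = y"
      using fun_cong[OF fun_cong[OF kh, of S], of y] S y by simp
    then have "\<gamma> i S x = y" using klam[OF i(1) S i(2)] i(3) by simp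
    then show ?thesis using i by blast
  qed
  show "((i, x), (j, x')) \<in> r S" if "i \<in> I" "j \<in> I" "x \<in> FObj (F i) S" "x' \<in> FObj (F j) S"
    "\<gamma> i S x = \<gamma> j S x'"
    using lam_eq[OF that(1,2) S that(3,4)] h\<gamma>[OF that(1) S that(3)] h\<gamma>[OF that(2) S that(4)] that(5) by simp
qed

section \<open>Filtered colimits: elements are identified when they agree at a later stage\<close>

locale filtered_diagram = universe TU for TU :: "'u itself" +
  fixes J :: "('j, 'a) cat" and X :: "('j, 'a, 'u presheaf, 'u topology \<Rightarrow> ('u \<Rightarrow> 'u) \<Rightarrow> ('u \<Rightarrow> 'u)) func"
  assumes J_small: "small TYPE('u) (Obj J)" and J: "filtered_cat J" and X: "is_functor J CondSet X"
begin

abbreviation "FX \<equiv> FObj X"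
abbreviation "AX \<equiv> FArr X"

lemma Jcat: "category J" and J_ne: "Obj J \<noteq> {}"
  using J by (auto simp: filtered_cat_def)

lemma J_id: "i \<in> Obj J \<Longrightarrow> Ident J i \<in> Hom J i i"
  using Jcat by (simp add: category_def)

lemma J_comp: "i \<in> Obj J \<Longrightarrow> j \<in> Obj J \<Longrightarrow> k \<in> Obj J \<Longrightarrow> u \<in> Hom J i j \<Longrightarrow> v \<in> Hom J j k \<Longrightarrow>
    Comp J i j k v u \<in> Hom J i k"
  using Jcat by (simp add: category_def)

lemma J_join: "i \<in> Obj J \<Longrightarrow> j \<in> Obj J \<Longrightarrow> \<exists>k\<in>Obj J. \<exists>u v. u \<in> Hom J i k \<and> v \<in> Hom J j k"
  using J unfolding filtered_cat_def by blast

lemma J_coeq: "i \<in> Obj J \<Longrightarrow> j \<in> Obj J \<Longrightarrow> u \<in> Hom J i j \<Longrightarrow> v \<in> Hom J i j \<Longrightarrow>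
    \<exists>k\<in>Obj J. \<exists>w\<in>Hom J j k. Comp J i j k w u = Comp J i j k w v"
  using J unfolding filtered_cat_def by blast

lemma X_obj: "i \<in> Obj J \<Longrightarrow> FX i \<in> Obj CondSet"
  using X by (simp add: is_functor_def)

lemma X_hom: "i \<in> Obj J \<Longrightarrow> j \<in> Obj J \<Longrightarrow> u \<in> Hom J i j \<Longrightarrow> AX i j u \<in> Hom CondSet (FX i) (FX j)"
  using X by (simp add: is_functor_def)

lemma X_in: "i \<in> Obj J \<Longrightarrow> j \<in> Obj J \<Longrightarrow> u \<in> Hom J i j \<Longrightarrow> S \<in> ED \<Longrightarrow> x \<in> FObj (FX i) S \<Longrightarrow>
    AX i j u S x \<in> FObj (FX j) S"
  using X_hom hom_in by metis

lemma X_nat: "i \<in> Obj J \<Longrightarrow> j \<in> Obj J \<Longrightarrow> u \<in> Hom J i j \<Longrightarrow> S \<in> ED \<Longrightarrow> R \<in> ED \<Longrightarrow> f \<in> cmaps R S \<Longrightarrow>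
    x \<in> FObj (FX i) S \<Longrightarrow> AX i j u R (FArr (FX i) S R f x) = FArr (FX j) S R f (AX i j u S x)"
  using X_hom hom_nat by metis

lemma X_id: "i \<in> Obj J \<Longrightarrow> S \<in> ED \<Longrightarrow> x \<in> FObj (FX i) S \<Longrightarrow> AX i i (Ident J i) S x = x"
  using X by (simp add: is_functor_def)

lemma X_comp: "i \<in> Obj J \<Longrightarrow> j \<in> Obj J \<Longrightarrow> k \<in> Obj J \<Longrightarrow> u \<in> Hom J i j \<Longrightarrow> v \<in> Hom J j k \<Longrightarrow>
    S \<in> ED \<Longrightarrow> x \<in> FObj (FX i) S \<Longrightarrow> AX i k (Comp J i j k v u) S x = AX j k v S (AX i j u S x)"
  using X by (simp add: is_functor_def)

definition "elts = (\<lambda>S. SIGMA i:Obj J. FObj (FX i) S)"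

definition "trans_rel S = {((i, x), (j, y)). i \<in> Obj J \<and> j \<in> Obj J \<and> x \<in> FObj (FX i) S \<and>
    (\<exists>u\<in>Hom J i j. y = AX i j u S x)}"

definition "eventual_eq S = {((i, x), (j, y)). i \<in> Obj J \<and> j \<in> Obj J \<and> x \<in> FObj (FX i) S \<and> y \<in> FObj (FX j) S \<and>
    (\<exists>k\<in>Obj J. \<exists>u\<in>Hom J i k. \<exists>v\<in>Hom J j k. AX i k u S x = AX j k v S y)}"

text \<open>The two witnesses give stages \<open>k\<close> and \<open>k'\<close> reached from
  \<open>j\<close>. They are joined at \<open>m\<close>, and the two resulting arrows from
  \<open>j\<close> to \<open>m\<close> are then equalized by \<open>t\<close>.\<close>

lemma eventual_trans:
  assumes S: "S \<in> ED" and "((i, x), (j, y)) \<in> eventual_eq S" "((j, y), (l, z)) \<in> eventual_eq S"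
  shows "((i, x), (l, z)) \<in> eventual_eq S"
proof -
  obtain k u v where k: "k \<in> Obj J" "u \<in> Hom J i k" "v \<in> Hom J j k" "AX i k u S x = AX j k v S y"
    using assms(2) by (auto simp: eventual_eq_def)
  obtain k' u' v' where k': "k' \<in> Obj J" "u' \<in> Hom J j k'" "v' \<in> Hom J l k'" "AX j k' u' S y = AX l k' v' S z"
    using assms(3) by (auto simp: eventual_eq_def)
  have I: "i \<in> Obj J" "j \<in> Obj J" "l \<in> Obj J" "x \<in> FObj (FX i) S" "y \<in> FObj (FX j) S" "z \<in> FObj (FX l) S"
    using assms by (auto simp: eventual_eq_def)
  obtain m w w' where m: "m \<in> Obj J" "w \<in> Hom J k m" "w' \<in> Hom J k' m" using J_join k(1) k'(1) by blast
  have "Comp J j k m w v \<in> Hom J j m" "Comp J j k' m w' u' \<in> Hom J j m"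
    using I k k' m J_comp by auto
  then obtain n t where n: "n \<in> Obj J" "t \<in> Hom J m n"
    "Comp J j m n t (Comp J j k m w v) = Comp J j m n t (Comp J j k' m w' u')"
    using J_coeq[OF I(2) m(1)] by blast
  have c: "Comp J i k m w u \<in> Hom J i m" "Comp J j k m w v \<in> Hom J j m"
      "Comp J j k' m w' u' \<in> Hom J j m" "Comp J l k' m w' v' \<in> Hom J l m"
    using I k k' m J_comp by auto
  have "AX i n (Comp J i m n t (Comp J i k m w u)) S x = AX m n t S (AX k m w S (AX i k u S x))"
    using I k m n(1,2) c S by (simp add: X_comp)
  also have "\<dots> = AX j n (Comp J j m n t (Comp J j k m w v)) S y"
    using I k m n(1,2) c S by (simp add: X_comp)
  also have "\<dots> = AX j n (Comp J j m n t (Comp J j k' m w' u')) S y" by (simp only: n(3))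
  also have "\<dots> = AX m n t S (AX k' m w' S (AX j k' u' S y))"
    using I k' m n(1,2) c S by (simp add: X_comp)
  also have "\<dots> = AX l n (Comp J l m n t (Comp J l k' m w' v')) S z"
    using I k' m n(1,2) c S by (simp add: X_comp)
  finally have "AX i n (Comp J i m n t (Comp J i k m w u)) S x = AX l n (Comp J l m n t (Comp J l k' m w' v')) S z" .
  moreover have "Comp J i m n t (Comp J i k m w u) \<in> Hom J i n" "Comp J l m n t (Comp J l k' m w' v') \<in> Hom J l n"
    using I m n c J_comp by auto
  ultimately show ?thesis using I n(1) by (auto simp: eventual_eq_def)
qed

text \<open>Filtered colimits commute with binary products. The elements agree over
  \<open>S1\<close> at stage \<open>k\<close> and over \<open>S2\<close> at stage \<open>k'\<close>.
  After joining the stages at \<open>m\<close> there are two parallel arrows from \<open>i\<close>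
  and two from \<open>j\<close>; \<open>t\<close> equalizes the first pair, \<open>q\<close> the
  second. At the final stage \<open>p\<close> both equalities concern the same two elements, and the
  sum condition of \<open>FX p\<close> identifies them.\<close>

lemma eventual_sum:
  assumes S: "S1 \<in> ED" "S2 \<in> ED" "S \<in> ED" and d: "disj_sum S1 S2 S i1 i2"
    and ij: "(i, x) \<in> elts S" "(j, y) \<in> elts S"
    and 1: "((i, FArr (FX i) S S1 i1 x), (j, FArr (FX j) S S1 i1 y)) \<in> eventual_eq S1"
    and 2: "((i, FArr (FX i) S S2 i2 x), (j, FArr (FX j) S S2 i2 y)) \<in> eventual_eq S2"
  shows "((i, x), (j, y)) \<in> eventual_eq S"
proof -
  note ic = disj_sum_cmaps[OF d]
  have I: "i \<in> Obj J" "j \<in> Obj J" "x \<in> FObj (FX i) S" "y \<in> FObj (FX j) S"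
    using ij by (auto simp: elts_def)
  obtain k u v where k: "k \<in> Obj J" "u \<in> Hom J i k" "v \<in> Hom J j k"
    "AX i k u S1 (FArr (FX i) S S1 i1 x) = AX j k v S1 (FArr (FX j) S S1 i1 y)"
    using 1 by (auto simp: eventual_eq_def)
  obtain k' u' v' where k': "k' \<in> Obj J" "u' \<in> Hom J i k'" "v' \<in> Hom J j k'"
    "AX i k' u' S2 (FArr (FX i) S S2 i2 x) = AX j k' v' S2 (FArr (FX j) S S2 i2 y)"
    using 2 by (auto simp: eventual_eq_def)
  obtain m w w' where m: "m \<in> Obj J" "w \<in> Hom J k m" "w' \<in> Hom J k' m" using J_join k(1) k'(1) by blast
  have c: "Comp J i k m w u \<in> Hom J i m" "Comp J i k' m w' u' \<in> Hom J i m"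
     "Comp J j k m w v \<in> Hom J j m" "Comp J j k' m w' v' \<in> Hom J j m"
    using I k k' m J_comp by auto
  obtain n t where n: "n \<in> Obj J" "t \<in> Hom J m n"
    "Comp J i m n t (Comp J i k m w u) = Comp J i m n t (Comp J i k' m w' u')"
    using J_coeq[OF I(1) m(1) c(1,2)] by blast
  have c': "Comp J j m n t (Comp J j k m w v) \<in> Hom J j n" "Comp J j m n t (Comp J j k' m w' v') \<in> Hom J j n"
     "Comp J i m n t (Comp J i k m w u) \<in> Hom J i n" "Comp J i m n t (Comp J i k' m w' u') \<in> Hom J i n"
    using I m n c J_comp by auto
  obtain p q where p: "p \<in> Obj J" "q \<in> Hom J n p"
    "Comp J j n p q (Comp J j m n t (Comp J j k m w v)) = Comp J j n p q (Comp J j m n t (Comp J j k' m w' v'))"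
    using J_coeq[OF I(2) n(1) c'(1,2)] by blast
  \<comment> \<open>Each of the two arrows factors through \<open>k\<close> as well as through
    \<open>k'\<close>; the first factorization (\<open>a1\<close>, \<open>b1\<close>) is used over
    \<open>S1\<close>, the second (\<open>a2\<close>, \<open>b2\<close>) over
    \<open>S2\<close>.\<close>
  let ?a = "Comp J i n p q (Comp J i m n t (Comp J i k m w u))"
  let ?b = "Comp J j n p q (Comp J j m n t (Comp J j k m w v))"
  have ab: "?a \<in> Hom J i p" "?b \<in> Hom J j p" using c' I n p J_comp by auto
  have a1: "AX i p ?a S' z = AX n p q S' (AX m n t S' (AX k m w S' (AX i k u S' z)))"
    if "S' \<in> ED" "z \<in> FObj (FX i) S'" for S' z
    using I k(1-3) m n(1,2) p(1,2) c c' that by (simp add: X_comp)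
  have a2: "AX i p ?a S' z = AX n p q S' (AX m n t S' (AX k' m w' S' (AX i k' u' S' z)))"
    if "S' \<in> ED" "z \<in> FObj (FX i) S'" for S' z
    unfolding n(3) using I k'(1-3) m n(1,2) p(1,2) c c' that by (simp add: X_comp)
  have b1: "AX j p ?b S' z = AX n p q S' (AX m n t S' (AX k m w S' (AX j k v S' z)))"
    if "S' \<in> ED" "z \<in> FObj (FX j) S'" for S' z
    using I k(1-3) m n(1,2) p(1,2) c c' that by (simp add: X_comp)
  have b2: "AX j p ?b S' z = AX n p q S' (AX m n t S' (AX k' m w' S' (AX j k' v' S' z)))"
    if "S' \<in> ED" "z \<in> FObj (FX j) S'" for S' z
    unfolding p(3) using I k'(1-3) m n(1,2) p(1,2) c c' that by (simp add: X_comp)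
  note Fi = CondSet_functor[OF X_obj[OF I(1)]] and Fj = CondSet_functor[OF X_obj[OF I(2)]]
  note r1 = arr_in[OF Fi S(3,1) ic(1) I(3)] arr_in[OF Fj S(3,1) ic(1) I(4)]
  note r2 = arr_in[OF Fi S(3,2) ic(2) I(3)] arr_in[OF Fj S(3,2) ic(2) I(4)]
  have "AX i p ?a S x = AX j p ?b S y"
  proof (rule sum_cond_unique[OF CondSet_sum[OF X_obj[OF p(1)]] S d])
    show "AX i p ?a S x \<in> FObj (FX p) S" "AX j p ?b S y \<in> FObj (FX p) S"
      using X_in I p ab S by auto
    have "FArr (FX p) S S1 i1 (AX i p ?a S x) = AX i p ?a S1 (FArr (FX i) S S1 i1 x)"
      using X_nat[OF I(1) p(1) ab(1) S(3,1) ic(1) I(3)] by simp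
    also have "\<dots> = AX j p ?b S1 (FArr (FX j) S S1 i1 y)"
      unfolding a1[OF S(1) r1(1)] b1[OF S(1) r1(2)] k(4) ..
    also have "\<dots> = FArr (FX p) S S1 i1 (AX j p ?b S y)"
      using X_nat[OF I(2) p(1) ab(2) S(3,1) ic(1) I(4)] by simp
    finally show "FArr (FX p) S S1 i1 (AX i p ?a S x) = FArr (FX p) S S1 i1 (AX j p ?b S y)" .
    have "FArr (FX p) S S2 i2 (AX i p ?a S x) = AX i p ?a S2 (FArr (FX i) S S2 i2 x)"
      using X_nat[OF I(1) p(1) ab(1) S(3,2) ic(2) I(3)] by simp
    also have "\<dots> = AX j p ?b S2 (FArr (FX j) S S2 i2 y)"
      unfolding a2[OF S(2) r2(1)] b2[OF S(2) r2(2)] k'(4) ..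
    also have "\<dots> = FArr (FX p) S S2 i2 (AX j p ?b S y)"
      using X_nat[OF I(2) p(1) ab(2) S(3,2) ic(2) I(4)] by simp
    finally show "FArr (FX p) S S2 i2 (AX i p ?a S x) = FArr (FX p) S S2 i2 (AX j p ?b S y)" .
  qed
  then show ?thesis using I p(1) ab by (auto simp: eventual_eq_def)
qed

lemma eventual_equiv:
  assumes S: "S \<in> ED"
  shows "equiv (elts S) (eventual_eq S)"
proof (rule equivI)
  show "eventual_eq S \<subseteq> elts S \<times> elts S" by (auto simp: eventual_eq_def elts_def)
  show "refl_on (elts S) (eventual_eq S)"
    unfolding refl_on_def by (auto simp: eventual_eq_def elts_def) (use J_id in blast)+
  show "sym (eventual_eq S)" unfolding sym_def eventual_eq_def by (clarsimp; metis)
  show "trans (eventual_eq S)" unfolding trans_def using eventual_trans[OF S] by (metis surj_pair)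
qed

lemma trans_rel_eventual: "S \<in> ED \<Longrightarrow> ((i, x), (j, y)) \<in> trans_rel S \<Longrightarrow> ((i, x), (j, y)) \<in> eventual_eq S"
proof -
  assume S: "S \<in> ED" and "((i, x), (j, y)) \<in> trans_rel S"
  then obtain u where u: "i \<in> Obj J" "j \<in> Obj J" "x \<in> FObj (FX i) S" "u \<in> Hom J i j" "y = AX i j u S x"
    by (auto simp: trans_rel_def)
  have "y \<in> FObj (FX j) S" using X_in[OF u(1,2,4) S u(3)] u(5) by simp
  moreover have "AX i j u S x = AX j j (Ident J j) S y" using X_id[OF u(2) S] calculation u(5) by simp
  ultimately show ?thesis unfolding eventual_eq_def using u(1-4) J_id[OF u(2)] by blast
qed

lemma eventual_gen: "S \<in> ED \<Longrightarrow> eventual_eq S \<subseteq> (trans_rel S \<union> (trans_rel S)\<inverse>)\<^sup>*"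
proof clarify
  fix i x j y assume S: "S \<in> ED" and "((i, x), (j, y)) \<in> eventual_eq S"
  then obtain k u v where k: "k \<in> Obj J" "u \<in> Hom J i k" "v \<in> Hom J j k" "AX i k u S x = AX j k v S y"
    and I: "i \<in> Obj J" "j \<in> Obj J" "x \<in> FObj (FX i) S" "y \<in> FObj (FX j) S"
    by (auto simp: eventual_eq_def)
  have "((i, x), (k, AX i k u S x)) \<in> trans_rel S" using k(1-3) I by (auto simp: trans_rel_def)
  moreover have "((j, y), (k, AX i k u S x)) \<in> trans_rel S" using k I by (auto simp: trans_rel_def)
  ultimately show "((i, x), (j, y)) \<in> (trans_rel S \<union> (trans_rel S)\<inverse>)\<^sup>*"
    by (meson UnI1 UnI2 converseI converse_rtrancl_into_rtrancl r_into_rtrancl)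
qed

lemma quotient: "\<exists>\<kappa>. presheaf_quotient (Obj J) FX \<kappa> elts trans_rel eventual_eq"
proof -
  obtain \<kappa> :: "'u rel" where \<kappa>: "uncountable_strong_limit \<kappa>" "\<kappa> <o |UNIV :: 'u set|"
    "\<forall>i\<in>Obj J. kan_from (small_ED \<kappa>) (FX i)"
    using common_kappa[OF J_small, of FX] X_obj by blast
  have "presheaf_quotient (Obj J) FX \<kappa> elts trans_rel eventual_eq"
  proof unfold_locales
    show "small TYPE('u) (Obj J)" "Obj J \<noteq> {}" by (rule J_small, rule J_ne)
    show "elts = (\<lambda>S. SIGMA i:Obj J. FObj (FX i) S)" by (rule elts_def)
    show "uncountable_strong_limit \<kappa>" "\<kappa> <o |UNIV :: 'u set|" by (fact \<kappa>)+
  next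
    fix i assume i: "i \<in> Obj J"
    show "FX i \<in> Obj CondSet" using i by (rule X_obj)
    show "kan_from (small_ED \<kappa>) (FX i)" using \<kappa> i by blast
  next
    fix S :: "'u topology" assume S: "S \<in> ED"
    show "equiv (elts S) (eventual_eq S)" using S by (rule eventual_equiv)
    show "eventual_eq S \<subseteq> (trans_rel S \<union> (trans_rel S)\<inverse>)\<^sup>*" using S by (rule eventual_gen)
    show "trans_rel S \<subseteq> eventual_eq S" using trans_rel_eventual[OF S] by (auto simp: subset_iff)
  next
    fix S R :: "'u topology" and f i x j y
    assume S: "S \<in> ED" "R \<in> ED" "f \<in> cmaps R S" and "((i, x), (j, y)) \<in> eventual_eq S"
    then obtain k u v where k: "k \<in> Obj J" "u \<in> Hom J i k" "v \<in> Hom J j k" "AX i k u S x = AX j k v S y"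
      and I: "i \<in> Obj J" "j \<in> Obj J" "x \<in> FObj (FX i) S" "y \<in> FObj (FX j) S"
      by (auto simp: eventual_eq_def)
    have "AX i k u R (FArr (FX i) S R f x) = AX j k v R (FArr (FX j) S R f y)"
      using k I S by (simp add: X_nat)
    then show "((i, FArr (FX i) S R f x), (j, FArr (FX j) S R f y)) \<in> eventual_eq R"
      using k I S CondSet_functor[OF X_obj] by (auto simp: eventual_eq_def arr_in)
  next
    fix c :: "'u topology" and i z j z'
    assume c: "c \<in> ED" and "((i, z), (j, z')) \<in> trans_rel c"
    then obtain u where u: "i \<in> Obj J" "j \<in> Obj J" "z \<in> FObj (FX i) c" "u \<in> Hom J i j" "z' = AX i j u c z"
      by (auto simp: trans_rel_def)
    \<comment> \<open>A transition pair descends because its first component does: the second is its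
      image under a natural map.\<close>
    obtain a f w where a: "a \<in> small_ED \<kappa>" "f \<in> cmaps c a" "w \<in> FObj (FX i) a" "FArr (FX i) a c f w = z"
      using kan_surj[OF CondSet_functor[OF X_obj[OF u(1)]] small_ED_subset \<kappa>(3)[rule_format, OF u(1)] c u(3)]
      by blast
    have "a \<in> ED" using a(1) small_ED_subset by blast
    then have "z' = FArr (FX j) a c f (AX i j u a w)" using a u c by (auto simp: X_nat)
    moreover have "((i, w), (j, AX i j u a w)) \<in> trans_rel a" using a u by (auto simp: trans_rel_def)
    ultimately show "\<exists>a\<in>small_ED \<kappa>. \<exists>f\<in>cmaps c a. \<exists>w w'. ((i, w), (j, w')) \<in> trans_rel a \<and>
        z = FArr (FX i) a c f w \<and> z' = FArr (FX j) a c f w'"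
      using a by blast
  next
    fix p q assume p: "p \<in> elts (discrete_topology {})" and q: "q \<in> elts (discrete_topology {})"
    let ?E = "discrete_topology {} :: 'u topology"
    obtain i x where i: "p = (i, x)" "i \<in> Obj J" "x \<in> FObj (FX i) ?E" using p by (auto simp: elts_def)
    obtain j y where j: "q = (j, y)" "j \<in> Obj J" "y \<in> FObj (FX j) ?E" using q by (auto simp: elts_def)
    obtain k u v where k: "k \<in> Obj J" "u \<in> Hom J i k" "v \<in> Hom J j k" using J_join i j by blast
    obtain e where "FObj (FX k) ?E = {e}" using CondSet_empty[OF X_obj[OF k(1)]] by blast
    then have "AX i k u ?E x = AX j k v ?E y" using X_in i j k empty_ED by (metis singletonD)
    then show "(p, q) \<in> eventual_eq ?E" using i j k by (auto simp: eventual_eq_def)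
  next
    fix S1 S2 :: "'u topology" and i x j y
    assume S: "S1 \<in> ED" "S2 \<in> ED" and "(i, x) \<in> elts S1" "(j, y) \<in> elts S2"
    then have I: "i \<in> Obj J" "j \<in> Obj J" "x \<in> FObj (FX i) S1" "y \<in> FObj (FX j) S2" by (auto simp: elts_def)
    obtain k u v where k: "k \<in> Obj J" "u \<in> Hom J i k" "v \<in> Hom J j k" using J_join I by blast
    have "((i, x), (k, AX i k u S1 x)) \<in> eventual_eq S1" "((j, y), (k, AX j k v S2 y)) \<in> eventual_eq S2"
      using k I S by (auto intro!: trans_rel_eventual simp: trans_rel_def)
    then show "\<exists>k z z'. ((i, x), (k, z)) \<in> eventual_eq S1 \<and> ((j, y), (k, z')) \<in> eventual_eq S2" by blast
  next
    fix S1 S2 S :: "'u topology" and i1 i2 i x j y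
    assume "S1 \<in> ED" "S2 \<in> ED" "S \<in> ED" "disj_sum S1 S2 S i1 i2" "(i, x) \<in> elts S" "(j, y) \<in> elts S"
     "((i, FArr (FX i) S S1 i1 x), (j, FArr (FX j) S S1 i1 y)) \<in> eventual_eq S1"
     "((i, FArr (FX i) S S2 i2 x), (j, FArr (FX j) S S2 i2 y)) \<in> eventual_eq S2"
    then show "((i, x), (j, y)) \<in> eventual_eq S" by (rule eventual_sum)
  qed
  then show ?thesis by blast
qed

text \<open>The class maps form a cocone since \<open>trans_rel\<close> lies in
  \<open>eventual_eq\<close>. So the colimit maps to the explicit quotient, and
  \<open>colimit_pointwise\<close> describes its elements and their equality.\<close>

lemma colimit_eval:
  assumes col: "is_colimit J CondSet X c \<iota>" and S: "S \<in> ED"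
  shows "y \<in> FObj c S \<Longrightarrow> \<exists>i\<in>Obj J. \<exists>x\<in>FObj (FX i) S. \<iota> i S x = y"
    and "i \<in> Obj J \<Longrightarrow> j \<in> Obj J \<Longrightarrow> x \<in> FObj (FX i) S \<Longrightarrow> x' \<in> FObj (FX j) S \<Longrightarrow> \<iota> i S x = \<iota> j S x' \<Longrightarrow>
      ((i, x), (j, x')) \<in> eventual_eq S"
proof -
  obtain \<kappa> where "presheaf_quotient (Obj J) FX \<kappa> elts trans_rel eventual_eq" using quotient by blast
  then interpret Q: presheaf_quotient "TYPE('u)" "Obj J" FX \<kappa> elts trans_rel eventual_eq .
  have c: "c \<in> Obj CondSet" "\<And>i. i \<in> Obj J \<Longrightarrow> \<iota> i \<in> Hom CondSet (FX i) c"
    "\<And>i j u. i \<in> Obj J \<Longrightarrow> j \<in> Obj J \<Longrightarrow> u \<in> Hom J i j \<Longrightarrow> Comp CondSet (FX i) (FX j) c (\<iota> j) (AX i j u) = \<iota> i"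
    using col by (auto simp: is_colimit_def is_cocone_def)
  have \<iota>: "\<iota> i S x = \<iota> j S y" if asm: "S \<in> ED" "((i, x), (j, y)) \<in> trans_rel S" for S i x j y
  proof -
    obtain u where u: "i \<in> Obj J" "j \<in> Obj J" "x \<in> FObj (FX i) S" "u \<in> Hom J i j" "y = AX i j u S x"
      using asm(2) by (auto simp: trans_rel_def)
    show ?thesis using fun_cong[OF fun_cong[OF c(3)[OF u(1,2,4)], of S], of x] u asm(1) by simp
  qed
  have "is_cocone J CondSet X Q.L Q.lam"
    unfolding is_cocone_def
  proof (intro conjI ballI Q.L_CondSet Q.lam_hom)
    fix i j u assume u: "i \<in> Obj J" "j \<in> Obj J" "u \<in> Hom J i j"
    show "Comp CondSet (FX i) (FX j) Q.L (Q.lam j) (AX i j u) = Q.lam i"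
    proof (rule hom_ext[OF hom_comp[OF Q.Ff[OF u(1)] X_hom[OF u] Q.lam_hom[OF u(2)]] Q.lam_hom[OF u(1)]])
      fix S :: "'u topology" and x assume x: "S \<in> ED" "x \<in> FObj (FX i) S"
      have t: "((i, x), (j, AX i j u S x)) \<in> trans_rel S" using u x by (auto simp: trans_rel_def)
      show "Comp CondSet (FX i) (FX j) Q.L (Q.lam j) (AX i j u) S x = Q.lam i S x"
        using Q.lam_eq[OF u(1,2) x X_in[OF u x]] trans_rel_eventual[OF x(1) t] x by simp
    qed
  qed
  then have ex: "\<exists>h\<in>Hom CondSet c Q.L. \<forall>i\<in>Obj J. Comp CondSet (FX i) c Q.L h (\<iota> i) = Q.lam i"
    using col unfolding is_colimit_def by blast
  have "is_cocone J CondSet X c \<iota>" using col by (simp add: is_colimit_def)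
  then have u: "\<exists>!h. h \<in> Hom CondSet c c \<and> (\<forall>j\<in>Obj J. Comp CondSet (FX j) c c h (\<iota> j) = \<iota> j)"
    using col unfolding is_colimit_def by blast
  have uniq: "h = Ident CondSet c"
    if "h \<in> Hom CondSet c c" "\<forall>i\<in>Obj J. Comp CondSet (FX i) c c h (\<iota> i) = \<iota> i" for h
  proof (rule ex1_unique[OF u])
    note cf = CondSet_functor[OF c(1)]
    show "h \<in> Hom CondSet c c \<and> (\<forall>j\<in>Obj J. Comp CondSet (FX j) c c h (\<iota> j) = \<iota> j)" using that by blast
    have "Comp CondSet (FX j) c c (Ident CondSet c) (\<iota> j) = \<iota> j" if j: "j \<in> Obj J" for j
      by (rule hom_ext[OF hom_comp[OF Q.Ff[OF j] c(2)[OF j] hom_ident[OF cf]] c(2)[OF j]])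
        (simp add: hom_in[OF c(2)[OF j]])
    then show "Ident CondSet c \<in> Hom CondSet c c \<and>
        (\<forall>j\<in>Obj J. Comp CondSet (FX j) c c (Ident CondSet c) (\<iota> j) = \<iota> j)"
      using hom_ident[OF cf] by blast
  qed
  show "y \<in> FObj c S \<Longrightarrow> \<exists>i\<in>Obj J. \<exists>x\<in>FObj (FX i) S. \<iota> i S x = y"
    by (rule Q.colimit_pointwise(1)[OF c(1,2) \<iota> ex uniq S])
  show "i \<in> Obj J \<Longrightarrow> j \<in> Obj J \<Longrightarrow> x \<in> FObj (FX i) S \<Longrightarrow> x' \<in> FObj (FX j) S \<Longrightarrow> \<iota> i S x = \<iota> j S x' \<Longrightarrow>
      ((i, x), (j, x')) \<in> eventual_eq S"
    by (rule Q.colimit_pointwise(2)[OF c(1,2) \<iota> ex uniq S])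
qed

end

text \<open>The effect of a decomposition on all condensed sets. In \<open>disj_sum\<close> the
  homeomorphism orders the summands, whereas this form is symmetric on its face, so that chains can
  be changed over either summand.\<close>

definition split_by :: "'u topology \<Rightarrow> ('u \<Rightarrow> 'u) \<Rightarrow> 'u topology \<Rightarrow> ('u \<Rightarrow> 'u) \<Rightarrow> 'u topology \<Rightarrow> bool" where
  "split_by S1 i1 S2 i2 S \<longleftrightarrow> i1 \<in> cmaps S1 S \<and> i2 \<in> cmaps S2 S \<and>
    (\<forall>T\<in>Obj CondSet.
      (\<forall>x1\<in>FObj T S1. \<forall>x2\<in>FObj T S2. \<exists>x\<in>FObj T S. FArr T S S1 i1 x = x1 \<and> FArr T S S2 i2 x = x2) \<and>
      (\<forall>x\<in>FObj T S. \<forall>y\<in>FObj T S. FArr T S S1 i1 x = FArr T S S1 i1 y \<longrightarrow>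
         FArr T S S2 i2 x = FArr T S S2 i2 y \<longrightarrow> x = y))"

lemma split_by_sym: "split_by S1 i1 S2 i2 S \<Longrightarrow> split_by S2 i2 S1 i1 S"
  unfolding split_by_def by blast

lemma disj_sum_split_by:
  assumes "S1 \<in> ED" "S2 \<in> ED" "S \<in> ED" "disj_sum S1 S2 S i1 i2"
  shows "split_by S1 i1 S2 i2 S"
  unfolding split_by_def
proof (intro conjI ballI impI disj_sum_cmaps[OF assms(4)])
  fix T :: "'a presheaf" and x1 x2
  assume T: "T \<in> Obj CondSet" and "x1 \<in> FObj T S1" "x2 \<in> FObj T S2"
  then show "\<exists>x\<in>FObj T S. FArr T S S1 i1 x = x1 \<and> FArr T S S2 i2 x = x2"
    using sum_cond_ex[OF CondSet_sum[OF T] assms] by simp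
next
  fix T :: "'a presheaf" and x y
  assume T: "T \<in> Obj CondSet" and "x \<in> FObj T S" "y \<in> FObj T S"
    "FArr T S S1 i1 x = FArr T S S1 i1 y" "FArr T S S2 i2 x = FArr T S S2 i2 y"
  then show "x = y" using sum_cond_unique[OF CondSet_sum[OF T] assms] by simp
qed

section \<open>Reflexive coequalizers: elements are identified along zigzags of pairs
  \<open>(f y, g y)\<close>\<close>

locale reflexive_pair = universe TU for TU :: "'u itself" +
  fixes Y Z :: "'u presheaf" and f g s
  assumes Y: "Y \<in> Obj CondSet" and Z: "Z \<in> Obj CondSet"
    and f: "f \<in> Hom CondSet Y Z" and g: "g \<in> Hom CondSet Y Z" and s: "s \<in> Hom CondSet Z Y"
    and fs: "Comp CondSet Z Y Z f s = Ident CondSet Z" and gs: "Comp CondSet Z Y Z g s = Ident CondSet Z"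
begin

lemma fs': "S \<in> ED \<Longrightarrow> z \<in> FObj Z S \<Longrightarrow> f S (s S z) = z"
  using fun_cong[OF fun_cong[OF fs, of S], of z] by simp

lemma gs': "S \<in> ED \<Longrightarrow> z \<in> FObj Z S \<Longrightarrow> g S (s S z) = z"
  using fun_cong[OF fun_cong[OF gs, of S], of z] by simp

definition "pairs S = {(f S y, g S y) | y. y \<in> FObj Y S}"

definition "conn S = (pairs S \<union> (pairs S)\<inverse>)\<^sup>*"

lemma pairs_in: "S \<in> ED \<Longrightarrow> (a, b) \<in> pairs S \<Longrightarrow> a \<in> FObj Z S \<and> b \<in> FObj Z S"
  by (auto simp: pairs_def intro: hom_in[OF f] hom_in[OF g])

lemma conn_in: "(a, b) \<in> conn S \<Longrightarrow> S \<in> ED \<Longrightarrow> a \<in> FObj Z S \<Longrightarrow> b \<in> FObj Z S"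
  unfolding conn_def
proof (induction rule: rtrancl_induct)
  case (step b c)
  then show ?case using pairs_in[of S b c] pairs_in[of S c b] by blast
qed

lemma pairs_arr:
  assumes S: "S \<in> ED" "R \<in> ED" "h \<in> cmaps R S" and ab: "(a, b) \<in> pairs S"
  shows "(FArr Z S R h a, FArr Z S R h b) \<in> pairs R"
proof -
  obtain y where y: "y \<in> FObj Y S" "a = f S y" "b = g S y" using ab by (auto simp: pairs_def)
  have "FArr Y S R h y \<in> FObj Y R" using arr_in[OF CondSet_functor[OF Y] S y(1)] .
  then show ?thesis
    unfolding pairs_def y(2,3) hom_nat[OF f S y(1), symmetric] hom_nat[OF g S y(1), symmetric] by blast
qed

lemma conn_arr:
  assumes S: "S \<in> ED" "R \<in> ED" "h \<in> cmaps R S" and ab: "(a, b) \<in> conn S"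
  shows "(FArr Z S R h a, FArr Z S R h b) \<in> conn R"
  using ab unfolding conn_def
proof (induction rule: rtrancl_induct)
  case (step b c)
  then have "(FArr Z S R h b, FArr Z S R h c) \<in> pairs R \<union> (pairs R)\<inverse>" using pairs_arr[OF S] by auto
  with step show ?case by (meson rtrancl.rtrancl_into_rtrancl)
qed simp

lemma sym_conn: "(a, b) \<in> conn S \<Longrightarrow> (b, a) \<in> conn S"
  using sym_rtrancl[OF sym_Un_converse, of "pairs S"] unfolding conn_def by (blast dest: symD)

text \<open>The simultaneous section pads a chain in one summand by a constant chain in the other.\<close>

lemma conn_glue:
  assumes S: "S1 \<in> ED" "S2 \<in> ED" "S \<in> ED" and sp: "split_by S1 i1 S2 i2 S"
    and ab: "(a, b) \<in> conn S1" and a: "a \<in> FObj Z S1" and c: "c \<in> FObj Z S2"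
    and p: "p \<in> FObj Z S" "FArr Z S S1 i1 p = a" "FArr Z S S2 i2 p = c"
    and q: "q \<in> FObj Z S" "FArr Z S S1 i1 q = b" "FArr Z S S2 i2 q = c"
  shows "(p, q) \<in> conn S"
  using ab[unfolded conn_def] q
proof (induction arbitrary: q rule: rtrancl_induct)
  case base
  then have "p = q" using sp p Z unfolding split_by_def by metis
  then show ?case by (simp add: conn_def)
next
  case (step b b')
  note i = sp[unfolded split_by_def, THEN conjunct1] sp[unfolded split_by_def, THEN conjunct2, THEN conjunct1]
  have glue: "\<exists>t\<in>FObj T S. FArr T S S1 i1 t = x1 \<and> FArr T S S2 i2 t = x2"
    if "T \<in> Obj CondSet" "x1 \<in> FObj T S1" "x2 \<in> FObj T S2" for T x1 x2
    using sp that unfolding split_by_def by blast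
  have uniq: "x = y" if "x \<in> FObj Z S" "y \<in> FObj Z S" "FArr Z S S1 i1 x = FArr Z S S1 i1 y"
    "FArr Z S S2 i2 x = FArr Z S S2 i2 y" for x y
    using sp that Z unfolding split_by_def by blast
  have "b \<in> FObj Z S1" using conn_in[OF _ S(1) a] step.hyps(1) by (simp add: conn_def)
  then obtain q0 where q0: "q0 \<in> FObj Z S" "FArr Z S S1 i1 q0 = b" "FArr Z S S2 i2 q0 = c"
    using glue[OF Z _ c] by blast
  have pq0: "(p, q0) \<in> conn S" using step.IH[OF q0] .
  have pair: "(x, y) \<in> pairs S"
    if asm: "(a1, a2) \<in> pairs S1" "x \<in> FObj Z S" "FArr Z S S1 i1 x = a1" "FArr Z S S2 i2 x = c"
      "y \<in> FObj Z S" "FArr Z S S1 i1 y = a2" "FArr Z S S2 i2 y = c" for a1 a2 x y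
  proof -
    obtain w where w: "w \<in> FObj Y S1" "f S1 w = a1" "g S1 w = a2" using asm(1) by (auto simp: pairs_def)
    have sc: "s S2 c \<in> FObj Y S2" using hom_in[OF s S(2) c] .
    \<comment> \<open>\<open>f\<close> and \<open>g\<close> both send \<open>s S2 c\<close> to
      \<open>c\<close>, so the glued element \<open>t\<close> realizes the given pair over
      \<open>S1\<close> and the pair \<open>(c, c)\<close> over \<open>S2\<close>.\<close>
    obtain t where t: "t \<in> FObj Y S" "FArr Y S S1 i1 t = w" "FArr Y S S2 i2 t = s S2 c"
      using glue[OF Y w(1) sc] by blast
    have "f S t = x"
      by (rule uniq[OF hom_in[OF f S(3) t(1)] asm(2)])
        (simp_all add: hom_nat[OF f S(3,1) i(1) t(1), symmetric] hom_nat[OF f S(3,2) i(2) t(1), symmetric]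
          t w asm fs'[OF S(2) c])
    moreover have "g S t = y"
      by (rule uniq[OF hom_in[OF g S(3) t(1)] asm(5)])
        (simp_all add: hom_nat[OF g S(3,1) i(1) t(1), symmetric] hom_nat[OF g S(3,2) i(2) t(1), symmetric]
          t w asm gs'[OF S(2) c])
    ultimately show ?thesis using t(1) by (auto simp: pairs_def)
  qed
  have "(q0, q) \<in> pairs S \<union> (pairs S)\<inverse>"
    using step.hyps(2) pair[OF _ q0 step.prems] pair[OF _ step.prems q0] by blast
  with pq0 show ?case unfolding conn_def by (meson rtrancl.rtrancl_into_rtrancl)
qed

text \<open>The index set with one point turns the single object \<open>Z\<close> into a family as
  \<open>presheaf_quotient\<close> expects it.\<close>

definition "pts = (\<lambda>S. {()} \<times> FObj Z S)"

definition "pair_rel S = {(((), a), ((), b)) | a b. (a, b) \<in> pairs S}"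

definition "conn_rel S = {(((), a), ((), b)) | a b. a \<in> FObj Z S \<and> (a, b) \<in> conn S}"

lemma conn_gen: "(a, b) \<in> conn S \<Longrightarrow> (((), a), ((), b)) \<in> (pair_rel S \<union> (pair_rel S)\<inverse>)\<^sup>*"
  unfolding conn_def
proof (induction rule: rtrancl_induct)
  case (step b c)
  then have "(((), b), ((), c)) \<in> pair_rel S \<union> (pair_rel S)\<inverse>" by (auto simp: pair_rel_def)
  with step show ?case by (meson rtrancl.rtrancl_into_rtrancl)
qed simp

lemma quotient: "\<exists>\<kappa>. presheaf_quotient {()} (\<lambda>_. Z) \<kappa> pts pair_rel conn_rel"
proof -
  \<comment> \<open>\<open>bool\<close> indexes the family of \<open>Y\<close> and \<open>Z\<close>.
    One \<open>\<kappa>\<close> has to serve both: \<open>Z\<close> is the object divided out, and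
    the generating pairs descend because \<open>Y\<close> is Kan extended.\<close>
  have "small TYPE('u) (UNIV :: bool set)" by (simp add: small_finite)
  then have "\<exists>\<kappa> :: 'u rel. uncountable_strong_limit \<kappa> \<and> \<kappa> <o |UNIV :: 'u set| \<and>
     (\<forall>b\<in>UNIV. kan_from (small_ED \<kappa>) (if b then Y else Z))"
    by (rule common_kappa) (simp add: Y Z)
  then obtain \<kappa> :: "'u rel" where \<kappa>: "uncountable_strong_limit \<kappa>" "\<kappa> <o |UNIV :: 'u set|"
    "\<And>b. kan_from (small_ED \<kappa>) (if b then Y else Z)"
    by blast
  have kY: "kan_from (small_ED \<kappa>) Y"
    and kZ: "kan_from (small_ED \<kappa>) Z"
    using \<kappa>(3)[of True] \<kappa>(3)[of False] by auto
  have "presheaf_quotient {()} (\<lambda>_. Z) \<kappa> pts pair_rel conn_rel"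
  proof unfold_locales
    show "small TYPE('u) {()}" "{()} \<noteq> {}" by (simp_all add: small_finite)
    show "pts = (\<lambda>S. SIGMA i:{()}. FObj Z S)" by (simp add: pts_def)
    show "uncountable_strong_limit \<kappa>" "\<kappa> <o |UNIV :: 'u set|" by (fact \<kappa>)+
    show "Z \<in> Obj CondSet" by (rule Z)
    show "kan_from (small_ED \<kappa>) Z" by (rule kZ)
  next
    fix S :: "'u topology" assume S: "S \<in> ED"
    show "equiv (pts S) (conn_rel S)"
    proof (rule equivI)
      show "conn_rel S \<subseteq> pts S \<times> pts S" using conn_in[OF _ S] by (auto simp: conn_rel_def pts_def)
      show "refl_on (pts S) (conn_rel S)"
        by (auto simp: refl_on_def conn_rel_def pts_def conn_def)
      show "sym (conn_rel S)" using conn_in[OF _ S] sym_conn by (auto simp: sym_def conn_rel_def)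
      show "trans (conn_rel S)" by (auto simp: trans_def conn_rel_def conn_def)
    qed
    show "conn_rel S \<subseteq> (pair_rel S \<union> (pair_rel S)\<inverse>)\<^sup>*" using conn_gen by (auto simp: conn_rel_def)
    show "pair_rel S \<subseteq> conn_rel S" using pairs_in[OF S] by (auto simp: conn_rel_def pair_rel_def conn_def)
  next
    fix S R :: "'u topology" and h i x j y
    assume S: "S \<in> ED" "R \<in> ED" "h \<in> cmaps R S" and "((i, x), (j, y)) \<in> conn_rel S"
    then have "x \<in> FObj Z S" "(x, y) \<in> conn S" by (auto simp: conn_rel_def)
    then show "((i, FArr Z S R h x), (j, FArr Z S R h y)) \<in> conn_rel R"
      using conn_arr[OF S] arr_in[OF CondSet_functor[OF Z] S] by (auto simp: conn_rel_def)
  next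
    fix c :: "'u topology" and i z j z'
    assume c: "c \<in> ED" and "((i, z), (j, z')) \<in> pair_rel c"
    then obtain y where y: "y \<in> FObj Y c" "z = f c y" "z' = g c y" by (auto simp: pair_rel_def pairs_def)
    obtain a h w where a: "a \<in> small_ED \<kappa>" "h \<in> cmaps c a" "w \<in> FObj Y a" "FArr Y a c h w = y"
      using kan_surj[OF CondSet_functor[OF Y] small_ED_subset kY c y(1)] by blast
    have aE: "a \<in> ED" using a(1) small_ED_subset by blast
    have "z = FArr Z a c h (f a w)" "z' = FArr Z a c h (g a w)"
      using y a hom_nat[OF f aE c a(2,3)] hom_nat[OF g aE c a(2,3)] by simp_all
    moreover have "((i, f a w), (j, g a w)) \<in> pair_rel a" using a by (auto simp: pair_rel_def pairs_def)
    ultimately show "\<exists>a\<in>small_ED \<kappa>. \<exists>h\<in>cmaps c a. \<exists>w w'. ((i, w), (j, w')) \<in> pair_rel a \<and>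
        z = FArr Z a c h w \<and> z' = FArr Z a c h w'"
      using a(1,2) by blast
  next
    fix p q assume "p \<in> pts (discrete_topology {} :: 'u topology)" "q \<in> pts (discrete_topology {} :: 'u topology)"
    moreover obtain e where "FObj Z (discrete_topology {} :: 'u topology) = {e}" using CondSet_empty[OF Z] by blast
    ultimately show "(p, q) \<in> conn_rel (discrete_topology {} :: 'u topology)"
      by (auto simp: pts_def conn_rel_def conn_def)
  next
    fix S1 S2 :: "'u topology" and i x j y
    assume "(i, x) \<in> pts S1" "(j, y) \<in> pts S2"
    then have "((i, x), ((), x)) \<in> conn_rel S1 \<and> ((j, y), ((), y)) \<in> conn_rel S2"
      by (auto simp: pts_def conn_rel_def conn_def)
    then show "\<exists>k z z'. ((i, x), (k, z)) \<in> conn_rel S1 \<and> ((j, y), (k, z')) \<in> conn_rel S2" by blast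
  next
    fix S1 S2 S :: "'u topology" and i1 i2 i x j y
    assume S: "S1 \<in> ED" "S2 \<in> ED" "S \<in> ED" and d: "disj_sum S1 S2 S i1 i2"
      and x: "(i, x) \<in> pts S" and y: "(j, y) \<in> pts S"
      and 1: "((i, FArr Z S S1 i1 x), (j, FArr Z S S1 i1 y)) \<in> conn_rel S1"
      and 2: "((i, FArr Z S S2 i2 x), (j, FArr Z S S2 i2 y)) \<in> conn_rel S2"
    note sp = disj_sum_split_by[OF S d]
    have c1: "(FArr Z S S1 i1 x, FArr Z S S1 i1 y) \<in> conn S1"
      and c2: "(FArr Z S S2 i2 x, FArr Z S S2 i2 y) \<in> conn S2" using 1 2 by (auto simp: conn_rel_def)
    have xy: "x \<in> FObj Z S" "y \<in> FObj Z S" using x y by (auto simp: pts_def)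
    note ic = disj_sum_cmaps[OF d]
    have m: "FArr Z S S1 i1 x \<in> FObj Z S1" "FArr Z S S1 i1 y \<in> FObj Z S1"
      "FArr Z S S2 i2 x \<in> FObj Z S2" "FArr Z S S2 i2 y \<in> FObj Z S2"
      using arr_in[OF CondSet_functor[OF Z]] S ic xy by auto
    \<comment> \<open>The passage from \<open>x\<close> to \<open>y\<close> changes one summand at a
      time; \<open>t\<close> already agrees with \<open>y\<close> over \<open>S1\<close> and still
      with \<open>x\<close> over \<open>S2\<close>.\<close>
    obtain t where t: "t \<in> FObj Z S" "FArr Z S S1 i1 t = FArr Z S S1 i1 y" "FArr Z S S2 i2 t = FArr Z S S2 i2 x"
      using sum_cond_ex[OF CondSet_sum[OF Z] S d m(2,3)] by blast
    have "(x, t) \<in> conn S" by (rule conn_glue[OF S sp c1 m(1,3) xy(1) refl refl t])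
    moreover have "(t, y) \<in> conn S"
      by (rule conn_glue[OF S(2,1,3) split_by_sym[OF sp] c2 m(3,2) t(1,3,2) xy(2) refl refl])
    ultimately have "(x, y) \<in> conn S" by (auto simp: conn_def)
    then show "((i, x), (j, y)) \<in> conn_rel S" using xy by (auto simp: conn_rel_def)
  qed
  then show ?thesis by blast
qed

text \<open>The class map coequalizes \<open>f\<close> and \<open>g\<close> because
  \<open>pair_rel\<close> lies in \<open>conn_rel\<close>; then \<open>colimit_pointwise\<close>
  applies with \<open>q\<close> as the only leg.\<close>

lemma coequalizer_eval:
  assumes coeq: "is_coequalizer CondSet Y Z f g Q q" and S: "S \<in> ED"
  shows "y \<in> FObj Q S \<Longrightarrow> \<exists>x\<in>FObj Z S. q S x = y"
    and "x \<in> FObj Z S \<Longrightarrow> x' \<in> FObj Z S \<Longrightarrow> q S x = q S x' \<Longrightarrow> (x, x') \<in> conn S"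
proof -
  obtain \<kappa> where "presheaf_quotient {()} (\<lambda>_. Z) \<kappa> pts pair_rel conn_rel" using quotient by blast
  then interpret P: presheaf_quotient "TYPE('u)" "{()}" "\<lambda>_. Z" \<kappa> pts pair_rel conn_rel .
  have c: "Q \<in> Obj CondSet" "q \<in> Hom CondSet Z Q" "Comp CondSet Y Z Q q f = Comp CondSet Y Z Q q g"
    using coeq by (auto simp: is_coequalizer_def)
  note Zf = CondSet_functor[OF Z] and Qf = CondSet_functor[OF c(1)] and Yf = CondSet_functor[OF Y]
  have un: "\<exists>!h. h \<in> Hom CondSet Q W \<and> Comp CondSet Z Q W h q = r"
    if "W \<in> Obj CondSet" "r \<in> Hom CondSet Z W" "Comp CondSet Y Z W r f = Comp CondSet Y Z W r g" for W r
    using coeq that by (auto simp: is_coequalizer_def)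
  have resp: "q S x = q S y" if asm: "S \<in> ED" "((i, x), (j, y)) \<in> pair_rel S" for S i x j y
  proof -
    obtain w where w: "w \<in> FObj Y S" "x = f S w" "y = g S w" using asm(2) by (auto simp: pair_rel_def pairs_def)
    show ?thesis using fun_cong[OF fun_cong[OF c(3), of S], of w] w asm(1) by simp
  qed
  have lam: "P.lam () \<in> Hom CondSet Z P.L" using P.lam_hom by simp
  have "Comp CondSet Y Z P.L (P.lam ()) f = Comp CondSet Y Z P.L (P.lam ()) g"
  proof (rule hom_ext[OF hom_comp[OF Yf f lam] hom_comp[OF Yf g lam]])
    fix S :: "'u topology" and x assume x: "S \<in> ED" "x \<in> FObj Y S"
    have "(((), f S x), ((), g S x)) \<in> conn_rel S"
      using P.rho_r[OF x(1)] x by (auto simp: pair_rel_def pairs_def)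
    then show "Comp CondSet Y Z P.L (P.lam ()) f S x = Comp CondSet Y Z P.L (P.lam ()) g S x"
      using P.lam_eq[of "()" "()" S "f S x" "g S x"] x hom_in[OF f x] hom_in[OF g x] by simp
  qed
  from un[OF P.L_CondSet lam this]
  have ex: "\<exists>h\<in>Hom CondSet Q P.L. \<forall>i\<in>{()}. Comp CondSet Z Q P.L h q = P.lam i" by auto
  have uniq: "h = Ident CondSet Q"
    if h: "h \<in> Hom CondSet Q Q" "\<forall>i\<in>{()}. Comp CondSet Z Q Q h q = q" for h
  proof (rule ex1_unique[OF un[OF c]])
    show "h \<in> Hom CondSet Q Q \<and> Comp CondSet Z Q Q h q = q" using h by simp
    have "Comp CondSet Z Q Q (Ident CondSet Q) q = q"
      by (rule hom_ext[OF hom_comp[OF Zf c(2) hom_ident[OF Qf]] c(2)]) (simp add: hom_in[OF c(2)])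
    then show "Ident CondSet Q \<in> Hom CondSet Q Q \<and> Comp CondSet Z Q Q (Ident CondSet Q) q = q"
      using hom_ident[OF Qf] by blast
  qed
  have qh: "\<And>i. i \<in> {()} \<Longrightarrow> q \<in> Hom CondSet Z Q" by (rule c(2))
  note pw = P.colimit_pointwise[where C = Q and \<gamma> = "\<lambda>_. q", OF c(1) qh]
  show "\<exists>x\<in>FObj Z S. q S x = y" if y: "y \<in> FObj Q S"
  proof -
    have "\<exists>i\<in>{()}. \<exists>x\<in>FObj Z S. q S x = y"
      by (rule pw(1)[OF _ _ ex uniq S y]) (assumption | rule resp)+
    then show ?thesis by simp
  qed
  show "(x, x') \<in> conn S" if x: "x \<in> FObj Z S" "x' \<in> FObj Z S" "q S x = q S x'"
  proof -
    have "(((), x), ((), x')) \<in> conn_rel S"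
      by (rule pw(2)[OF _ _ ex uniq S _ _ x]) (assumption | rule resp | simp)+
    then show ?thesis by (simp add: conn_rel_def)
  qed
qed

end

section \<open>Representable condensed sets are compact and projective\<close>

text \<open>\<open>u\<close> is a universal element: evaluation at \<open>u\<close> is a bijection
  from Hom(T, W) onto W(S). In this form the Yoneda lemma applies directly to every isomorphic copy
  of \<open>underline S\<close>.\<close>

definition represented :: "'u presheaf \<Rightarrow> 'u topology \<Rightarrow> ('u \<Rightarrow> 'u) \<Rightarrow> bool" where
  "represented T S u \<longleftrightarrow> T \<in> Obj CondSet \<and> S \<in> ED \<and> u \<in> FObj T S \<and>
     (\<forall>W\<in>Obj CondSet. \<forall>w\<in>FObj W S. \<exists>!\<eta>. \<eta> \<in> Hom CondSet T W \<and> \<eta> S u = w)"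

lemma represented_ex:
  "represented T S u \<Longrightarrow> W \<in> Obj CondSet \<Longrightarrow> w \<in> FObj W S \<Longrightarrow> \<exists>\<eta>\<in>Hom CondSet T W. \<eta> S u = w"
  unfolding represented_def by blast

lemma represented_unique:
  assumes "represented T S u" "W \<in> Obj CondSet" "\<eta> \<in> Hom CondSet T W" "\<theta> \<in> Hom CondSet T W" "\<eta> S u = \<theta> S u"
  shows "\<eta> = \<theta>"
proof -
  have "\<eta> S u \<in> FObj W S" using assms hom_in unfolding represented_def by blast
  then have 1: "\<exists>!\<xi>. \<xi> \<in> Hom CondSet T W \<and> \<xi> S u = \<eta> S u" using assms unfolding represented_def by blast
  show ?thesis by (rule ex1_unique[OF 1]) (simp_all add: assms)
qed

text \<open>The mediating map sends \<open>y\<close> to the value of \<open>\<delta>\<close> at any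
  preimage of \<open>y\<close>; hypothesis \<open>eq\<close> makes the choice of the preimage
  irrelevant.\<close>

lemma set_colimitI:
  assumes cone: "is_cocone J (set_cat UNIV) G L \<nu>"
    and surj: "\<And>y. y \<in> L \<Longrightarrow> \<exists>j\<in>Obj J. \<exists>x\<in>FObj G j. \<nu> j x = y"
    and eq: "\<And>W \<delta>. is_cocone J (set_cat UNIV) G W \<delta> \<Longrightarrow>
      \<forall>i\<in>Obj J. \<forall>j\<in>Obj J. \<forall>x\<in>FObj G i. \<forall>y\<in>FObj G j. \<nu> i x = \<nu> j y \<longrightarrow> \<delta> i x = \<delta> j y"
  shows "is_colimit J (set_cat UNIV) G L \<nu>"
  unfolding is_colimit_def
proof (intro conjI cone allI impI)
  fix W \<delta> assume \<delta>: "is_cocone J (set_cat UNIV) G W \<delta>"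
  have \<nu>in: "\<nu> j \<in> FObj G j \<rightarrow>\<^sub>E L" and \<delta>in: "\<delta> j \<in> FObj G j \<rightarrow>\<^sub>E W" if "j \<in> Obj J" for j
    using cone \<delta> that by (auto simp: is_cocone_def set_cat_def)
  define h where "h = (\<lambda>y\<in>L. SOME w. \<exists>j\<in>Obj J. \<exists>x\<in>FObj G j. \<nu> j x = y \<and> \<delta> j x = w)"
  have h: "h (\<nu> j x) = \<delta> j x" if j: "j \<in> Obj J" "x \<in> FObj G j" for j x
  proof -
    have "\<exists>w. \<exists>i\<in>Obj J. \<exists>x'\<in>FObj G i. \<nu> i x' = \<nu> j x \<and> \<delta> i x' = w" using j by blast
    note ex = this
    have h_eq: "h (\<nu> j x) = (SOME w. \<exists>i\<in>Obj J. \<exists>x'\<in>FObj G i. \<nu> i x' = \<nu> j x \<and> \<delta> i x' = w)"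
      using PiE_mem[OF \<nu>in[OF j(1)] j(2)] by (simp add: h_def)
    have "\<exists>i\<in>Obj J. \<exists>x'\<in>FObj G i. \<nu> i x' = \<nu> j x \<and> \<delta> i x' = h (\<nu> j x)"
      unfolding h_eq by (rule someI_ex[OF ex])
    then obtain i x' where i: "i \<in> Obj J" "x' \<in> FObj G i" "\<nu> i x' = \<nu> j x" "\<delta> i x' = h (\<nu> j x)"
      by blast
    have "\<delta> i x' = \<delta> j x" using eq[OF \<delta>, rule_format, OF i(1) j(1) i(2) j(2) i(3)] .
    with i(4) show ?thesis by simp
  qed
  have hW: "h \<in> L \<rightarrow>\<^sub>E W"
  proof (rule PiE_I)
    fix y assume "y \<in> L"
    then obtain j x where "j \<in> Obj J" "x \<in> FObj G j" "\<nu> j x = y" using surj by blast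
    then show "h y \<in> W" using h \<delta>in by (metis PiE_mem)
  qed (simp add: h_def)
  have comp: "compose (FObj G j) k (\<nu> j) = \<delta> j \<longleftrightarrow> (\<forall>x\<in>FObj G j. k (\<nu> j x) = \<delta> j x)" if "j \<in> Obj J" for j k
    using \<delta>in[OF that] by (auto simp: compose_def fun_eq_iff PiE_def extensional_def)
  show "\<exists>!h. h \<in> Hom (set_cat UNIV) L W \<and> (\<forall>j\<in>Obj J. Comp (set_cat UNIV) (FObj G j) L W h (\<nu> j) = \<delta> j)"
  proof (rule ex1I[of _ h])
    show "h \<in> Hom (set_cat UNIV) L W \<and> (\<forall>j\<in>Obj J. Comp (set_cat UNIV) (FObj G j) L W h (\<nu> j) = \<delta> j)"
      using hW h comp by (simp add: set_cat_def)
    fix k assume "k \<in> Hom (set_cat UNIV) L W \<and> (\<forall>j\<in>Obj J. Comp (set_cat UNIV) (FObj G j) L W k (\<nu> j) = \<delta> j)"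
    then have k: "k \<in> L \<rightarrow>\<^sub>E W" "\<And>j x. j \<in> Obj J \<Longrightarrow> x \<in> FObj G j \<Longrightarrow> k (\<nu> j x) = \<delta> j x"
      using comp by (auto simp: set_cat_def)
    show "k = h"
    proof (rule PiE_ext[OF k(1) hW])
      fix y assume "y \<in> L"
      then obtain j x where "j \<in> Obj J" "x \<in> FObj G j" "\<nu> j x = y" using surj by blast
      then show "k y = h y" using k h by metis
    qed
  qed
qed

context universe begin

text \<open>Evaluation at \<open>u\<close> turns Hom(T, X j) into the value of X j at
  \<open>S\<close>, where \<open>colimit_eval\<close> applies. Elements are lifted back to morphisms
  by the existence part of representability, equalities by its uniqueness part.\<close>

lemma represented_compact:
  fixes T :: "'u presheaf"
  assumes rep: "represented T S u"
  shows "compact_object TYPE('u) CondSet T"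
  unfolding compact_object_def
proof (intro conjI allI impI)
  show T: "T \<in> Obj CondSet" using rep by (simp add: represented_def)
  note Tf = CondSet_functor[OF T]
  have S: "S \<in> ED" and u: "u \<in> FObj T S" using rep by (auto simp: represented_def)
  fix J :: "('u, 'u) cat" and X :: "('u, 'u, 'u presheaf, 'u topology \<Rightarrow> ('u \<Rightarrow> 'u) \<Rightarrow> ('u \<Rightarrow> 'u)) func"
    and c \<iota>
  assume asm: "small_cat TYPE('u) J \<and> filtered_cat J \<and> is_functor J CondSet X \<and> is_colimit J CondSet X c \<iota>"
  then have "small TYPE('u) (Obj J)" "filtered_cat J" "is_functor J CondSet X"
    unfolding small_cat_def by blast+
  then interpret D: filtered_diagram "TYPE('u)" J X
    by unfold_locales
  have col: "is_colimit J CondSet X c \<iota>" using asm by blast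
  have c: "c \<in> Obj CondSet" "\<And>i. i \<in> Obj J \<Longrightarrow> \<iota> i \<in> Hom CondSet (FObj X i) c"
    "\<And>i j u. i \<in> Obj J \<Longrightarrow> j \<in> Obj J \<Longrightarrow> u \<in> Hom J i j \<Longrightarrow> Comp CondSet (FObj X i) (FObj X j) c (\<iota> j) (FArr X i j u) = \<iota> i"
    using col by (auto simp: is_colimit_def is_cocone_def)
  let ?G = "comp_func (hom_functor CondSet T) X"
  let ?\<nu> = "\<lambda>j. FArr (hom_functor CondSet T) (FObj X j) c (\<iota> j)"
  have G: "FObj ?G j = Hom CondSet T (FObj X j)"
    "FArr ?G i j v = (\<lambda>\<eta>\<in>Hom CondSet T (FObj X i). Comp CondSet T (FObj X i) (FObj X j) (FArr X i j v) \<eta>)"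
    "?\<nu> j = (\<lambda>\<eta>\<in>Hom CondSet T (FObj X j). Comp CondSet T (FObj X j) c (\<iota> j) \<eta>)"
    "FObj (hom_functor CondSet T) c = Hom CondSet T c" for i j v
    by (simp_all add: comp_func_def hom_functor_def)
  show "is_colimit J (set_cat UNIV) ?G (FObj (hom_functor CondSet T) c) ?\<nu>"
  proof (rule set_colimitI)
    show "is_cocone J (set_cat UNIV) ?G (FObj (hom_functor CondSet T) c) ?\<nu>"
      unfolding is_cocone_def G
    proof (intro conjI ballI)
      fix i j v assume v: "i \<in> Obj J" "j \<in> Obj J" "v \<in> Hom J i j"
      show "Comp (set_cat UNIV) (Hom CondSet T (FObj X i)) (Hom CondSet T (FObj X j)) (Hom CondSet T c)
         (\<lambda>\<eta>\<in>Hom CondSet T (FObj X j). Comp CondSet T (FObj X j) c (\<iota> j) \<eta>)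
         (\<lambda>\<eta>\<in>Hom CondSet T (FObj X i). Comp CondSet T (FObj X i) (FObj X j) (FArr X i j v) \<eta>) =
         (\<lambda>\<eta>\<in>Hom CondSet T (FObj X i). Comp CondSet T (FObj X i) c (\<iota> i) \<eta>)"
        unfolding set_cat_def compose_def cat.simps
      proof (rule restrict_ext)
        fix \<eta> assume \<eta>: "\<eta> \<in> Hom CondSet T (FObj X i)"
        show "(\<lambda>\<eta>\<in>Hom CondSet T (FObj X j). Comp CondSet T (FObj X j) c (\<iota> j) \<eta>)
          ((\<lambda>\<eta>\<in>Hom CondSet T (FObj X i). Comp CondSet T (FObj X i) (FObj X j) (FArr X i j v) \<eta>) \<eta>) =
          Comp CondSet T (FObj X i) c (\<iota> i) \<eta>"
          unfolding restrict_apply'[OF \<eta>] restrict_apply'[OF hom_comp[OF Tf \<eta> D.X_hom[OF v]]]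
            hom_assoc[OF Tf \<eta>, symmetric] c(3)[OF v] ..
      qed
    qed (auto simp: set_cat_def intro: hom_comp[OF Tf _ c(2)])
  next
    fix \<zeta> assume "\<zeta> \<in> FObj (hom_functor CondSet T) c"
    then have \<zeta>: "\<zeta> \<in> Hom CondSet T c" by (simp add: G)
    obtain j x where j: "j \<in> Obj J" "x \<in> FObj (FObj X j) S" "\<iota> j S x = \<zeta> S u"
      using D.colimit_eval(1)[OF col S hom_in[OF \<zeta> S u]] by blast
    obtain \<eta> where \<eta>: "\<eta> \<in> Hom CondSet T (FObj X j)" "\<eta> S u = x"
      using represented_ex[OF rep D.X_obj[OF j(1)] j(2)] by blast
    have "Comp CondSet T (FObj X j) c (\<iota> j) \<eta> = \<zeta>"
      by (rule represented_unique[OF rep c(1) hom_comp[OF Tf \<eta>(1) c(2)[OF j(1)]] \<zeta>]) (simp add: S u \<eta> j)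
    then show "\<exists>j\<in>Obj J. \<exists>\<eta>\<in>FObj ?G j. ?\<nu> j \<eta> = \<zeta>" unfolding G using j \<eta> by auto
  next
    fix W \<delta>
    assume \<delta>: "is_cocone J (set_cat UNIV) ?G W \<delta>"
    show "\<forall>i\<in>Obj J. \<forall>j\<in>Obj J. \<forall>x\<in>FObj ?G i. \<forall>y\<in>FObj ?G j. ?\<nu> i x = ?\<nu> j y \<longrightarrow> \<delta> i x = \<delta> j y"
    proof (intro ballI impI)
      fix i j \<eta> \<theta>
      assume ij: "i \<in> Obj J" "j \<in> Obj J"
        and "\<eta> \<in> FObj ?G i" "\<theta> \<in> FObj ?G j" "?\<nu> i \<eta> = ?\<nu> j \<theta>"
      then have \<eta>: "\<eta> \<in> Hom CondSet T (FObj X i)" "\<theta> \<in> Hom CondSet T (FObj X j)"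
        "Comp CondSet T (FObj X i) c (\<iota> i) \<eta> = Comp CondSet T (FObj X j) c (\<iota> j) \<theta>"
        unfolding G by auto
      have "\<iota> i S (\<eta> S u) = \<iota> j S (\<theta> S u)"
        using fun_cong[OF fun_cong[OF \<eta>(3), of S], of u] S u by simp
      then have "((i, \<eta> S u), (j, \<theta> S u)) \<in> D.eventual_eq S"
        by (intro D.colimit_eval(2)[OF col S ij] hom_in[OF \<eta>(1) S u] hom_in[OF \<eta>(2) S u])
      then obtain k v w where k: "k \<in> Obj J" "v \<in> Hom J i k" "w \<in> Hom J j k"
        "FArr X i k v S (\<eta> S u) = FArr X j k w S (\<theta> S u)"
        by (auto simp: D.eventual_eq_def)
      \<comment> \<open>At stage \<open>k\<close> the two composites agree on \<open>u\<close>,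
        hence altogether; a cocone then takes the same value at \<open>\<eta>\<close> and at
        \<open>\<theta>\<close>, namely its value at the common composite.\<close>
      have "Comp CondSet T (FObj X i) (FObj X k) (FArr X i k v) \<eta> = Comp CondSet T (FObj X j) (FObj X k) (FArr X j k w) \<theta>"
        by (rule represented_unique[OF rep D.X_obj[OF k(1)] hom_comp[OF Tf \<eta>(1) D.X_hom[OF ij(1) k(1,2)]]
            hom_comp[OF Tf \<eta>(2) D.X_hom[OF ij(2) k(1,3)]]]) (simp add: S u k)
      moreover have "\<delta> k (FArr ?G i k v \<eta>) = \<delta> i \<eta>"
      proof -
        have "compose (FObj ?G i) (\<delta> k) (FArr ?G i k v) = \<delta> i"
          using \<delta> ij k by (auto simp: is_cocone_def set_cat_def)
        from fun_cong[OF this, of \<eta>] show ?thesis using \<eta> by (simp add: compose_def G)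
      qed
      moreover have "\<delta> k (FArr ?G j k w \<theta>) = \<delta> j \<theta>"
      proof -
        have "compose (FObj ?G j) (\<delta> k) (FArr ?G j k w) = \<delta> j"
          using \<delta> ij k by (auto simp: is_cocone_def set_cat_def)
        from fun_cong[OF this, of \<theta>] show ?thesis using \<eta> by (simp add: compose_def G)
      qed
      ultimately show "\<delta> i \<eta> = \<delta> j \<theta>" using \<eta> by (simp add: G)
    qed
  qed
qed

text \<open>As for compactness, evaluation at \<open>u\<close> reduces everything to values at
  \<open>S\<close>, where \<open>coequalizer_eval\<close> gives surjectivity of \<open>q\<close> and
  zigzags for its fibres.\<close>

lemma represented_projective:
  fixes T :: "'u presheaf"
  assumes rep: "represented T S u"
  shows "projective_object CondSet T"
  unfolding projective_object_def
proof (intro conjI ballI allI impI)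
  show T: "T \<in> Obj CondSet" using rep by (simp add: represented_def)
  note Tf = CondSet_functor[OF T]
  have S: "S \<in> ED" and u: "u \<in> FObj T S" using rep by (auto simp: represented_def)
  fix Y Z :: "'u presheaf" and f g Q q
  assume Y: "Y \<in> Obj CondSet" and Z: "Z \<in> Obj CondSet" and f: "f \<in> Hom CondSet Y Z" and g: "g \<in> Hom CondSet Y Z"
    and asm: "(\<exists>s\<in>Hom CondSet Z Y. Comp CondSet Z Y Z f s = Ident CondSet Z \<and> Comp CondSet Z Y Z g s = Ident CondSet Z) \<and>
        is_coequalizer CondSet Y Z f g Q q"
  then obtain s where "s \<in> Hom CondSet Z Y" "Comp CondSet Z Y Z f s = Ident CondSet Z"
    "Comp CondSet Z Y Z g s = Ident CondSet Z" by blast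
  then interpret R: reflexive_pair "TYPE('u)" Y Z f g s
    using Y Z f g by unfold_locales
  have coeq: "is_coequalizer CondSet Y Z f g Q q" using asm by blast
  have c: "Q \<in> Obj CondSet" "q \<in> Hom CondSet Z Q" "Comp CondSet Y Z Q q f = Comp CondSet Y Z Q q g"
    using coeq by (auto simp: is_coequalizer_def)
  let ?H = "hom_functor CondSet T"
  have H: "FObj ?H A = Hom CondSet T A"
    "FArr ?H A B \<phi> = (\<lambda>\<eta>\<in>Hom CondSet T A. Comp CondSet T A B \<phi> \<eta>)" for A B \<phi>
    by (simp_all add: hom_functor_def)
  have surj: "\<exists>\<eta>\<in>Hom CondSet T Z. Comp CondSet T Z Q q \<eta> = \<zeta>" if \<zeta>: "\<zeta> \<in> Hom CondSet T Q" for \<zeta>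
  proof -
    obtain x where x: "x \<in> FObj Z S" "q S x = \<zeta> S u"
      using R.coequalizer_eval(1)[OF coeq S hom_in[OF \<zeta> S u]] by blast
    obtain \<eta> where \<eta>: "\<eta> \<in> Hom CondSet T Z" "\<eta> S u = x" using represented_ex[OF rep Z x(1)] by blast
    have "Comp CondSet T Z Q q \<eta> = \<zeta>"
      by (rule represented_unique[OF rep c(1) hom_comp[OF Tf \<eta>(1) c(2)] \<zeta>]) (simp add: S u \<eta> x)
    then show ?thesis using \<eta> by blast
  qed
  show "is_coequalizer (set_cat UNIV) (FObj ?H Y) (FObj ?H Z) (FArr ?H Y Z f) (FArr ?H Y Z g) (FObj ?H Q) (FArr ?H Z Q q)"
    unfolding is_coequalizer_def H
  proof (intro conjI ballI impI)
    show "Hom CondSet T Q \<in> Obj (set_cat UNIV)" by (simp add: set_cat_def)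
    show "(\<lambda>\<eta>\<in>Hom CondSet T Z. Comp CondSet T Z Q q \<eta>) \<in> Hom (set_cat UNIV) (Hom CondSet T Z) (Hom CondSet T Q)"
      using hom_comp[OF Tf _ c(2)] by (auto simp: set_cat_def)
    have "Comp CondSet T Z Q q (Comp CondSet T Y Z f \<eta>) = Comp CondSet T Z Q q (Comp CondSet T Y Z g \<eta>)"
      if "\<eta> \<in> Hom CondSet T Y" for \<eta>
      using hom_assoc[OF Tf that, of Q Z q f] hom_assoc[OF Tf that, of Q Z q g] c(3) by simp
    then show "Comp (set_cat UNIV) (Hom CondSet T Y) (Hom CondSet T Z) (Hom CondSet T Q)
       (\<lambda>\<eta>\<in>Hom CondSet T Z. Comp CondSet T Z Q q \<eta>) (\<lambda>\<eta>\<in>Hom CondSet T Y. Comp CondSet T Y Z f \<eta>) =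
      Comp (set_cat UNIV) (Hom CondSet T Y) (Hom CondSet T Z) (Hom CondSet T Q)
       (\<lambda>\<eta>\<in>Hom CondSet T Z. Comp CondSet T Z Q q \<eta>) (\<lambda>\<eta>\<in>Hom CondSet T Y. Comp CondSet T Y Z g \<eta>)"
      unfolding set_cat_def compose_def cat.simps
      by (intro restrict_ext) (simp add: hom_comp[OF Tf _ f] hom_comp[OF Tf _ g])
  next
    fix W r
    assume "r \<in> Hom (set_cat UNIV) (Hom CondSet T Z) W"
      and req: "Comp (set_cat UNIV) (Hom CondSet T Y) (Hom CondSet T Z) W r (\<lambda>\<eta>\<in>Hom CondSet T Y. Comp CondSet T Y Z f \<eta>) =
        Comp (set_cat UNIV) (Hom CondSet T Y) (Hom CondSet T Z) W r (\<lambda>\<eta>\<in>Hom CondSet T Y. Comp CondSet T Y Z g \<eta>)"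
    then have r: "r \<in> Hom CondSet T Z \<rightarrow>\<^sub>E W" by (simp add: set_cat_def)
    have req': "r (Comp CondSet T Y Z f \<eta>) = r (Comp CondSet T Y Z g \<eta>)" if "\<eta> \<in> Hom CondSet T Y" for \<eta>
      using fun_cong[OF req, of \<eta>] that by (simp add: set_cat_def compose_def)
    \<comment> \<open>Induction along the zigzag: an intermediate point lifts to a morphism into
      \<open>Z\<close>, and each link lifts to a morphism \<open>\<mu>\<close> into
      \<open>Y\<close>, at which \<open>r\<close> takes equal values after composition with
      \<open>f\<close> and with \<open>g\<close>.\<close>
    have conn: "r \<eta> = r \<theta>" if asm: "\<eta> \<in> Hom CondSet T Z" "\<theta> \<in> Hom CondSet T Z" "(\<eta> S u, \<theta> S u) \<in> R.conn S" for \<eta> \<theta>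
      using asm(3)[unfolded R.conn_def] asm(2)
    proof (induction "\<theta> S u" arbitrary: \<theta> rule: rtrancl_induct)
      case base
      then show ?case using represented_unique[OF rep Z asm(1)] by metis
    next
      case (step b)
      have "b \<in> FObj Z S"
        using R.conn_in[OF _ S hom_in[OF asm(1) S u]] step.hyps(1) by (simp add: R.conn_def)
      then obtain \<xi> where \<xi>: "\<xi> \<in> Hom CondSet T Z" "\<xi> S u = b" using represented_ex[OF rep Z] by blast
      have pair: "r \<alpha> = r \<beta>" if ab: "\<alpha> \<in> Hom CondSet T Z" "\<beta> \<in> Hom CondSet T Z" "(\<alpha> S u, \<beta> S u) \<in> R.pairs S" for \<alpha> \<beta>
      proof -
        obtain y where y: "y \<in> FObj Y S" "f S y = \<alpha> S u" "g S y = \<beta> S u" using ab(3) by (auto simp: R.pairs_def)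
        obtain \<mu> where \<mu>: "\<mu> \<in> Hom CondSet T Y" "\<mu> S u = y" using represented_ex[OF rep Y y(1)] by blast
        have "Comp CondSet T Y Z f \<mu> = \<alpha>"
          by (rule represented_unique[OF rep Z hom_comp[OF Tf \<mu>(1) f] ab(1)]) (simp add: S u \<mu> y)
        moreover have "Comp CondSet T Y Z g \<mu> = \<beta>"
          by (rule represented_unique[OF rep Z hom_comp[OF Tf \<mu>(1) g] ab(2)]) (simp add: S u \<mu> y)
        ultimately show ?thesis using req'[OF \<mu>(1)] by simp
      qed
      have "r \<eta> = r \<xi>" using step.hyps(3)[of \<xi>] \<xi> by simp
      also have "r \<xi> = r \<theta>"
        using step.hyps(2) pair[OF \<xi>(1) step.prems] pair[OF step.prems \<xi>(1)] \<xi>(2) by auto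
      finally show ?case .
    qed
    \<comment> \<open>The choice is harmless: two lifts of \<open>\<zeta>\<close> have connected
      values at \<open>u\<close>, so \<open>r\<close> agrees on them by \<open>conn\<close>.\<close>
    define h where "h = (\<lambda>\<zeta>\<in>Hom CondSet T Q. SOME w. \<exists>\<eta>\<in>Hom CondSet T Z. Comp CondSet T Z Q q \<eta> = \<zeta> \<and> r \<eta> = w)"
    have h: "h (Comp CondSet T Z Q q \<eta>) = r \<eta>" if \<eta>: "\<eta> \<in> Hom CondSet T Z" for \<eta>
    proof -
      have "\<exists>w. \<exists>\<theta>\<in>Hom CondSet T Z. Comp CondSet T Z Q q \<theta> = Comp CondSet T Z Q q \<eta> \<and> r \<theta> = w" using \<eta> by blast
      note ex = this
      have h_eq: "h (Comp CondSet T Z Q q \<eta>) =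
          (SOME w. \<exists>\<theta>\<in>Hom CondSet T Z. Comp CondSet T Z Q q \<theta> = Comp CondSet T Z Q q \<eta> \<and> r \<theta> = w)"
        using hom_comp[OF Tf \<eta> c(2)] by (simp add: h_def)
      have "\<exists>\<theta>\<in>Hom CondSet T Z. Comp CondSet T Z Q q \<theta> = Comp CondSet T Z Q q \<eta> \<and>
          r \<theta> = h (Comp CondSet T Z Q q \<eta>)"
        unfolding h_eq by (rule someI_ex[OF ex])
      then obtain \<theta> where \<theta>: "\<theta> \<in> Hom CondSet T Z"
        "Comp CondSet T Z Q q \<theta> = Comp CondSet T Z Q q \<eta>" "r \<theta> = h (Comp CondSet T Z Q q \<eta>)"
        by blast
      have "q S (\<theta> S u) = q S (\<eta> S u)"
        using fun_cong[OF fun_cong[OF \<theta>(2), of S], of u] S u by simp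
      then have "(\<theta> S u, \<eta> S u) \<in> R.conn S"
        by (intro R.coequalizer_eval(2)[OF coeq S] hom_in[OF \<theta>(1) S u] hom_in[OF \<eta> S u])
      then show ?thesis using conn[OF \<theta>(1) \<eta>] \<theta>(3) by simp
    qed
    have hW: "h \<in> Hom CondSet T Q \<rightarrow>\<^sub>E W"
    proof (rule PiE_I)
      fix \<zeta> assume "\<zeta> \<in> Hom CondSet T Q"
      then obtain \<eta> where "\<eta> \<in> Hom CondSet T Z" "Comp CondSet T Z Q q \<eta> = \<zeta>" using surj by blast
      then show "h \<zeta> \<in> W" using h PiE_mem[OF r] by metis
    qed (simp add: h_def)
    have comp: "compose (Hom CondSet T Z) k (\<lambda>\<eta>\<in>Hom CondSet T Z. Comp CondSet T Z Q q \<eta>) = r \<longleftrightarrow>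
        (\<forall>\<eta>\<in>Hom CondSet T Z. k (Comp CondSet T Z Q q \<eta>) = r \<eta>)" for k
      using r by (auto simp: compose_def fun_eq_iff PiE_def extensional_def)
    show "\<exists>!h. h \<in> Hom (set_cat UNIV) (Hom CondSet T Q) W \<and>
       Comp (set_cat UNIV) (Hom CondSet T Z) (Hom CondSet T Q) W h (\<lambda>\<eta>\<in>Hom CondSet T Z. Comp CondSet T Z Q q \<eta>) = r"
    proof (rule ex1I[of _ h])
      show "h \<in> Hom (set_cat UNIV) (Hom CondSet T Q) W \<and>
        Comp (set_cat UNIV) (Hom CondSet T Z) (Hom CondSet T Q) W h (\<lambda>\<eta>\<in>Hom CondSet T Z. Comp CondSet T Z Q q \<eta>) = r"
        using hW h comp by (simp add: set_cat_def)
      fix k assume "k \<in> Hom (set_cat UNIV) (Hom CondSet T Q) W \<and>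
        Comp (set_cat UNIV) (Hom CondSet T Z) (Hom CondSet T Q) W k (\<lambda>\<eta>\<in>Hom CondSet T Z. Comp CondSet T Z Q q \<eta>) = r"
      then have k: "k \<in> Hom CondSet T Q \<rightarrow>\<^sub>E W" "\<And>\<eta>. \<eta> \<in> Hom CondSet T Z \<Longrightarrow> k (Comp CondSet T Z Q q \<eta>) = r \<eta>"
        using comp by (auto simp: set_cat_def)
      show "k = h"
      proof (rule PiE_ext[OF k(1) hW])
        fix \<zeta> assume "\<zeta> \<in> Hom CondSet T Q"
        then obtain \<eta> where "\<eta> \<in> Hom CondSet T Z" "Comp CondSet T Z Q q \<eta> = \<zeta>" using surj by blast
        then show "k \<zeta> = h \<zeta>" using k(2) h by metis
      qed
    qed
  qed
qed

lemma yoneda: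
  fixes W :: "'u presheaf"
  assumes W: "W \<in> Obj CondSet" and S: "S \<in> ED" and w: "w \<in> FObj W S"
    and US: "underline S \<in> Obj CondSet"
  shows "mk_hom (underline S) (\<lambda>R \<phi>. FArr W S R \<phi> w) \<in> Hom CondSet (underline S) W"
proof (rule mk_hom[OF CondSet_functor[OF US]])
  fix R :: "'u topology" and \<phi> assume "R \<in> ED" "\<phi> \<in> FObj (underline S) R"
  then show "FArr W S R \<phi> w \<in> FObj W R"
    using arr_in[OF CondSet_functor[OF W] S] w by (simp add: underline_def)
next
  fix R Q :: "'u topology" and g \<phi> assume "R \<in> ED" "Q \<in> ED" "g \<in> cmaps Q R" "\<phi> \<in> FObj (underline S) R"
  then show "FArr W S Q (FArr (underline S) R Q g \<phi>) w = FArr W R Q g (FArr W S R \<phi> w)"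
    using arr_comp[OF CondSet_functor[OF W] S] w by (simp add: underline_def)
qed

text \<open>The universal element is the image of the identity of \<open>S\<close> under the
  isomorphism. Every \<open>x\<close> in T(R) is its restriction along the map
  \<open>R \<rightarrow> S\<close> that corresponds to \<open>x\<close>, which gives
  uniqueness.\<close>

lemma isomorphic_represented:
  fixes T :: "'u presheaf"
  assumes S: "S \<in> ED" and iso: "isomorphic_in CondSet T (underline S)"
  shows "\<exists>u. represented T S u"
proof -
  obtain f g where T: "T \<in> Obj CondSet" and US: "underline S \<in> Obj CondSet"
    and f: "f \<in> Hom CondSet T (underline S)" and g: "g \<in> Hom CondSet (underline S) T"
    and gf: "Comp CondSet T (underline S) T g f = Ident CondSet T"
    and fg: "Comp CondSet (underline S) T (underline S) f g = Ident CondSet (underline S)"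
    using iso unfolding isomorphic_in_def by blast
  note Tf = CondSet_functor[OF T] and Uf = CondSet_functor[OF US]
  define e where "e = (\<lambda>s\<in>topspace S. s)"
  have e: "e \<in> FObj (underline S) S" by (simp add: e_def underline_def cmaps_id)
  have u: "g S e \<in> FObj T S" using hom_in[OF g S e] .
  have fge: "f S (g S e) = e" using fun_cong[OF fun_cong[OF fg, of S], of e] S e by simp
  have gen: "FArr T S R (f R x) (g S e) = x \<and> f R x \<in> cmaps R S" if x: "R \<in> ED" "x \<in> FObj T R" for R x
  proof -
    have \<phi>: "f R x \<in> cmaps R S" using hom_in[OF f x] by (simp add: underline_def)
    have "FArr (underline S) S R (f R x) e = f R x"
      using \<phi> by (simp add: underline_def e_def cmaps_id cmaps_id_comp)
    then have "g R (f R x) = FArr T S R (f R x) (g S e)" using hom_nat[OF g S x(1) \<phi> e] by simp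
    moreover have "g R (f R x) = x" using fun_cong[OF fun_cong[OF gf, of R], of x] x by simp
    ultimately show ?thesis using \<phi> by simp
  qed
  have "\<exists>!\<eta>. \<eta> \<in> Hom CondSet T W \<and> \<eta> S (g S e) = w" if W: "W \<in> Obj CondSet" and w: "w \<in> FObj W S" for W w
  proof (rule ex1I)
    let ?y = "mk_hom (underline S) (\<lambda>R \<phi>. FArr W S R \<phi> w)"
    have y: "?y \<in> Hom CondSet (underline S) W" by (rule yoneda[OF W S w US])
    have "?y S e = w" using arr_id[OF CondSet_functor[OF W] S w] S e by (simp add: e_def)
    then show "Comp CondSet T (underline S) W ?y f \<in> Hom CondSet T W \<and>
        Comp CondSet T (underline S) W ?y f S (g S e) = w"
      using hom_comp[OF Tf f y] S u fge by simp
    fix \<eta> assume \<eta>: "\<eta> \<in> Hom CondSet T W \<and> \<eta> S (g S e) = w"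
    show "\<eta> = Comp CondSet T (underline S) W ?y f"
    proof (rule hom_ext[OF _ hom_comp[OF Tf f y]])
      fix R :: "'u topology" and x assume x: "R \<in> ED" "x \<in> FObj T R"
      have "\<eta> R (FArr T S R (f R x) (g S e)) = FArr W S R (f R x) (\<eta> S (g S e))"
        using hom_nat[of \<eta> T W, OF _ S x(1) _ u, of "f R x"] gen[OF x] \<eta> by blast
      moreover have "Comp CondSet T (underline S) W ?y f R x = FArr W S R (f R x) w"
        unfolding Comp_CondSet_apply[OF x] using x(1) hom_in[OF f x] by (rule mk_hom_apply)
      ultimately show "\<eta> R x = Comp CondSet T (underline S) W ?y f R x"
        using gen[OF x] \<eta> by simp
    qed (use \<eta> in blast)
  qed
  then show ?thesis unfolding represented_def using T S u by blast
qed

end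

section \<open>Extremally disconnected spaces and their coproducts\<close>

text \<open>With \<open>V\<close> the preimage of \<open>U\<close> under \<open>r\<close>, the
  closure of \<open>U\<close> is the preimage under \<open>i\<close> of the closure of
  \<open>V\<close>, and the latter is open in \<open>S\<close>.\<close>

lemma extremally_disconnected_retract:
  assumes S: "extremally_disconnected_space S" and i: "continuous_map S' S i" and r: "continuous_map S S' r"
    and ri: "\<And>x. x \<in> topspace S' \<Longrightarrow> r (i x) = x"
  shows "extremally_disconnected_space S'"
  unfolding extremally_disconnected_space_def
proof (intro allI impI)
  fix U assume U: "openin S' U"
  define V where "V = {y \<in> topspace S. r y \<in> U}"
  have V: "openin S V" using r U by (simp add: V_def continuous_map_def)
  have Usub: "U \<subseteq> topspace S'" using U by (rule openin_subset)
  have "S' closure_of U = {x \<in> topspace S'. i x \<in> S closure_of V}"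
  proof (intro subset_antisym subsetI)
    have "closedin S' {x \<in> topspace S'. i x \<in> S closure_of V}"
      using i by (simp add: continuous_map_closedin)
    moreover have "U \<subseteq> {x \<in> topspace S'. i x \<in> S closure_of V}"
    proof
      fix x assume x: "x \<in> U"
      then have "i x \<in> V" using Usub i ri by (auto simp: V_def continuous_map_def)
      then show "x \<in> {x \<in> topspace S'. i x \<in> S closure_of V}"
        using x Usub closure_of_subset[OF openin_subset[OF V]] by blast
    qed
    ultimately have "S' closure_of U \<subseteq> {x \<in> topspace S'. i x \<in> S closure_of V}"
      by (rule closure_of_minimal[rotated])
    then show "x \<in> S' closure_of U \<Longrightarrow> x \<in> {x \<in> topspace S'. i x \<in> S closure_of V}" for x by blast
  next
    fix x assume x: "x \<in> {x \<in> topspace S'. i x \<in> S closure_of V}"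
    have "r (i x) \<in> S' closure_of (r ` V)"
      using continuous_map_image_closure_subset[OF r, of V] x by blast
    moreover have "r ` V \<subseteq> U" by (auto simp: V_def)
    ultimately show "x \<in> S' closure_of U" using x ri closure_of_mono[of "r ` V" U S'] by auto
  qed
  moreover have "openin S (S closure_of V)" using S V by (simp add: extremally_disconnected_space_def)
  ultimately show "openin S' (S' closure_of U)" using i by (simp add: continuous_map_def)
qed

lemma extremally_disconnected_open_subspace:
  assumes "extremally_disconnected_space X" "openin X V"
  shows "extremally_disconnected_space (subtopology X V)"
  using assms unfolding extremally_disconnected_space_def
  by (auto simp: openin_open_subtopology closure_of_subtopology_open)

text \<open>Inside an open \<open>V\<close> the closure of \<open>U\<close> coincides with the
  closure of the trace of \<open>U\<close> on \<open>V\<close>, taken in \<open>V\<close>; so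
  openness of closures can be tested locally.\<close>

lemma extremally_disconnected_local:
  assumes loc: "\<And>x. x \<in> topspace X \<Longrightarrow>
    \<exists>V. openin X V \<and> x \<in> V \<and> extremally_disconnected_space (subtopology X V)"
  shows "extremally_disconnected_space X"
  unfolding extremally_disconnected_space_def
proof (intro allI impI)
  fix U assume U: "openin X U"
  show "openin X (X closure_of U)"
  proof (subst openin_subopen, intro ballI)
    fix x assume x: "x \<in> X closure_of U"
    then have "x \<in> topspace X" using closure_of_subset_topspace[of X U] by blast
    then obtain V where V: "openin X V" "x \<in> V" "extremally_disconnected_space (subtopology X V)"
      using loc by blast
    have "openin (subtopology X V) (U \<inter> V)" using U by (rule openin_subtopology_Int)
    then have "openin (subtopology X V) (subtopology X V closure_of (U \<inter> V))"
      using V(3) by (simp add: extremally_disconnected_space_def)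
    then have "openin X (V \<inter> X closure_of (U \<inter> V))"
      using V(1) by (simp add: closure_of_subtopology_open openin_open_subtopology)
    moreover have "V \<inter> X closure_of (U \<inter> V) = V \<inter> X closure_of U"
      using openin_Int_closure_of_eq[OF V(1), of U] by (simp add: Int_commute)
    ultimately show "\<exists>T. openin X T \<and> x \<in> T \<and> T \<subseteq> X closure_of U"
      using x V(2) by (intro exI[of _ "V \<inter> X closure_of U"]) auto
  qed
qed

text \<open>Openness of \<open>A\<close> preserves extremal disconnectedness, closedness preserves
  compactness.\<close>

lemma ED_clopen_subspace:
  assumes R: "R \<in> Obj (ExtrDisc :: ('u topology, 'u \<Rightarrow> 'u) cat)" and A: "openin R A" "closedin R A"
  shows "subtopology R A \<in> ED"
proof -
  have "small TYPE('u) (topspace R \<inter> A)"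
    using R unfolding ED_iff small_def by (meson card_of_mono1 inf_le1 ordLeq_ordLess_trans)
  then show ?thesis
    using R A unfolding ED_iff
    by (auto simp: Hausdorff_space_subtopology extremally_disconnected_open_subspace
        compact_space_subtopology closedin_compact_space Int_commute)
qed

lemma disj_sum_clopen:
  assumes "openin R A" "closedin R A"
  shows "disj_sum (subtopology R A) (subtopology R (topspace R - A)) R
    (\<lambda>s\<in>topspace R \<inter> A. s) (\<lambda>s\<in>topspace R \<inter> (topspace R - A). s)"
proof -
  let ?S = "sum_topology (\<lambda>b. if b then subtopology R (topspace R - A) else subtopology R A) UNIV"
  have B: "openin R (topspace R - A)" using assms(2) by (rule openin_diff[OF openin_topspace])
  \<comment> \<open>The tag \<open>x \<notin> A\<close> is \<open>False\<close> on \<open>A\<close>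
    because \<open>False\<close> marks the first summand.\<close>
  have "homeomorphic_maps ?S R snd (\<lambda>x. (x \<notin> A, x))"
    unfolding homeomorphic_maps_def
  proof (intro conjI)
    show "continuous_map ?S R snd"
      unfolding continuous_map_def openin_sum_topology
    proof (intro conjI allI impI ballI)
      fix U b assume U: "openin R U"
      have e: "{x. (b, x) \<in> {x \<in> topspace ?S. snd x \<in> U}} =
          (if b then (topspace R - A) \<inter> U else A \<inter> U)"
        using openin_subset[OF U] by (auto simp: split: if_splits)
      show "openin (if b then subtopology R (topspace R - A) else subtopology R A)
          {x. (b, x) \<in> {x \<in> topspace ?S. snd x \<in> U}}"
        unfolding e using openin_subtopology_Int2[OF U] by auto
    qed (auto split: if_splits)
    show "continuous_map R ?S (\<lambda>x. (x \<notin> A, x))"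
      unfolding continuous_map_def openin_sum_topology
    proof (intro conjI allI impI ballI)
      fix U assume U: "U \<subseteq> Sigma UNIV (topspace \<circ> (\<lambda>b. if b then subtopology R (topspace R - A) else subtopology R A)) \<and>
         (\<forall>b\<in>UNIV. openin (if b then subtopology R (topspace R - A) else subtopology R A) {x. (b, x) \<in> U})"
      have "openin R {x. (True, x) \<in> U}" "openin R {x. (False, x) \<in> U}"
        using U openin_trans_full[OF _ B] openin_trans_full[OF _ assms(1)] by (metis iso_tuple_UNIV_I)+
      moreover have "x \<in> topspace R \<and> (b \<longleftrightarrow> x \<notin> A)" if "(b, x) \<in> U" for b x
      proof -
        have "(b, x) \<in> Sigma UNIV (topspace \<circ> (\<lambda>b. if b then subtopology R (topspace R - A) else subtopology R A))"
          using U that by blast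
        then show ?thesis by (cases b) auto
      qed
      then have "{x \<in> topspace R. (x \<notin> A, x) \<in> U} = {x. (True, x) \<in> U} \<union> {x. (False, x) \<in> U}"
        by (intro set_eqI iffI) (auto, metis+)
      ultimately show "openin R {x \<in> topspace R. (x \<notin> A, x) \<in> U}" by (simp only: openin_Un)
    qed auto
  qed (auto split: if_splits)
  then have "homeomorphic_map ?S R snd" by (auto simp: homeomorphic_map_maps)
  then show ?thesis unfolding disj_sum_def by (intro exI[of _ snd]) (auto simp: topspace_subtopology)
qed

lemma disj_sum_cover:
  assumes "disj_sum S1 S2 S i1 i2" "x \<in> topspace S"
  shows "x \<in> i1 ` topspace S1 \<or> x \<in> i2 ` topspace S2"
proof -
  obtain h where h: "homeomorphic_map (sum_topology (\<lambda>b. if b then S2 else S1) UNIV) S h"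
    and i: "i1 = (\<lambda>s\<in>topspace S1. h (False, s))" "i2 = (\<lambda>s\<in>topspace S2. h (True, s))"
    using assms unfolding disj_sum_def by blast
  have "x \<in> h ` topspace (sum_topology (\<lambda>b. if b then S2 else S1) UNIV)"
    using homeomorphic_imp_surjective_map[OF h] assms(2) by simp
  then obtain b s where "x = h (b, s)" "s \<in> topspace (if b then S2 else S1)" by auto
  then show ?thesis unfolding i by (cases b) auto
qed

lemma disj_sum_glue:
  assumes d: "disj_sum S1 S2 S i1 i2" and x: "x1 \<in> cmaps S1 X" "x2 \<in> cmaps S2 X"
  shows "\<exists>f\<in>cmaps S X. compose (topspace S1) f i1 = x1 \<and> compose (topspace S2) f i2 = x2"
proof -
  let ?S = "sum_topology (\<lambda>b. if b then S2 else S1) UNIV"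
  obtain h where h: "homeomorphic_map ?S S h"
    and i: "i1 = (\<lambda>s\<in>topspace S1. h (False, s))" "i2 = (\<lambda>s\<in>topspace S2. h (True, s))"
    using assms unfolding disj_sum_def by blast
  obtain k where k: "homeomorphic_maps ?S S h k" using h by (auto simp: homeomorphic_map_maps)
  have kc: "continuous_map S ?S k" and kh: "\<And>p. p \<in> topspace ?S \<Longrightarrow> k (h p) = p"
    using k by (auto simp: homeomorphic_maps_def)
  define F where "F p = (if fst p then x2 (snd p) else x1 (snd p))" for p
  have "continuous_map ?S X F"
    unfolding continuous_map_def openin_sum_topology
  proof (intro conjI allI impI ballI)
    fix U b assume U: "openin X U"
    have e: "{s. (b, s) \<in> {p \<in> topspace ?S. F p \<in> U}} =
        (if b then {s \<in> topspace S2. x2 s \<in> U} else {s \<in> topspace S1. x1 s \<in> U})"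
      by (auto simp: F_def split: if_splits)
    show "openin (if b then S2 else S1) {s. (b, s) \<in> {p \<in> topspace ?S. F p \<in> U}}"
      unfolding e using x U by (auto simp: cmaps_def continuous_map_def)
  qed (use x in \<open>auto simp: F_def cmaps_def continuous_map_def split: if_splits\<close>)
  then have "continuous_map S X (F \<circ> k)" using kc by (rule continuous_map_compose[rotated])
  then have f: "restrict (F \<circ> k) (topspace S) \<in> cmaps S X" by (rule cmaps_restrict)
  have hS: "h p \<in> topspace S" if "p \<in> topspace ?S" for p
    using homeomorphic_imp_surjective_map[OF h] that by blast
  have "restrict (F \<circ> k) (topspace S) (i1 s) = x1 s" if "s \<in> topspace S1" for s
    using that hS[of "(False, s)"] kh[of "(False, s)"] by (simp add: i F_def)
  moreover have "restrict (F \<circ> k) (topspace S) (i2 s) = x2 s" if "s \<in> topspace S2" for s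
    using that hS[of "(True, s)"] kh[of "(True, s)"] by (simp add: i F_def)
  ultimately show ?thesis
    using x by (intro bexI[OF _ f] conjI extensionalityI[of _ "topspace S1"] extensionalityI[of _ "topspace S2"])
      (auto simp: compose_def cmaps_def)
qed

text \<open>Compactness is given up so that the class admits infinite coproducts. Each point still
  has a compact open neighbourhood of the right kind, which is enough for Hom(-, X) to be
  condensed.\<close>

definition locally_ED :: "'u topology \<Rightarrow> bool" where
  "locally_ED X \<longleftrightarrow> small TYPE('u) (topspace X) \<and> Hausdorff_space X \<and>
     (\<forall>x\<in>topspace X. \<exists>V. openin X V \<and> compactin X V \<and> x \<in> V \<and> extremally_disconnected_space (subtopology X V))"

context universe begin

lemma locally_ED_space: "S \<in> ED \<Longrightarrow> locally_ED S"
  unfolding locally_ED_def ED_iff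
  by (auto intro!: exI[of _ "topspace S"] simp: compact_space_def[symmetric] subtopology_topspace)

lemma locally_ED_cover:
  assumes X: "locally_ED X" and C: "compactin X C"
  shows "\<exists>K. openin X K \<and> compactin X K \<and> C \<subseteq> K"
proof -
  let ?\<U> = "{V. openin X V \<and> compactin X V}"
  have "C \<subseteq> \<Union>?\<U>" using X compactin_subset_topspace[OF C] unfolding locally_ED_def by blast
  then obtain \<F> where F: "finite \<F>" "\<F> \<subseteq> ?\<U>" "C \<subseteq> \<Union>\<F>"
    using C unfolding compactin_def by (metis (no_types, lifting) mem_Collect_eq)
  then have "openin X (\<Union>\<F>)" "compactin X (\<Union>\<F>)"
    by (auto intro: openin_Union compactin_Union)
  then show ?thesis using F(3) by blast
qed

lemma locally_ED_compact_open:
  assumes X: "locally_ED (X :: 'u topology)" and K: "openin X K" "compactin X K"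
  shows "subtopology X K \<in> ED"
proof -
  have "extremally_disconnected_space X"
    using X unfolding locally_ED_def by (intro extremally_disconnected_local) blast
  moreover have "small TYPE('u) (topspace X \<inter> K)"
    using X unfolding locally_ED_def by (auto intro: small_subset)
  ultimately show ?thesis
    using X K unfolding ED_iff locally_ED_def
    by (simp add: Hausdorff_space_subtopology extremally_disconnected_open_subspace compact_space_subtopology)
qed

text \<open>The image of \<open>R\<close> is compact and finitely many compact open sets cover it.
  This substitutes for compactness of \<open>X\<close>: Hom(-, X) is the union of the Hom(-,
  K).\<close>

lemma cmaps_compact_open:
  assumes X: "locally_ED X" and R: "R \<in> ED" and f: "f \<in> cmaps R X"
  shows "\<exists>K. openin X K \<and> compactin X K \<and> f \<in> cmaps R (subtopology X K)"
proof -
  have "compactin R (topspace R)" using R by (simp add: ED_iff compact_space_def)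
  then have "compactin X (f ` topspace R)" using f by (auto simp: cmaps_def intro: image_compactin)
  then obtain K where K: "openin X K" "compactin X K" "f ` topspace R \<subseteq> K" using locally_ED_cover[OF X] by blast
  then have "f \<in> cmaps R (subtopology X K)"
    using f by (auto simp: cmaps_def continuous_map_in_subtopology)
  then show ?thesis using K by blast
qed

lemma cmaps_small: "small TYPE('u) (topspace R) \<Longrightarrow> small TYPE('u) (topspace X) \<Longrightarrow> small TYPE('u) (cmaps R X)"
  by (rule small_subset[OF _ small_PiE]) (auto simp: cmaps_def continuous_map_def PiE_def)

lemma underline_functor:
  fixes X :: "'u topology"
  assumes "small TYPE('u) (topspace X)"
  shows "presheaf (underline X)"
  unfolding presheaf_iff
proof (intro conjI ballI)
  fix S :: "'u topology" assume "S \<in> ED"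
  then show "small TYPE('u) (FObj (underline X) S)"
    using assms by (simp add: underline_def ED_iff cmaps_small)
  show "FArr (underline X) S S (\<lambda>s\<in>topspace S. s) = (\<lambda>x\<in>FObj (underline X) S. x)"
    by (auto simp: underline_def cmaps_comp_id)
next
  fix S R :: "'u topology" and f assume "f \<in> cmaps R S"
  then show "FArr (underline X) S R f \<in> FObj (underline X) S \<rightarrow>\<^sub>E FObj (underline X) R"
    by (auto simp: underline_def cmaps_comp)
next
  fix S R Q :: "'u topology" and f g assume f: "f \<in> cmaps R S" and g: "g \<in> cmaps Q R"
  show "FArr (underline X) S Q (compose (topspace Q) f g) =
     compose (FObj (underline X) S) (FArr (underline X) R Q g) (FArr (underline X) S R f)"
    unfolding underline_def func.simps compose_def[of "cmaps S X"]
    by (rule restrict_ext) (simp add: cmaps_comp[OF f] cmaps_assoc[OF g])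
qed

lemma underline_sum: "sum_cond (underline X)"
  unfolding sum_cond_def
proof (intro ballI allI impI)
  fix S1 S2 S :: "'a topology" and i1 i2 assume d: "disj_sum S1 S2 S i1 i2"
  note ic = disj_sum_cmaps[OF d]
  have "bij_betw (\<lambda>f. (compose (topspace S1) f i1, compose (topspace S2) f i2)) (cmaps S X) (cmaps S1 X \<times> cmaps S2 X)"
    unfolding bij_betw_def
  proof (intro conjI inj_onI subset_antisym subsetI)
    fix f g assume fg: "f \<in> cmaps S X" "g \<in> cmaps S X"
      "(compose (topspace S1) f i1, compose (topspace S2) f i2) = (compose (topspace S1) g i1, compose (topspace S2) g i2)"
    then have e: "compose (topspace S1) f i1 = compose (topspace S1) g i1"
        "compose (topspace S2) f i2 = compose (topspace S2) g i2" by simp_all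
    have "f (i1 s) = g (i1 s)" if "s \<in> topspace S1" for s
      using fun_cong[OF e(1), of s] that by (simp add: compose_def)
    moreover have "f (i2 s) = g (i2 s)" if "s \<in> topspace S2" for s
      using fun_cong[OF e(2), of s] that by (simp add: compose_def)
    ultimately show "f = g"
      using disj_sum_cover[OF d] by (intro cmaps_ext[OF fg(1,2)]) blast
  next
    fix z assume "z \<in> (\<lambda>f. (compose (topspace S1) f i1, compose (topspace S2) f i2)) ` cmaps S X"
    then show "z \<in> cmaps S1 X \<times> cmaps S2 X" using ic by (auto intro: cmaps_comp)
  next
    fix z assume "z \<in> cmaps S1 X \<times> cmaps S2 X"
    then obtain x1 x2 where z: "z = (x1, x2)" "x1 \<in> cmaps S1 X" "x2 \<in> cmaps S2 X" by blast
    obtain f where f: "f \<in> cmaps S X" "compose (topspace S1) f i1 = x1" "compose (topspace S2) f i2 = x2"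
      using disj_sum_glue[OF d z(2,3)] by blast
    show "z \<in> (\<lambda>f. (compose (topspace S1) f i1, compose (topspace S2) f i2)) ` cmaps S X"
      using f z(1) by (intro image_eqI[of _ _ f]) simp_all
  qed
  moreover have "bij_betw (\<lambda>x. (FArr (underline X) S S1 i1 x, FArr (underline X) S S2 i2 x)) (cmaps S X) A \<longleftrightarrow>
      bij_betw (\<lambda>f. (compose (topspace S1) f i1, compose (topspace S2) f i2)) (cmaps S X) A" for A
    by (rule bij_betw_cong) (simp add: underline_def)
  ultimately show "bij_betw (\<lambda>x. (FArr (underline X) S S1 i1 x, FArr (underline X) S S2 i2 x)) (FObj (underline X) S)
      (FObj (underline X) S1 \<times> FObj (underline X) S2)"
    by (simp add: underline_def)
qed

text \<open>A map \<open>c \<rightarrow> X\<close> factors through a compact open \<open>K\<close>,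
  itself a \<open>\<kappa>\<close>-small space, and is therefore the restriction of the inclusion of
  \<open>K\<close>. The value that a cocone prescribes there does not depend on \<open>K\<close>, as
  two choices are compared in their union.\<close>

lemma underline_kan:
  fixes X :: "'u topology" and \<kappa> :: "'u rel"
  assumes X: "locally_ED X" and \<kappa>: "|topspace X| <o \<kappa>"
  shows "kan_from (small_ED \<kappa>) (underline X)"
proof -
  have "small TYPE('u) (topspace X)" using X by (simp add: locally_ED_def)
  note Uf = underline_functor[OF this]
  define incl where "incl K = (\<lambda>s\<in>topspace (subtopology X K). s)" for K
  have incl: "incl K \<in> cmaps (subtopology X K) X" for K
    unfolding incl_def by (rule cmaps_restrict) (simp add: continuous_map_from_subtopology)
  have small: "subtopology X K \<in> small_ED \<kappa>" if "openin X K" "compactin X K" for K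
  proof -
    have "|topspace X \<inter> K| <o \<kappa>" using \<kappa> by (meson card_of_mono1 inf_le1 ordLeq_ordLess_trans)
    then show ?thesis using locally_ED_compact_open[OF X that] by (simp add: small_ED_def)
  qed
  have incl_comp: "compose (topspace R) (incl K) f = f" if "f \<in> cmaps R (subtopology X K)" for R K f
    using cmaps_id_comp[OF that] by (simp add: incl_def)
  show ?thesis
  proof (rule kanI[OF Uf small_ED_subset])
    fix c :: "'u topology" and y assume c: "c \<in> ED" and y: "y \<in> FObj (underline X) c"
    then obtain K where K: "openin X K" "compactin X K" "y \<in> cmaps c (subtopology X K)"
      using cmaps_compact_open[OF X c] by (auto simp: underline_def)
    have "FArr (underline X) (subtopology X K) c y (incl K) = y"
      using incl_comp[OF K(3)] incl by (simp add: underline_def)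
    moreover have "incl K \<in> FObj (underline X) (subtopology X K)" using incl by (simp add: underline_def)
    ultimately show "\<exists>a\<in>small_ED \<kappa>. \<exists>f\<in>cmaps c a. \<exists>x\<in>FObj (underline X) a. FArr (underline X) a c f x = y"
      using small[OF K(1,2)] K(3) by blast
  next
    fix c and W :: "('u \<Rightarrow> 'u) set" and \<delta> :: "'u topology \<Rightarrow> ('u \<Rightarrow> 'u) \<Rightarrow> ('u \<Rightarrow> 'u) \<Rightarrow> 'u \<Rightarrow> 'u"
    assume c: "c \<in> ED"
      and compat: "\<And>a b g h x. a \<in> small_ED \<kappa> \<Longrightarrow> b \<in> small_ED \<kappa> \<Longrightarrow> g \<in> cmaps c b \<Longrightarrow> h \<in> cmaps b a \<Longrightarrow>
          x \<in> FObj (underline X) a \<Longrightarrow> \<delta> b g (FArr (underline X) a b h x) = \<delta> a (compose (topspace c) h g) x"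
    \<comment> \<open>Compatibility along \<open>x : a \<rightarrow> K\<close> rewrites every value
      of the cocone as a value at the inclusion of a compact open set.\<close>
    have key: "\<delta> a f x = \<delta> (subtopology X K) (compose (topspace c) x f) (incl K)"
      if "a \<in> small_ED \<kappa>" "f \<in> cmaps c a" "x \<in> cmaps a (subtopology X K)" "openin X K" "compactin X K" for a f x K
      using compat[OF small[OF that(4,5)] that(1-3), of "incl K"] incl_comp[OF that(3)] incl
      by (simp add: underline_def)
    define sel where "sel y = (SOME K. openin X K \<and> compactin X K \<and> y \<in> cmaps c (subtopology X K))" for y
    have sel: "openin X (sel y) \<and> compactin X (sel y) \<and> y \<in> cmaps c (subtopology X (sel y))" if "y \<in> cmaps c X" for y
      unfolding sel_def by (rule someI_ex[OF cmaps_compact_open[OF X c that]])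
    have mono: "g \<in> cmaps R (subtopology X K')" if "g \<in> cmaps R (subtopology X K)" "K \<subseteq> K'" for g R K K'
      using that by (auto simp: cmaps_def continuous_map_in_subtopology)
    have "\<delta> (subtopology X (sel y)) y (incl (sel y)) = \<delta> a f x"
      if a: "a \<in> small_ED \<kappa>" "f \<in> cmaps c a" "x \<in> cmaps a X" "y = compose (topspace c) x f" for a f x y
    proof -
      have aE: "a \<in> ED" using a small_ED_subset by blast
      obtain K where K: "openin X K" "compactin X K" "x \<in> cmaps a (subtopology X K)"
        using cmaps_compact_open[OF X aE a(3)] by blast
      have "y \<in> cmaps c X" using a cmaps_comp by blast
      note s = sel[OF this]
      \<comment> \<open>\<open>K\<close> contains the image of \<open>x\<close>, while
        \<open>sel y\<close> was chosen from \<open>y\<close> alone; the union contains both and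
        mediates between them.\<close>
      let ?K = "K \<union> sel y"
      have U: "openin X ?K" "compactin X ?K" using K s by (auto intro: compactin_Un)
      have x: "x \<in> cmaps a (subtopology X ?K)" by (rule mono[OF K(3)]) simp
      have i: "incl (sel y) \<in> cmaps (subtopology X (sel y)) (subtopology X ?K)"
        using incl[of "sel y"] by (auto simp: cmaps_def continuous_map_in_subtopology incl_def)
      have "\<delta> a f x = \<delta> (subtopology X ?K) y (incl ?K)" using key[OF a(1,2) x U] a(4) by simp
      also have "\<dots> = \<delta> (subtopology X (sel y)) y (incl (sel y))"
        using key[OF small _ i U, of y] s incl_comp[of y c "sel y"] by simp
      finally show ?thesis by simp
    qed
    then show "\<exists>h. \<forall>a\<in>small_ED \<kappa>. \<forall>f\<in>cmaps c a. \<forall>x\<in>FObj (underline X) a. h (FArr (underline X) a c f x) = \<delta> a f x"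
      by (intro exI[of _ "\<lambda>y. \<delta> (subtopology X (sel y)) y (incl (sel y))"]) (simp add: underline_def)
  qed
qed

lemma underline_CondSet:
  fixes X :: "'u topology"
  assumes X: "locally_ED X"
  shows "underline X \<in> Obj CondSet"
  unfolding Obj_CondSet condensed_iff mem_Collect_eq
proof (intro conjI underline_sum)
  have s: "small TYPE('u) (topspace X)" using X by (simp add: locally_ED_def)
  show "presheaf (underline X)" by (rule underline_functor[OF s])
  obtain \<kappa> :: "'u rel" where \<kappa>: "uncountable_strong_limit \<kappa>" "\<kappa> <o |UNIV :: 'u set|" "|topspace X| <o \<kappa>"
    using exists_strong_limit[OF s] by blast
  then show "small_presheaf (underline X)" unfolding small_presheaf_iff using underline_kan[OF X \<kappa>(3)] by blast
  have "cmaps (discrete_topology {}) X = {\<lambda>_. undefined}"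
    by (auto simp: cmaps_def continuous_map_def)
  then show "\<exists>x. FObj (underline X) (discrete_topology {}) = {x}"
    unfolding underline_def func.simps by blast
qed

definition ul_map :: "'u topology \<Rightarrow> ('u \<Rightarrow> 'u) \<Rightarrow> 'u topology \<Rightarrow> ('u \<Rightarrow> 'u) \<Rightarrow> ('u \<Rightarrow> 'u)" where
  "ul_map X p = mk_hom (underline X) (\<lambda>R f. compose (topspace R) p f)"

lemma ul_map_hom:
  fixes X Y :: "'u topology"
  assumes X: "locally_ED X" and p: "p \<in> cmaps X Y"
  shows "ul_map X p \<in> Hom CondSet (underline X) (underline Y)"
  unfolding ul_map_def
proof (rule mk_hom[OF CondSet_functor[OF underline_CondSet[OF X]]])
  fix S R :: "'u topology" and f x assume f: "f \<in> cmaps R S" and x: "x \<in> FObj (underline X) S"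
  then have x: "x \<in> cmaps S X" by (simp add: underline_def)
  show "compose (topspace R) p (FArr (underline X) S R f x) = FArr (underline Y) S R f (compose (topspace S) p x)"
    using cmaps_comp[OF x p] x cmaps_assoc[OF f, of p x] by (simp add: underline_def)
qed (use p in \<open>auto simp: underline_def intro: cmaps_comp\<close>)

end

section \<open>Gluing over finite clopen partitions, and topological coproducts\<close>

context universe begin

definition rincl :: "'u topology \<Rightarrow> 'u set \<Rightarrow> 'u \<Rightarrow> 'u" where
  "rincl R A = (\<lambda>x\<in>topspace (subtopology R A). x)"

lemma rincl_cmaps: "rincl R A \<in> cmaps (subtopology R A) R"
  unfolding rincl_def by (rule cmaps_restrict) (simp add: continuous_map_from_subtopology)

lemma disj_sum_rincl:
  "openin R A \<Longrightarrow> closedin R A \<Longrightarrow> disj_sum (subtopology R A) (subtopology R (topspace R - A)) R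
    (rincl R A) (rincl R (topspace R - A))"
  using disj_sum_clopen[of R A] by (simp add: rincl_def)

text \<open>The sum condition for two summands, iterated: one part is split off and the induction
  hypothesis is applied to its clopen complement, which is why \<open>R\<close> has to vary. For no
  parts at all \<open>R\<close> is the empty space and \<open>T\<close> has a single element
  there.\<close>

lemma glue:
  fixes T :: "'u presheaf"
  assumes T: "T \<in> Obj CondSet" and D: "finite D"
  shows "R \<in> ED \<Longrightarrow> (\<And>e. e \<in> D \<Longrightarrow> openin R (P e) \<and> closedin R (P e)) \<Longrightarrow> topspace R = (\<Union>e\<in>D. P e) \<Longrightarrow>
    disjoint_family_on P D \<Longrightarrow> (\<And>e. e \<in> D \<Longrightarrow> t e \<in> FObj T (subtopology R (P e))) \<Longrightarrow>
    (\<exists>z\<in>FObj T R. \<forall>e\<in>D. FArr T R (subtopology R (P e)) (rincl R (P e)) z = t e) \<and>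
    (\<forall>z\<in>FObj T R. \<forall>z'\<in>FObj T R.
      (\<forall>e\<in>D. FArr T R (subtopology R (P e)) (rincl R (P e)) z = t e) \<longrightarrow>
      (\<forall>e\<in>D. FArr T R (subtopology R (P e)) (rincl R (P e)) z' = t e) \<longrightarrow> z = z')"
  using D
proof (induction D arbitrary: R rule: finite_induct)
  case empty
  then have "R = discrete_topology {}" by (simp add: null_topspace_iff_trivial)
  then show ?case using CondSet_empty[OF T] by auto
next
  case (insert e D)
  note Tf = CondSet_functor[OF T]
  let ?A = "P e" and ?B = "topspace R - P e"
  let ?RB = "subtopology R ?B" and ?r = "\<lambda>z e. FArr T R (subtopology R (P e)) (rincl R (P e)) z"
  have A: "openin R ?A" "closedin R ?A" using insert.prems(2) by auto
  then have B: "openin R ?B" "closedin R ?B" by (auto intro: openin_diff closedin_diff)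
  have RA: "subtopology R ?A \<in> ED" and RB: "?RB \<in> ED"
    using ED_clopen_subspace[OF insert.prems(1)] A B by auto
  have PB: "P e' \<subseteq> ?B" if "e' \<in> D" for e'
    using that insert.prems(3,4) insert.hyps(2) by (auto simp: disjoint_family_on_def)
  have sub: "subtopology ?RB (P e') = subtopology R (P e')" if "e' \<in> D" for e'
    using PB[OF that] by (simp add: subtopology_subtopology inf.absorb2)
  have RP: "subtopology R (P e') \<in> ED" if "e' \<in> D" for e'
    using ED_clopen_subspace[OF insert.prems(1)] insert.prems(2) that by auto
  \<comment> \<open>Restricting to a part directly or by way of the complement of \<open>P e\<close>
    gives the same element.\<close>
  have comp: "FArr T ?RB (subtopology ?RB (P e')) (rincl ?RB (P e')) (FArr T R ?RB (rincl R ?B) z) = ?r z e'"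
    if "e' \<in> D" "z \<in> FObj T R" for e' z
  proof -
    have "rincl ?RB (P e') \<in> cmaps (subtopology R (P e')) ?RB"
      using rincl_cmaps[of ?RB "P e'"] sub[OF that(1)] by simp
    moreover have "compose (topspace (subtopology R (P e'))) (rincl R ?B) (rincl ?RB (P e')) = rincl R (P e')"
      using PB[OF that(1)] by (auto simp: compose_def fun_eq_iff rincl_def)
    ultimately show ?thesis
      using arr_comp[OF Tf insert.prems(1) RB RP[OF that(1)] rincl_cmaps _ that(2)] sub[OF that(1)] by simp
  qed
  have IH: "(\<exists>z\<in>FObj T ?RB. \<forall>e'\<in>D. FArr T ?RB (subtopology ?RB (P e')) (rincl ?RB (P e')) z = t e') \<and>
    (\<forall>z\<in>FObj T ?RB. \<forall>z'\<in>FObj T ?RB.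
      (\<forall>e'\<in>D. FArr T ?RB (subtopology ?RB (P e')) (rincl ?RB (P e')) z = t e') \<longrightarrow>
      (\<forall>e'\<in>D. FArr T ?RB (subtopology ?RB (P e')) (rincl ?RB (P e')) z' = t e') \<longrightarrow> z = z')"
  proof (rule insert.IH[OF RB])
    show "openin ?RB (P e') \<and> closedin ?RB (P e')" if "e' \<in> D" for e'
      using PB[OF that] insert.prems(2)[of e'] that
      by (simp add: openin_open_subtopology[OF B(1)] closedin_closed_subtopology[OF B(2)])
    show "topspace ?RB = (\<Union>e\<in>D. P e)"
      using insert.prems(3) PB by auto
    show "disjoint_family_on P D" using insert.prems(4) by (auto simp: disjoint_family_on_def)
    show "t e' \<in> FObj T (subtopology ?RB (P e'))" if "e' \<in> D" for e'
      unfolding sub[OF that] using insert.prems(5) that by simp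
  qed
  then obtain w where w: "w \<in> FObj T ?RB"
    "\<And>e'. e' \<in> D \<Longrightarrow> FArr T ?RB (subtopology ?RB (P e')) (rincl ?RB (P e')) w = t e'" by blast
  have w_unique: "FArr T R ?RB (rincl R ?B) z = w" if z: "z \<in> FObj T R" "\<forall>e'\<in>insert e D. ?r z e' = t e'" for z
    using conjunct2[OF IH, rule_format, OF arr_in[OF Tf insert.prems(1) RB rincl_cmaps z(1)] w(1) _ w(2)] comp z
    by simp
  have te: "t e \<in> FObj T (subtopology R ?A)" using insert.prems(5) by simp
  obtain z where z: "z \<in> FObj T R" "?r z e = t e" "FArr T R ?RB (rincl R ?B) z = w"
    using sum_cond_ex[OF CondSet_sum[OF T] RA RB insert.prems(1) disj_sum_rincl[OF A] te w(1)] by auto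
  have "\<forall>e'\<in>insert e D. ?r z e' = t e'"
    using z(2,3) comp[OF _ z(1)] w(2) by simp
  moreover have "y = y'" if "y \<in> FObj T R" "y' \<in> FObj T R" "\<forall>e'\<in>insert e D. ?r y e' = t e'"
    "\<forall>e'\<in>insert e D. ?r y' e' = t e'" for y y'
    using sum_cond_unique[OF CondSet_sum[OF T] RA RB insert.prems(1) disj_sum_rincl[OF A] that(1,2)]
      w_unique[OF that(1,3)] w_unique[OF that(2,4)] that(3,4) by simp
  ultimately show ?case using z(1) by blast
qed

end

text \<open>Spaces are topologies on \<open>'u\<close>, so the disjoint union has to be placed
  inside \<open>'u\<close>; \<open>\<phi>\<close> is the embedding.\<close>

locale coproduct = universe TU for TU :: "'u itself" +
  fixes E :: "'e set" and S :: "'e \<Rightarrow> 'u topology" and \<phi> :: "'e \<times> 'u \<Rightarrow> 'u"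
  assumes E_small: "small TYPE('u) E" and S_ED: "\<And>e. e \<in> E \<Longrightarrow> S e \<in> ED"
    and \<phi>_inj: "inj_on \<phi> (SIGMA e:E. topspace (S e))"
begin

definition "X = topology (\<lambda>U. U \<subseteq> \<phi> ` (SIGMA e:E. topspace (S e)) \<and>
   (\<forall>e\<in>E. openin (S e) {s \<in> topspace (S e). \<phi> (e, s) \<in> U}))"

lemma openin_X: "openin X U \<longleftrightarrow> U \<subseteq> \<phi> ` (SIGMA e:E. topspace (S e)) \<and>
   (\<forall>e\<in>E. openin (S e) {s \<in> topspace (S e). \<phi> (e, s) \<in> U})"
proof -
  have "istopology (\<lambda>U. U \<subseteq> \<phi> ` (SIGMA e:E. topspace (S e)) \<and>
   (\<forall>e\<in>E. openin (S e) {s \<in> topspace (S e). \<phi> (e, s) \<in> U}))"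
    unfolding istopology_def
  proof (intro conjI allI impI ballI)
    fix U V e
    assume "U \<subseteq> \<phi> ` (SIGMA e:E. topspace (S e)) \<and> (\<forall>e\<in>E. openin (S e) {s \<in> topspace (S e). \<phi> (e, s) \<in> U})"
      "V \<subseteq> \<phi> ` (SIGMA e:E. topspace (S e)) \<and> (\<forall>e\<in>E. openin (S e) {s \<in> topspace (S e). \<phi> (e, s) \<in> V})"
      and e: "e \<in> E"
    then have "openin (S e) ({s \<in> topspace (S e). \<phi> (e, s) \<in> U} \<inter> {s \<in> topspace (S e). \<phi> (e, s) \<in> V})"
      by blast
    also have "{s \<in> topspace (S e). \<phi> (e, s) \<in> U} \<inter> {s \<in> topspace (S e). \<phi> (e, s) \<in> V} =
      {s \<in> topspace (S e). \<phi> (e, s) \<in> U \<inter> V}" by blast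
    finally show "openin (S e) {s \<in> topspace (S e). \<phi> (e, s) \<in> U \<inter> V}" .
  next
    fix \<U> e
    assume "\<forall>U\<in>\<U>. U \<subseteq> \<phi> ` (SIGMA e:E. topspace (S e)) \<and> (\<forall>e\<in>E. openin (S e) {s \<in> topspace (S e). \<phi> (e, s) \<in> U})"
      and e: "e \<in> E"
    then have "openin (S e) (\<Union>U\<in>\<U>. {s \<in> topspace (S e). \<phi> (e, s) \<in> U})" by blast
    also have "(\<Union>U\<in>\<U>. {s \<in> topspace (S e). \<phi> (e, s) \<in> U}) = {s \<in> topspace (S e). \<phi> (e, s) \<in> \<Union>\<U>}" by blast
    finally show "openin (S e) {s \<in> topspace (S e). \<phi> (e, s) \<in> \<Union>\<U>}" .
  qed blast+
  then show ?thesis by (simp add: X_def topology_inverse')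
qed

lemma topspace_X: "topspace X = \<phi> ` (SIGMA e:E. topspace (S e))"
proof -
  have "{s \<in> topspace (S e). \<phi> (e, s) \<in> \<phi> ` (SIGMA e:E. topspace (S e))} = topspace (S e)" if "e \<in> E" for e
    using that by auto
  then have "openin X (\<phi> ` (SIGMA e:E. topspace (S e)))" by (simp add: openin_X)
  then show ?thesis using openin_subset[of X] openin_X[of "topspace X"] by blast
qed

definition "inc e = (\<lambda>s\<in>topspace (S e). \<phi> (e, s))"

definition "block e = inc e ` topspace (S e)"

lemma inc_cmaps: "e \<in> E \<Longrightarrow> inc e \<in> cmaps (S e) X"
proof -
  assume e: "e \<in> E"
  have "continuous_map (S e) X (\<lambda>s. \<phi> (e, s))"
    unfolding continuous_map_def topspace_X openin_X using e by blast
  then show ?thesis unfolding inc_def by (rule cmaps_restrict)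
qed

lemma \<phi>_eq: "e \<in> E \<Longrightarrow> e' \<in> E \<Longrightarrow> s \<in> topspace (S e) \<Longrightarrow> s' \<in> topspace (S e') \<Longrightarrow>
    \<phi> (e, s) = \<phi> (e', s') \<longleftrightarrow> e = e' \<and> s = s'"
  using inj_onD[OF \<phi>_inj, of "(e, s)" "(e', s')"] by auto

lemma inc_open:
  assumes e: "e \<in> E" and U: "openin (S e) U"
  shows "openin X (inc e ` U)"
  unfolding openin_X
proof (intro conjI ballI)
  have Us: "U \<subseteq> topspace (S e)" using U by (rule openin_subset)
  then show "inc e ` U \<subseteq> \<phi> ` (SIGMA e:E. topspace (S e))" using e by (auto simp: inc_def)
  fix e' assume e': "e' \<in> E"
  have "{s \<in> topspace (S e'). \<phi> (e', s) \<in> inc e ` U} = (if e' = e then U else {})"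
    using Us e e' by (auto simp: inc_def \<phi>_eq subset_iff image_iff)
  then show "openin (S e') {s \<in> topspace (S e'). \<phi> (e', s) \<in> inc e ` U}" using U by auto
qed

lemma block_open: "e \<in> E \<Longrightarrow> openin X (block e)"
  unfolding block_def by (rule inc_open) auto

lemma block_compact: "e \<in> E \<Longrightarrow> compactin X (block e)"
proof -
  assume e: "e \<in> E"
  have "compactin (S e) (topspace (S e))" using S_ED[OF e] by (simp add: ED_iff compact_space_def)
  moreover have "continuous_map (S e) X (inc e)" using inc_cmaps[OF e] by (simp add: cmaps_def)
  ultimately show ?thesis unfolding block_def by (rule image_compactin)
qed

lemma block_disjoint: "disjoint_family_on block E"
  by (auto simp: disjoint_family_on_def block_def inc_def \<phi>_eq)

lemma block_cover: "topspace X = (\<Union>e\<in>E. block e)"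
  by (auto simp: topspace_X block_def inc_def)

definition "ret e = (\<lambda>x\<in>block e. inv_into (topspace (S e)) (inc e) x)"

lemma inc_inj: "e \<in> E \<Longrightarrow> inj_on (inc e) (topspace (S e))"
  by (rule inj_onI) (auto simp: inc_def \<phi>_eq)

lemma ret_inc: "e \<in> E \<Longrightarrow> s \<in> topspace (S e) \<Longrightarrow> ret e (inc e s) = s"
  by (simp add: ret_def block_def inc_inj)

lemma inc_ret: "e \<in> E \<Longrightarrow> x \<in> block e \<Longrightarrow> inc e (ret e x) = x"
  by (auto simp: block_def ret_inc)

lemma ret_cmaps:
  assumes e: "e \<in> E"
  shows "ret e \<in> cmaps (subtopology X (block e)) (S e)"
proof -
  have ts: "topspace (subtopology X (block e)) = block e" using block_cover e by auto
  have "{x \<in> block e. ret e x \<in> U} = inc e ` U" if "U \<subseteq> topspace (S e)" for U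
    using that e ret_inc[OF e] by (auto simp: block_def)
  moreover have "openin (subtopology X (block e)) (inc e ` U)" if "openin (S e) U" for U
    unfolding openin_open_subtopology[OF block_open[OF e]]
    using inc_open[OF e that] openin_subset[OF that] by (auto simp: block_def)
  ultimately have "openin (subtopology X (block e)) {x \<in> block e. ret e x \<in> U}" if "openin (S e) U" for U
    using openin_subset[OF that] that by simp
  then have "continuous_map (subtopology X (block e)) (S e) (ret e)"
    using e unfolding continuous_map_def ts by (auto simp: block_def ret_inc)
  moreover have "ret e \<in> extensional (topspace (subtopology X (block e)))" unfolding ts ret_def by simp
  ultimately show ?thesis unfolding cmaps_def by blast
qed

text \<open>Each block is open, compact and a copy of its summand by way of \<open>inc\<close> and
  \<open>ret\<close>. Points of different blocks are separated by the blocks, points of one block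
  inside the summand.\<close>

lemma X_locally_ED: "locally_ED X"
  unfolding locally_ED_def
proof (intro conjI ballI)
  show "small TYPE('u) (topspace X)"
    unfolding topspace_X using S_ED by (intro small_image small_Sigma E_small) (auto simp: ED_iff)
  show "Hausdorff_space X"
    unfolding Hausdorff_space_def
  proof (intro allI impI)
    fix x y assume xy: "x \<in> topspace X \<and> y \<in> topspace X \<and> x \<noteq> y"
    then obtain e e' where e: "e \<in> E" "x \<in> block e" "e' \<in> E" "y \<in> block e'" using block_cover by auto
    show "\<exists>U V. openin X U \<and> openin X V \<and> x \<in> U \<and> y \<in> V \<and> disjnt U V"
    proof (cases "e = e'")
      case False
      then have "disjnt (block e) (block e')" using block_disjoint e by (simp add: disjoint_family_on_def disjnt_def)
      then show ?thesis using e block_open by blast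
    next
      case True
      obtain s s' where s: "s \<in> topspace (S e)" "x = inc e s" "s' \<in> topspace (S e)" "y = inc e s'"
        using e True by (auto simp: block_def)
      then have "s \<noteq> s'" using xy by blast
      then obtain U V where U: "openin (S e) U" "openin (S e) V" "s \<in> U" "s' \<in> V" "disjnt U V"
        using S_ED[OF e(1)] s unfolding ED_iff Hausdorff_space_def by blast
      have "disjnt (inc e ` U) (inc e ` V)"
        using U inj_on_image_Int[OF inc_inj[OF e(1)] openin_subset[OF U(1)] openin_subset[OF U(2)]]
        by (simp add: disjnt_def)
      then show ?thesis using inc_open[OF e(1)] U s by blast
    qed
  qed
  fix x assume "x \<in> topspace X"
  then obtain e where e: "e \<in> E" "x \<in> block e" using block_cover by auto
  have "extremally_disconnected_space (subtopology X (block e))"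
  proof (rule extremally_disconnected_retract)
    show "extremally_disconnected_space (S e)" using S_ED[OF e(1)] by (simp add: ED_iff)
    show "continuous_map (subtopology X (block e)) (S e) (ret e)" using ret_cmaps[OF e(1)] by (simp add: cmaps_def)
    show "continuous_map (S e) (subtopology X (block e)) (inc e)"
      using inc_cmaps[OF e(1)] by (auto simp: cmaps_def continuous_map_in_subtopology block_def)
    show "inc e (ret e x) = x" if "x \<in> topspace (subtopology X (block e))" for x
      using that inc_ret[OF e(1)] by simp
  qed
  then show "\<exists>V. openin X V \<and> compactin X V \<and> x \<in> V \<and> extremally_disconnected_space (subtopology X V)"
    using e block_open block_compact by blast
qed

lemma map_out:
  assumes g: "\<And>e. e \<in> E \<Longrightarrow> g e \<in> cmaps (S e) Y"
  shows "\<exists>p\<in>cmaps X Y. \<forall>e\<in>E. compose (topspace (S e)) p (inc e) = g e"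
proof -
  define p where "p x = (case inv_into (SIGMA e:E. topspace (S e)) \<phi> x of (e, s) \<Rightarrow> g e s)" for x
  have p: "p (\<phi> (e, s)) = g e s" if "e \<in> E" "s \<in> topspace (S e)" for e s
    using that by (simp add: p_def inv_into_f_f[OF \<phi>_inj])
  have "continuous_map X Y p"
    unfolding continuous_map_def
  proof (intro conjI allI impI)
    show "p \<in> topspace X \<rightarrow> topspace Y" using cmaps_in[OF g] p by (auto simp: topspace_X)
    fix U assume U: "openin Y U"
    show "openin X {x \<in> topspace X. p x \<in> U}"
      unfolding openin_X
    proof (intro conjI ballI)
      fix e assume e: "e \<in> E"
      have "{s \<in> topspace (S e). \<phi> (e, s) \<in> {x \<in> topspace X. p x \<in> U}} = {s \<in> topspace (S e). g e s \<in> U}"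
        using e p by (auto simp: topspace_X \<phi>_eq)
      then show "openin (S e) {s \<in> topspace (S e). \<phi> (e, s) \<in> {x \<in> topspace X. p x \<in> U}}"
        using g[OF e] U by (simp add: cmaps_def continuous_map_def)
    qed (auto simp: topspace_X)
  qed
  then have P: "restrict p (topspace X) \<in> cmaps X Y" by (rule cmaps_restrict)
  have "compose (topspace (S e)) (restrict p (topspace X)) (inc e) = g e" if e: "e \<in> E" for e
    by (rule cmaps_ext[OF cmaps_comp[OF inc_cmaps[OF e] P] g[OF e]])
      (use e p in \<open>auto simp: compose_def inc_def topspace_X\<close>)
  then show ?thesis using P by blast
qed

definition "piece R f e = {x \<in> topspace R. f x \<in> block e}"

text \<open>Over its piece, \<open>f\<close> is the inclusion of the summand after this map into
  \<open>S e\<close>.\<close>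

definition "lift R f e = (\<lambda>x\<in>topspace (subtopology R (piece R f e)). ret e (f x))"

lemma piece_clopen:
  assumes "f \<in> cmaps R X" "e \<in> E"
  shows "openin R (piece R f e)" "closedin R (piece R f e)"
proof -
  have "closedin X (block e)"
    using X_locally_ED by (intro compactin_imp_closedin block_compact assms) (simp add: locally_ED_def)
  moreover have "continuous_map R X f" using assms(1) by (simp add: cmaps_def)
  ultimately show "openin R (piece R f e)" "closedin R (piece R f e)"
    using block_open[OF assms(2)] unfolding piece_def
    by (simp_all add: openin_continuous_map_preimage closedin_continuous_map_preimage)
qed

lemma piece_ED: "R \<in> ED \<Longrightarrow> f \<in> cmaps R X \<Longrightarrow> e \<in> E \<Longrightarrow> subtopology R (piece R f e) \<in> ED"
  by (rule ED_clopen_subspace[OF _ piece_clopen])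

text \<open>Compactness leaves only finitely many nonempty pieces, which turns an arbitrary map into
  the coproduct into a case for \<open>glue\<close>.\<close>

lemma pieces:
  assumes R: "R \<in> ED" and f: "f \<in> cmaps R X"
  obtains D where "finite D" "D \<subseteq> E" "topspace R = (\<Union>e\<in>D. piece R f e)" "disjoint_family_on (piece R f) D"
    "\<And>e. e \<in> E \<Longrightarrow> e \<notin> D \<Longrightarrow> piece R f e = {}"
proof -
  let ?\<U> = "block ` E"
  have "compactin R (topspace R)" using R by (simp add: ED_iff compact_space_def)
  then have "compactin X (f ` topspace R)" using f by (auto simp: cmaps_def intro: image_compactin)
  moreover have "\<forall>U\<in>?\<U>. openin X U" using block_open by blast
  moreover have "f ` topspace R \<subseteq> \<Union>?\<U>" using f block_cover by (auto dest: cmaps_in)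
  ultimately obtain \<F> where "finite \<F>" "\<F> \<subseteq> ?\<U>" "f ` topspace R \<subseteq> \<Union>\<F>"
    unfolding compactin_def by meson
  then obtain D where D: "finite D" "D \<subseteq> E" "f ` topspace R \<subseteq> (\<Union>e\<in>D. block e)"
    by (metis finite_subset_image)
  show ?thesis
  proof
    show "finite D" "D \<subseteq> E" by fact+
    show "topspace R = (\<Union>e\<in>D. piece R f e)" using D(3) by (auto simp: piece_def)
    show "disjoint_family_on (piece R f) D"
      using block_disjoint D(2) by (auto simp: disjoint_family_on_def piece_def)
    fix e assume e: "e \<in> E" "e \<notin> D"
    show "piece R f e = {}"
    proof (rule ccontr)
      assume "piece R f e \<noteq> {}"
      then obtain x where x: "x \<in> topspace R" "f x \<in> block e" by (auto simp: piece_def)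
      then obtain e' where "e' \<in> D" "f x \<in> block e'" using D(3) by blast
      then have "e' \<in> E" "e \<noteq> e'" using e D(2) by auto
      then have "block e \<inter> block e' = {}"
        using block_disjoint e(1) by (simp add: disjoint_family_on_def)
      then show False using x(2) \<open>f x \<in> block e'\<close> by blast
    qed
  qed
qed

lemma lift_cmaps:
  assumes f: "f \<in> cmaps R X" and e: "e \<in> E"
  shows "lift R f e \<in> cmaps (subtopology R (piece R f e)) (S e)"
    and "compose (topspace (subtopology R (piece R f e))) (inc e) (lift R f e) =
      compose (topspace (subtopology R (piece R f e))) f (rincl R (piece R f e))"
proof -
  have "continuous_map (subtopology R (piece R f e)) (subtopology X (block e)) f"
    using f by (auto simp: cmaps_def continuous_map_in_subtopology continuous_map_from_subtopology piece_def)
  then have "continuous_map (subtopology R (piece R f e)) (S e) (ret e \<circ> f)"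
    using ret_cmaps[OF e] by (auto simp: cmaps_def intro: continuous_map_compose)
  from cmaps_restrict[OF this]
  show "lift R f e \<in> cmaps (subtopology R (piece R f e)) (S e)" by (simp add: lift_def o_def)
  show "compose (topspace (subtopology R (piece R f e))) (inc e) (lift R f e) =
      compose (topspace (subtopology R (piece R f e))) f (rincl R (piece R f e))"
    unfolding compose_def lift_def
    by (rule restrict_ext) (auto simp: inc_ret[OF e] piece_def rincl_def)
qed

end

section \<open>Projective condensed sets are retracts of coproducts\<close>

context coproduct begin

text \<open>Naturality is used twice, along the inclusion of the piece and along its lift to
  \<open>S e\<close>; both restrict to the same map from the piece to \<open>X\<close>. So the value
  of a morphism is governed by its values at the inclusions of the summands.\<close>

lemma piece_hom:
  assumes W: "W \<in> Obj CondSet" and \<alpha>: "\<alpha> \<in> Hom CondSet (underline X) W"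
    and R: "R \<in> ED" and f: "f \<in> cmaps R X" and e: "e \<in> E"
  shows "FArr W R (subtopology R (piece R f e)) (rincl R (piece R f e)) (\<alpha> R f) =
     FArr W (S e) (subtopology R (piece R f e)) (lift R f e) (\<alpha> (S e) (inc e))"
proof -
  let ?P = "subtopology R (piece R f e)"
  have P: "?P \<in> ED" by (rule piece_ED[OF R f e])
  have "FArr W R ?P (rincl R (piece R f e)) (\<alpha> R f) = \<alpha> ?P (FArr (underline X) R ?P (rincl R (piece R f e)) f)"
    using hom_nat[OF \<alpha> R P rincl_cmaps] f by (simp add: underline_def)
  also have "FArr (underline X) R ?P (rincl R (piece R f e)) f = FArr (underline X) (S e) ?P (lift R f e) (inc e)"
    using f inc_cmaps[OF e] lift_cmaps(2)[OF f e] by (simp add: underline_def)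
  also have "\<alpha> ?P \<dots> = FArr W (S e) ?P (lift R f e) (\<alpha> (S e) (inc e))"
    using hom_nat[OF \<alpha> S_ED[OF e] P lift_cmaps(1)[OF f e]] inc_cmaps[OF e] by (simp add: underline_def)
  finally show ?thesis .
qed

lemma pieces_unique:
  assumes T: "T \<in> Obj CondSet" and R: "R \<in> ED" and f: "f \<in> cmaps R X"
    and t: "t \<in> FObj T R" and t': "t' \<in> FObj T R"
    and eq: "\<And>e. e \<in> E \<Longrightarrow> FArr T R (subtopology R (piece R f e)) (rincl R (piece R f e)) t =
      FArr T R (subtopology R (piece R f e)) (rincl R (piece R f e)) t'"
  shows "t = t'"
proof -
  obtain D where D: "finite D" "D \<subseteq> E" "topspace R = (\<Union>e\<in>D. piece R f e)" "disjoint_family_on (piece R f) D"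
    using pieces[OF R f] by metis
  let ?r = "\<lambda>z e. FArr T R (subtopology R (piece R f e)) (rincl R (piece R f e)) z"
  have "\<forall>z\<in>FObj T R. \<forall>z'\<in>FObj T R. (\<forall>e\<in>D. ?r z e = ?r t' e) \<longrightarrow> (\<forall>e\<in>D. ?r z' e = ?r t' e) \<longrightarrow> z = z'"
  proof (rule conjunct2[OF glue[OF T D(1) R _ D(3,4)]])
    fix e assume "e \<in> D"
    then have e: "e \<in> E" using D by blast
    show "openin R (piece R f e) \<and> closedin R (piece R f e)" using piece_clopen[OF f e] by blast
    show "?r t' e \<in> FObj T (subtopology R (piece R f e))"
      by (rule arr_in[OF CondSet_functor[OF T] R piece_ED[OF R f e] rincl_cmaps t'])
  qed
  then show ?thesis using t t' eq D(2) by (simp add: subset_iff)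
qed

text \<open>Together with \<open>hom_ex\<close> this is the Yoneda lemma for a coproduct: maps from
  \<open>underline X\<close> to \<open>W\<close> correspond to families of elements of the W(S e).
  The pieces of \<open>f\<close> determine the value at \<open>f\<close>, and
  \<open>piece_hom\<close> computes it on each piece.\<close>

lemma hom_unique:
  assumes W: "W \<in> Obj CondSet" and \<alpha>: "\<alpha> \<in> Hom CondSet (underline X) W" and \<beta>: "\<beta> \<in> Hom CondSet (underline X) W"
    and eq: "\<And>e. e \<in> E \<Longrightarrow> \<alpha> (S e) (inc e) = \<beta> (S e) (inc e)"
  shows "\<alpha> = \<beta>"
proof (rule hom_ext[OF \<alpha> \<beta>])
  fix R :: "'u topology" and f assume R: "R \<in> ED" and f0: "f \<in> FObj (underline X) R"
  then have f: "f \<in> cmaps R X" by (simp add: underline_def)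
  show "\<alpha> R f = \<beta> R f"
    by (rule pieces_unique[OF W R f hom_in[OF \<alpha> R f0] hom_in[OF \<beta> R f0]])
      (simp add: piece_hom[OF W \<alpha> R f] piece_hom[OF W \<beta> R f] eq)
qed

text \<open>The value at \<open>f : R \<rightarrow> X\<close> of the map given by the elements \<open>x e\<close> is glued from the
  pullbacks of the \<open>x e\<close> to the parts of \<open>R\<close> lying over the summands.\<close>

definition "glued T x R f t \<longleftrightarrow> t \<in> FObj T R \<and> (\<forall>e\<in>E. \<forall>Q\<in>ED. \<forall>g\<in>cmaps Q R. \<forall>g'\<in>cmaps Q (S e).
   compose (topspace Q) f g = compose (topspace Q) (inc e) g' \<longrightarrow> FArr T R Q g t = FArr T (S e) Q g' (x e))"

lemma glued_unique:
  assumes T: "T \<in> Obj CondSet" and R: "R \<in> ED" and f: "f \<in> cmaps R X"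
    and t: "glued T x R f t" and t': "glued T x R f t'"
  shows "t = t'"
proof (rule pieces_unique[OF T R f])
  show "t \<in> FObj T R" "t' \<in> FObj T R" using t t' by (auto simp: glued_def)
  fix e assume e: "e \<in> E"
  have "FArr T R (subtopology R (piece R f e)) (rincl R (piece R f e)) z =
     FArr T (S e) (subtopology R (piece R f e)) (lift R f e) (x e)" if "glued T x R f z" for z
    using that e piece_ED[OF R f e] rincl_cmaps lift_cmaps[OF f e] unfolding glued_def by metis
  then show "FArr T R (subtopology R (piece R f e)) (rincl R (piece R f e)) t =
      FArr T R (subtopology R (piece R f e)) (rincl R (piece R f e)) t'"
    using t t' by simp
qed

text \<open>\<open>glue\<close> prescribes the element on finitely many pieces. A test map that lies
  over the summand \<open>e\<close> lands in the piece of \<open>e\<close>. If that piece is among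
  the finitely many, the test map factors through it; otherwise the piece is empty, so
  \<open>Q\<close> is empty and \<open>T\<close> has one element there.\<close>

lemma glued_ex:
  assumes T: "T \<in> Obj CondSet" and x: "\<And>e. e \<in> E \<Longrightarrow> x e \<in> FObj T (S e)" and R: "R \<in> ED" and f: "f \<in> cmaps R X"
  shows "\<exists>t. glued T x R f t"
proof -
  note Tf = CondSet_functor[OF T]
  obtain D where D: "finite D" "D \<subseteq> E" "topspace R = (\<Union>e\<in>D. piece R f e)" "disjoint_family_on (piece R f) D"
    "\<And>e. e \<in> E \<Longrightarrow> e \<notin> D \<Longrightarrow> piece R f e = {}"
    using pieces[OF R f] by metis
  let ?P = "\<lambda>e. subtopology R (piece R f e)"
  have "\<exists>z\<in>FObj T R. \<forall>e\<in>D. FArr T R (?P e) (rincl R (piece R f e)) z = FArr T (S e) (?P e) (lift R f e) (x e)"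
  proof (rule conjunct1[OF glue[OF T D(1) R _ D(3,4)]])
    fix e assume "e \<in> D"
    then have e: "e \<in> E" using D by blast
    show "openin R (piece R f e) \<and> closedin R (piece R f e)" using piece_clopen[OF f e] by blast
    show "FArr T (S e) (?P e) (lift R f e) (x e) \<in> FObj T (?P e)"
      using arr_in[OF Tf S_ED[OF e] piece_ED[OF R f e] lift_cmaps(1)[OF f e] x[OF e]] .
  qed
  then obtain z where z: "z \<in> FObj T R"
    "\<And>e. e \<in> D \<Longrightarrow> FArr T R (?P e) (rincl R (piece R f e)) z = FArr T (S e) (?P e) (lift R f e) (x e)" by blast
  have "glued T x R f z"
    unfolding glued_def
  proof (intro conjI z(1) ballI impI)
    fix e and Q :: "'u topology" and g g' assume e: "e \<in> E" and Q: "Q \<in> ED" and g: "g \<in> cmaps Q R" and g': "g' \<in> cmaps Q (S e)"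
      and fg: "compose (topspace Q) f g = compose (topspace Q) (inc e) g'"
    have fgq: "f (g y) = inc e (g' y)" if "y \<in> topspace Q" for y
      using fun_cong[OF fg, of y] that by (simp add: compose_def)
    have gp: "g y \<in> piece R f e" if y: "y \<in> topspace Q" for y
      using fgq[OF y] cmaps_in[OF g y] cmaps_in[OF g' y] by (auto simp: piece_def block_def)
    show "FArr T R Q g z = FArr T (S e) Q g' (x e)"
    proof (cases "e \<in> D")
      case True
      have gP: "g \<in> cmaps Q (?P e)" using g gp by (auto simp: cmaps_def continuous_map_in_subtopology)
      have "compose (topspace Q) (rincl R (piece R f e)) g = g"
        using cmaps_id_comp[OF gP] by (simp add: rincl_def)
      then have "FArr T R Q g z = FArr T (?P e) Q g (FArr T R (?P e) (rincl R (piece R f e)) z)"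
        using arr_comp[OF Tf R piece_ED[OF R f e] Q rincl_cmaps gP z(1)] by simp
      also have "\<dots> = FArr T (S e) Q (compose (topspace Q) (lift R f e) g) (x e)"
        unfolding z(2)[OF True]
        by (rule arr_comp[OF Tf S_ED[OF e] piece_ED[OF R f e] Q lift_cmaps(1)[OF f e] gP x[OF e]])
      also have "compose (topspace Q) (lift R f e) g = g'"
      proof (rule cmaps_ext[OF cmaps_comp[OF gP lift_cmaps(1)[OF f e]] g'])
        fix y assume y: "y \<in> topspace Q"
        then have "lift R f e (g y) = ret e (f (g y))"
          using gp cmaps_in[OF g] by (simp add: lift_def)
        then show "compose (topspace Q) (lift R f e) g y = g' y"
          using y fgq[OF y] ret_inc[OF e cmaps_in[OF g' y]] by (simp add: compose_def)
      qed
      finally show ?thesis .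
    next
      case False
      then have "topspace Q = {}" using gp D(5)[OF e False] by blast
      then have "Q = discrete_topology {}" by (simp add: null_topspace_iff_trivial)
      then obtain o' where "FObj T Q = {o'}" using CondSet_empty[OF T] by blast
      moreover have "FArr T R Q g z \<in> FObj T Q" "FArr T (S e) Q g' (x e) \<in> FObj T Q"
        using arr_in[OF Tf R Q g z(1)] arr_in[OF Tf S_ED[OF e] Q g' x[OF e]] .
      ultimately show ?thesis by simp
    qed
  qed
  then show ?thesis by blast
qed

text \<open>\<open>glued\<close> tests against all maps into \<open>R\<close>, so it is preserved by
  restriction along \<open>h\<close>; naturality then follows from
  \<open>glued_unique\<close>.\<close>

lemma hom_ex:
  assumes T: "T \<in> Obj CondSet" and x: "\<And>e. e \<in> E \<Longrightarrow> x e \<in> FObj T (S e)"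
  shows "\<exists>q\<in>Hom CondSet (underline X) T. \<forall>e\<in>E. q (S e) (inc e) = x e"
proof -
  note Tf = CondSet_functor[OF T]
  define q where "q R f = (SOME t. glued T x R f t)" for R f
  have q: "glued T x R f (q R f)" if "R \<in> ED" "f \<in> cmaps R X" for R f
    unfolding q_def by (rule someI_ex[OF glued_ex[OF T x that]])
  have "mk_hom (underline X) q \<in> Hom CondSet (underline X) T"
  proof (rule mk_hom[OF CondSet_functor[OF underline_CondSet[OF X_locally_ED]]])
    fix R :: "'u topology" and f assume "R \<in> ED" "f \<in> FObj (underline X) R"
    then show "q R f \<in> FObj T R" using q[of R f] by (simp add: underline_def glued_def)
  next
    fix R R' :: "'u topology" and h f
    assume R: "R \<in> ED" "R' \<in> ED" "h \<in> cmaps R' R" and "f \<in> FObj (underline X) R"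
    then have f: "f \<in> cmaps R X" by (simp add: underline_def)
    have fh: "compose (topspace R') f h \<in> cmaps R' X" by (rule cmaps_comp[OF R(3) f])
    note qf = q[OF R(1) f]
    then have qT: "q R f \<in> FObj T R" by (simp add: glued_def)
    have "glued T x R' (compose (topspace R') f h) (FArr T R R' h (q R f))"
      unfolding glued_def
    proof (intro conjI ballI impI)
      show "FArr T R R' h (q R f) \<in> FObj T R'" by (rule arr_in[OF Tf R qT])
      fix e and Q :: "'u topology" and g g' assume e: "e \<in> E" and Q: "Q \<in> ED" and g: "g \<in> cmaps Q R'" and g': "g' \<in> cmaps Q (S e)"
        and eq: "compose (topspace Q) (compose (topspace R') f h) g = compose (topspace Q) (inc e) g'"
      have hg: "compose (topspace Q) h g \<in> cmaps Q R" by (rule cmaps_comp[OF g R(3)])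
      have "compose (topspace Q) f (compose (topspace Q) h g) = compose (topspace Q) (inc e) g'"
        using cmaps_assoc[OF g, of f h] eq by simp
      then have "FArr T R Q (compose (topspace Q) h g) (q R f) = FArr T (S e) Q g' (x e)"
        using qf e Q hg g' unfolding glued_def by blast
      then show "FArr T R' Q g (FArr T R R' h (q R f)) = FArr T (S e) Q g' (x e)"
        using arr_comp[OF Tf R(1,2) Q R(3) g qT] by simp
    qed
    then have "q R' (compose (topspace R') f h) = FArr T R R' h (q R f)"
      using glued_unique[OF T R(2) fh q[OF R(2) fh]] by simp
    then show "q R' (FArr (underline X) R R' h f) = FArr T R R' h (q R f)"
      using f by (simp add: underline_def)
  qed
  moreover have "mk_hom (underline X) q (S e) (inc e) = x e" if e: "e \<in> E" for e
  proof -
    \<comment> \<open>Maps into two summands can agree after inclusion only if the summands are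
      equal or the source is empty, and over the empty space all elements of \<open>T\<close>
      coincide.\<close>
    have "glued T x (S e) (inc e) (x e)"
      unfolding glued_def
    proof (intro conjI ballI impI x e)
      fix e' and Q :: "'u topology" and g g' assume e': "e' \<in> E" and Q: "Q \<in> ED" and g: "g \<in> cmaps Q (S e)" and g': "g' \<in> cmaps Q (S e')"
        and eq: "compose (topspace Q) (inc e) g = compose (topspace Q) (inc e') g'"
      have eqy: "e = e' \<and> g y = g' y" if y: "y \<in> topspace Q" for y
      proof -
        have "inc e (g y) = inc e' (g' y)" using fun_cong[OF eq, of y] y by (simp add: compose_def)
        then show ?thesis using cmaps_in[OF g y] cmaps_in[OF g' y] \<phi>_eq[OF e e'] by (simp add: inc_def)
      qed
      show "FArr T (S e) Q g (x e) = FArr T (S e') Q g' (x e')"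
      proof (cases "topspace Q = {}")
        case True
        then have "Q = discrete_topology {}" by (simp add: null_topspace_iff_trivial)
        then obtain o' where "FObj T Q = {o'}" using CondSet_empty[OF T] by blast
        moreover have "FArr T (S e) Q g (x e) \<in> FObj T Q" "FArr T (S e') Q g' (x e') \<in> FObj T Q"
          using arr_in[OF Tf S_ED[OF e] Q g x[OF e]] arr_in[OF Tf S_ED[OF e'] Q g' x[OF e']] .
        ultimately show ?thesis by simp
      next
        case False
        then have "e = e'" using eqy by blast
        moreover have "g = g'" by (rule cmaps_ext[OF g g']) (use eqy in blast)
        ultimately show ?thesis by simp
      qed
    qed
    then have "q (S e) (inc e) = x e"
      using glued_unique[OF T S_ED[OF e] inc_cmaps[OF e] q[OF S_ED[OF e] inc_cmaps[OF e]]] by simp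
    then show ?thesis using S_ED[OF e] inc_cmaps[OF e] by (simp add: underline_def)
  qed
  ultimately show ?thesis by blast
qed

end

text \<open>If \<open>y\<close> were missed, the constant map \<open>b0\<close> and its modification
  at \<open>y\<close> would both factor the constant map on \<open>B\<close>, against
  uniqueness.\<close>

lemma set_coequalizer_surj:
  fixes b0 b1 :: 'm
  assumes c: "is_coequalizer (set_cat (UNIV :: 'm set set)) A B f g Q q" and b: "b0 \<noteq> b1" and y: "y \<in> Q"
    and fg: "f \<in> A \<rightarrow> B" "g \<in> A \<rightarrow> B"
  shows "\<exists>x\<in>B. q x = y"
proof (rule ccontr)
  assume no: "\<not> (\<exists>x\<in>B. q x = y)"
  have q: "q \<in> B \<rightarrow>\<^sub>E Q" and
    all: "\<forall>W :: 'm set. \<forall>r\<in>B \<rightarrow>\<^sub>E W. compose A r f = compose A r g \<longrightarrow> (\<exists>!h. h \<in> Q \<rightarrow>\<^sub>E W \<and> compose B h q = r)"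
    using c by (simp_all add: is_coequalizer_def set_cat_def)
  have "compose A (\<lambda>x\<in>B. b0) f = compose A (\<lambda>x\<in>B. b0) g"
    unfolding compose_def using fg by (intro restrict_ext) auto
  then have 1: "\<exists>!h. h \<in> Q \<rightarrow>\<^sub>E {b0, b1} \<and> compose B h q = (\<lambda>x\<in>B. b0)"
    using all[rule_format, of "\<lambda>x\<in>B. b0" "{b0, b1}"] by simp
  have "(\<lambda>z\<in>Q. b0) = (\<lambda>z\<in>Q. if z = y then b1 else b0)"
  proof (rule ex1_unique[OF 1])
    show "(\<lambda>z\<in>Q. b0) \<in> Q \<rightarrow>\<^sub>E {b0, b1} \<and> compose B (\<lambda>z\<in>Q. b0) q = (\<lambda>x\<in>B. b0)"
      unfolding compose_def using q by (auto intro!: restrict_ext)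
    show "(\<lambda>z\<in>Q. if z = y then b1 else b0) \<in> Q \<rightarrow>\<^sub>E {b0, b1} \<and>
        compose B (\<lambda>z\<in>Q. if z = y then b1 else b0) q = (\<lambda>x\<in>B. b0)"
      unfolding compose_def using q no by (auto intro!: restrict_ext)
  qed
  from fun_cong[OF this, of y] show False using b y by simp
qed

section \<open>A presentation of a condensed set by coproducts of small spaces\<close>

context universe begin

text \<open>The spaces of size below \<open>\<kappa>\<close> anywhere in \<open>'u\<close> can be
  too many to index a coproduct. Once the points are confined to \<open>K\<close>, a topology is a
  member of \<open>Pow (Pow K)\<close>.\<close>

lemma skeleton_small:
  assumes "small TYPE('u) (K :: 'u set)"
  shows "small TYPE('u) {S \<in> small_ED \<kappa>. topspace S \<subseteq> K}"
proof (rule small_inj)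
  show "inj_on (\<lambda>S. {U. openin S U}) {S \<in> small_ED \<kappa>. topspace S \<subseteq> K}"
    by (auto intro!: inj_onI simp: topology_eq)
  show "(\<lambda>S. {U. openin S U}) ` {S \<in> small_ED \<kappa>. topspace S \<subseteq> K} \<subseteq> Pow (Pow K)"
    using openin_subset by fastforce
  show "small TYPE('u) (Pow (Pow K))" using assms by (intro small_Pow)
qed

text \<open>\<open>a\<close> has fewer points than \<open>Field \<kappa>\<close>, so it injects
  there by \<open>j\<close>, and the coproduct construction with a single summand transports the
  topology along \<open>j\<close>. The only block is the whole space, which makes the copy
  compact.\<close>

lemma skeleton_iso:
  fixes \<kappa> :: "'u rel"
  assumes \<kappa>: "Card_order \<kappa>" and a: "a \<in> small_ED \<kappa>"
  shows "\<exists>S\<in>{S \<in> small_ED \<kappa>. topspace S \<subseteq> Field \<kappa>}. \<exists>u\<in>cmaps a S. \<exists>v\<in>cmaps S a.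
    compose (topspace a) v u = (\<lambda>s\<in>topspace a. s)"
proof -
  have aE: "a \<in> ED" and "|topspace a| <o \<kappa>" using a by (auto simp: small_ED_def)
  then have "|topspace a| \<le>o |Field \<kappa>|"
    using card_of_Field_ordIso[OF \<kappa>] by (meson ordIso_symmetric ordLess_imp_ordLeq ordLeq_ordIso_trans)
  then obtain j where j: "inj_on j (topspace a)" "j ` topspace a \<subseteq> Field \<kappa>"
    using card_of_ordLeq[of "topspace a" "Field \<kappa>"] by blast
  interpret C: coproduct "TYPE('u)" "{()}" "\<lambda>_. a" "\<lambda>p. j (snd p)"
    by unfold_locales (use aE j in \<open>auto simp: small_finite inj_on_def\<close>)
  have ts: "topspace C.X = C.block ()" using C.block_cover by simp
  then have sub: "subtopology C.X (C.block ()) = C.X" by (metis subtopology_topspace)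
  have XE: "C.X \<in> ED"
    using locally_ED_compact_open[OF C.X_locally_ED C.block_open[of "()"] C.block_compact[of "()"]] sub by simp
  have tj: "topspace C.X = j ` topspace a" by (force simp: C.topspace_X)
  have "|topspace C.X| <o \<kappa>"
    unfolding tj using \<open>|topspace a| <o \<kappa>\<close> card_of_image ordLeq_ordLess_trans by blast
  then have "C.X \<in> {S \<in> small_ED \<kappa>. topspace S \<subseteq> Field \<kappa>}" using XE tj j by (simp add: small_ED_def)
  moreover have "C.inc () \<in> cmaps a C.X" using C.inc_cmaps by simp
  moreover have "C.ret () \<in> cmaps C.X a" using C.ret_cmaps[of "()"] sub by simp
  moreover have "compose (topspace a) (C.ret ()) (C.inc ()) = (\<lambda>s\<in>topspace a. s)"
    unfolding compose_def by (rule restrict_ext) (simp add: C.ret_inc)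
  ultimately show ?thesis by blast
qed

text \<open>Once \<open>T\<close> is the coequalizer of a reflexive pair with quotient map
  \<open>q\<close>, projectivity makes composition with \<open>q\<close> surjective on morphisms out
  of \<open>T\<close>; a preimage of the identity is the section.\<close>

lemma projective_retract:
  fixes T :: "'u presheaf"
  assumes T: "T \<in> Obj CondSet" and proj: "projective_object CondSet T"
  shows "\<exists>X. locally_ED X \<and> (\<exists>q\<in>Hom CondSet (underline X) T. \<exists>s\<in>Hom CondSet T (underline X).
     Comp CondSet T (underline X) T q s = Ident CondSet T)"
proof -
  note Tf = CondSet_functor[OF T]
  obtain \<kappa> :: "'u rel" where \<kappa>: "uncountable_strong_limit \<kappa>" "\<kappa> <o |UNIV :: 'u set|"
    and kan: "kan_from (small_ED \<kappa>) T"
    using CondSet_small[OF T] unfolding small_presheaf_iff by blast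
  have Ck: "Card_order \<kappa>" using \<kappa> by (simp add: uncountable_strong_limit_def)
  define Sk where "Sk = {S \<in> small_ED \<kappa>. topspace S \<subseteq> Field \<kappa>}"
  have "small TYPE('u) (Field \<kappa>)"
    unfolding small_def using card_of_Field_ordIso[OF Ck] \<kappa>(2) ordIso_ordLess_trans by blast
  then have Sk_small: "small TYPE('u) Sk" unfolding Sk_def by (rule skeleton_small)
  have Sk_ED: "S \<in> ED" if "S \<in> Sk" for S using that small_ED_subset by (auto simp: Sk_def)
  have Sk_iso: "\<exists>S\<in>Sk. \<exists>u\<in>cmaps a S. \<exists>v\<in>cmaps S a. compose (topspace a) v u = (\<lambda>s\<in>topspace a. s)"
    if "a \<in> small_ED \<kappa>" for a
    unfolding Sk_def by (rule skeleton_iso[OF Ck that])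
  have top_small: "small TYPE('u) (topspace S)" if "S \<in> Sk" for S using Sk_ED[OF that] by (simp add: ED_iff)

  define E where "E = (SIGMA S:Sk. FObj T S)"
  have E_small: "small TYPE('u) E"
    unfolding E_def using Sk_small presheaf_small[OF Tf] Sk_ED by (intro small_Sigma) auto
  have "small TYPE('u) (SIGMA e:E. topspace (fst e))"
    using E_small top_small by (intro small_Sigma) (auto simp: E_def)
  then obtain \<phi> :: "_ \<Rightarrow> 'u" where \<phi>: "inj_on \<phi> (SIGMA e:E. topspace (fst e))" by (rule small_iso)
  interpret C: coproduct "TYPE('u)" E fst \<phi>
    by unfold_locales (use E_small \<phi> Sk_ED in \<open>auto simp: E_def\<close>)
  \<comment> \<open>The tautological map: the inclusion of the summand with index
    \<open>(S, t)\<close> goes to \<open>t\<close>.\<close>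
  obtain q where q: "q \<in> Hom CondSet (underline C.X) T" and q_inc: "\<And>e. e \<in> E \<Longrightarrow> q (fst e) (C.inc e) = snd e"
    using C.hom_ex[OF T, of snd] by (auto simp: E_def)
  let ?Z = "underline C.X"
  note Z = underline_CondSet[OF C.X_locally_ED]
  note Zf = CondSet_functor[OF Z]
  have q_in: "q R f \<in> FObj T R" if "R \<in> ED" "f \<in> cmaps R C.X" for R f
    using hom_in[OF q that(1)] that(2) by (simp add: underline_def)
  have r_nat: "r Q (compose (topspace Q) f g) = FArr W R Q g (r R f)"
    if "r \<in> Hom CondSet ?Z W" "R \<in> ED" "Q \<in> ED" "g \<in> cmaps Q R" "f \<in> cmaps R C.X" for r W R Q f g
    using hom_nat[OF that(1-4), of f] that(5) by (simp add: underline_def)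
  \<comment> \<open>An element over a small \<open>a\<close> is moved to the skeleton along
    \<open>v\<close>, where it is the label of a summand, and the inclusion of that summand is
    brought back along \<open>u\<close>.\<close>
  have cover: "\<exists>l\<in>cmaps a C.X. q a l = t" if a: "a \<in> small_ED \<kappa>" and t: "t \<in> FObj T a" for a t
  proof -
    have aE: "a \<in> ED" using a small_ED_subset by blast
    obtain S u v where S: "S \<in> Sk" "u \<in> cmaps a S" "v \<in> cmaps S a" "compose (topspace a) v u = (\<lambda>s\<in>topspace a. s)"
      using Sk_iso[OF a] by blast
    have e: "(S, FArr T a S v t) \<in> E" using S t arr_in[OF Tf aE Sk_ED[OF S(1)] S(3) t] by (simp add: E_def)
    have inc: "C.inc (S, FArr T a S v t) \<in> cmaps S C.X" using C.inc_cmaps[OF e] by simp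
    have "q a (compose (topspace a) (C.inc (S, FArr T a S v t)) u) = FArr T S a u (q S (C.inc (S, FArr T a S v t)))"
      by (rule r_nat[OF q Sk_ED[OF S(1)] aE S(2) inc])
    also have "\<dots> = FArr T S a u (FArr T a S v t)" using q_inc[OF e] by simp
    also have "\<dots> = t" using arr_comp[OF Tf aE Sk_ED[OF S(1)] aE S(3,2) t] S(4) arr_id[OF Tf aE t] by simp
    finally show ?thesis using cmaps_comp[OF S(2) inc] by blast
  qed

  \<comment> \<open>These triples are the elements of the kernel pair of \<open>q\<close> over
    spaces of the skeleton, so the second coproduct covers that kernel pair.\<close>
  define E' where "E' = {(S, f, g). S \<in> Sk \<and> f \<in> cmaps S C.X \<and> g \<in> cmaps S C.X \<and> q S f = q S g}"
  have "small TYPE('u) (topspace C.X)" using C.X_locally_ED by (simp add: locally_ED_def)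
  then have "small TYPE('u) (SIGMA S:Sk. cmaps S C.X \<times> cmaps S C.X)"
    using Sk_small top_small by (intro small_Sigma cmaps_small)
  then have E'_small: "small TYPE('u) E'" by (rule small_subset[rotated]) (auto simp: E'_def)
  have "small TYPE('u) (SIGMA e:E'. topspace (fst e))"
    using E'_small top_small by (intro small_Sigma) (auto simp: E'_def)
  then obtain \<phi>' :: "_ \<Rightarrow> 'u" where \<phi>': "inj_on \<phi>' (SIGMA e:E'. topspace (fst e))" by (rule small_iso)
  interpret C': coproduct "TYPE('u)" E' fst \<phi>'
    by unfold_locales (use E'_small \<phi>' Sk_ED in \<open>auto simp: E'_def\<close>)
  let ?Y = "underline C'.X"
  note Y = underline_CondSet[OF C'.X_locally_ED]
  note Yf = CondSet_functor[OF Y]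
  obtain p0 where p0: "p0 \<in> cmaps C'.X C.X" "\<And>e. e \<in> E' \<Longrightarrow> compose (topspace (fst e)) p0 (C'.inc e) = fst (snd e)"
    using C'.map_out[of "\<lambda>e. fst (snd e)" C.X] by (auto simp: E'_def)
  obtain p1 where p1: "p1 \<in> cmaps C'.X C.X" "\<And>e. e \<in> E' \<Longrightarrow> compose (topspace (fst e)) p1 (C'.inc e) = snd (snd e)"
    using C'.map_out[of "\<lambda>e. snd (snd e)" C.X] by (auto simp: E'_def)
  \<comment> \<open>Diagonal pairs belong to the kernel pair; they supply the common section
    \<open>\<sigma>\<close>.\<close>
  have diag: "(fst e, C.inc e, C.inc e) \<in> E'" if "e \<in> E" for e
    using that C.inc_cmaps[OF that] by (auto simp: E'_def E_def)
  obtain \<sigma> where \<sigma>: "\<sigma> \<in> cmaps C.X C'.X"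
    "\<And>e. e \<in> E \<Longrightarrow> compose (topspace (fst e)) \<sigma> (C.inc e) = C'.inc (fst e, C.inc e, C.inc e)"
    using C.map_out[of "\<lambda>e. C'.inc (fst e, C.inc e, C.inc e)" C'.X] C'.inc_cmaps[OF diag] by auto
  let ?f = "ul_map C'.X p0" and ?g = "ul_map C'.X p1" and ?s = "ul_map C.X \<sigma>"
  have f: "?f \<in> Hom CondSet ?Y ?Z" by (rule ul_map_hom[OF C'.X_locally_ED p0(1)])
  have g: "?g \<in> Hom CondSet ?Y ?Z" by (rule ul_map_hom[OF C'.X_locally_ED p1(1)])
  have s: "?s \<in> Hom CondSet ?Z ?Y" by (rule ul_map_hom[OF C.X_locally_ED \<sigma>(1)])
  have ul: "ul_map A p R x = compose (topspace R) p x" if "R \<in> ED" "x \<in> cmaps R A" for A p R x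
    using that by (simp add: ul_map_def underline_def)
  have psec: "Comp CondSet ?Z ?Y ?Z (ul_map C'.X p) ?s = Ident CondSet ?Z"
    if p: "p \<in> cmaps C'.X C.X" and pe: "\<And>e. e \<in> E \<Longrightarrow> compose (topspace (fst e)) p (C'.inc (fst e, C.inc e, C.inc e)) = C.inc e" for p
  proof (rule C.hom_unique[OF Z hom_comp[OF Zf s ul_map_hom[OF C'.X_locally_ED p]] hom_ident[OF Zf]])
    fix e assume e: "e \<in> E"
    have SE: "fst e \<in> ED" using C.S_ED[OF e] .
    have inc: "C.inc e \<in> FObj ?Z (fst e)" using C.inc_cmaps[OF e] by (simp add: underline_def)
    have "?s (fst e) (C.inc e) = C'.inc (fst e, C.inc e, C.inc e)"
      using ul[OF SE C.inc_cmaps[OF e]] \<sigma>(2)[OF e] by simp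
    moreover have "C'.inc (fst e, C.inc e, C.inc e) \<in> cmaps (fst e) C'.X" using C'.inc_cmaps[OF diag[OF e]] by simp
    ultimately show "Comp CondSet ?Z ?Y ?Z (ul_map C'.X p) ?s (fst e) (C.inc e) =
        Ident CondSet ?Z (fst e) (C.inc e)"
      using ul[OF SE, of "C'.inc (fst e, C.inc e, C.inc e)" C'.X p] pe[OF e] SE inc by simp
  qed
  have fs: "Comp CondSet ?Z ?Y ?Z ?f ?s = Ident CondSet ?Z"
    by (rule psec[OF p0(1)]) (use p0(2)[OF diag] in simp)
  have gs: "Comp CondSet ?Z ?Y ?Z ?g ?s = Ident CondSet ?Z"
    by (rule psec[OF p1(1)]) (use p1(2)[OF diag] in simp)
  have qfg: "Comp CondSet ?Y ?Z T q ?f = Comp CondSet ?Y ?Z T q ?g"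
  proof (rule C'.hom_unique[OF T hom_comp[OF Yf f q] hom_comp[OF Yf g q]])
    fix e assume e: "e \<in> E'"
    have SE: "fst e \<in> ED" using C'.S_ED[OF e] .
    have inc: "C'.inc e \<in> FObj ?Y (fst e)" using C'.inc_cmaps[OF e] by (simp add: underline_def)
    have "q (fst e) (fst (snd e)) = q (fst e) (snd (snd e))" using e by (auto simp: E'_def)
    then show "Comp CondSet ?Y ?Z T q ?f (fst e) (C'.inc e) =
        Comp CondSet ?Y ?Z T q ?g (fst e) (C'.inc e)"
      using ul[OF SE C'.inc_cmaps[OF e]] p0(2)[OF e] p1(2)[OF e] SE inc by simp
  qed
  have q_surj: "\<exists>z\<in>cmaps c C.X. q c z = y" if c: "c \<in> ED" and y: "y \<in> FObj T c" for c y
  proof -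
    obtain a h x where a: "a \<in> small_ED \<kappa>" "h \<in> cmaps c a" "x \<in> FObj T a" "FArr T a c h x = y"
      using kan_surj[OF Tf small_ED_subset kan c y] by blast
    have aE: "a \<in> ED" using a small_ED_subset by blast
    obtain l where l: "l \<in> cmaps a C.X" "q a l = x" using cover[OF a(1,3)] by blast
    have "q c (compose (topspace c) l h) = y" using r_nat[OF q aE c a(2) l(1)] l(2) a(4) by simp
    then show ?thesis using cmaps_comp[OF a(2) l(1)] by blast
  qed
  have coeq: "is_coequalizer CondSet ?Y ?Z ?f ?g T q"
    unfolding is_coequalizer_def
  proof (intro conjI ballI impI T q qfg)
    fix W r
    assume W: "W \<in> Obj CondSet" and r: "r \<in> Hom CondSet ?Z W"
      and rfg: "Comp CondSet ?Y ?Z W r ?f = Comp CondSet ?Y ?Z W r ?g"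
    note Wf = CondSet_functor[OF W]
    \<comment> \<open>Two lifts of one element, moved to the skeleton along \<open>v\<close>, form
      an index in \<open>E'\<close>, where \<open>r\<close> identifies them by hypothesis;
      restriction along \<open>u\<close> brings the equality back to \<open>a\<close>.\<close>
    have wd: "r a l = r a l'"
      if a: "a \<in> small_ED \<kappa>" and l: "l \<in> cmaps a C.X" "l' \<in> cmaps a C.X" "q a l = q a l'" for a l l'
    proof -
      have aE: "a \<in> ED" using a small_ED_subset by blast
      obtain S u v where S: "S \<in> Sk" "u \<in> cmaps a S" "v \<in> cmaps S a" "compose (topspace a) v u = (\<lambda>s\<in>topspace a. s)"
        using Sk_iso[OF a] by blast
      note SE = Sk_ED[OF S(1)]
      let ?l = "compose (topspace S) l v" and ?l' = "compose (topspace S) l' v"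
      have lv: "?l \<in> cmaps S C.X" "?l' \<in> cmaps S C.X" using cmaps_comp[OF S(3)] l by auto
      have e: "(S, ?l, ?l') \<in> E'"
        using S(1) lv r_nat[OF q aE SE S(3) l(1)] r_nat[OF q aE SE S(3) l(2)] l(3) by (simp add: E'_def)
      have inc: "C'.inc (S, ?l, ?l') \<in> cmaps S C'.X" using C'.inc_cmaps[OF e] by simp
      then have inc': "C'.inc (S, ?l, ?l') \<in> FObj ?Y S" by (simp add: underline_def)
      have "r S ?l = r S ?l'"
        using fun_cong[OF fun_cong[OF rfg, of S], of "C'.inc (S, ?l, ?l')"]
          ul[OF SE inc] p0(2)[OF e] p1(2)[OF e] SE inc' by simp
      then have "FArr W S a u (r S ?l) = FArr W S a u (r S ?l')" by simp
      then have "r a (compose (topspace a) ?l u) = r a (compose (topspace a) ?l' u)"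
        using r_nat[OF r SE aE S(2) lv(1)] r_nat[OF r SE aE S(2) lv(2)] by simp
      moreover have "compose (topspace a) (compose (topspace S) k v) u = k" if "k \<in> cmaps a C.X" for k
        using cmaps_assoc[OF S(2), of k v] S(4) cmaps_comp_id[OF that] by simp
      ultimately show ?thesis using l by simp
    qed
    define sel where "sel a x = (SOME l. l \<in> cmaps a C.X \<and> q a l = x)" for a x
    have sel: "sel a x \<in> cmaps a C.X" "q a (sel a x) = x" if "a \<in> small_ED \<kappa>" "x \<in> FObj T a" for a x
    proof -
      have "\<exists>l. l \<in> cmaps a C.X \<and> q a l = x" using cover[OF that] by blast
      from someI_ex[OF this] show "sel a x \<in> cmaps a C.X" "q a (sel a x) = x" by (simp_all add: sel_def)
    qed
    have r_in: "r a l \<in> FObj W a" if "a \<in> ED" "l \<in> cmaps a C.X" for a l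
      using hom_in[OF r that(1)] that(2) by (simp add: underline_def)
    \<comment> \<open>By \<open>wd\<close> the value of \<open>r\<close> at a lift depends only on
      the element of \<open>T\<close>, so these values form a cocone over the small spaces; the Kan
      property of \<open>T\<close> extends it to all \<open>c\<close>.\<close>
    have "\<exists>H. (\<forall>y\<in>FObj T c. H y \<in> FObj W c) \<and> (\<forall>a\<in>small_ED \<kappa>. \<forall>h\<in>cmaps c a. \<forall>x\<in>FObj T a.
        H (FArr T a c h x) = FArr W a c h (r a (sel a x)))" if c: "c \<in> ED" for c
    proof (rule kan_ex[OF Tf small_ED_subset kan c presheaf_small[OF Wf c]])
      fix a :: "'u topology" and h x assume a: "a \<in> small_ED \<kappa>" "h \<in> cmaps c a" "x \<in> FObj T a"
      then have "a \<in> ED" using small_ED_subset by blast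
      then show "FArr W a c h (r a (sel a x)) \<in> FObj W c"
        using arr_in[OF Wf _ c a(2)] r_in sel[OF a(1,3)] by blast
    next
      fix a b :: "'u topology" and g h x assume a: "a \<in> small_ED \<kappa>" "b \<in> small_ED \<kappa>" "g \<in> cmaps c b" "h \<in> cmaps b a" "x \<in> FObj T a"
      have ab: "a \<in> ED" "b \<in> ED" using a small_ED_subset by auto
      note sx = sel[OF a(1,5)]
      have hx: "FArr T a b h x \<in> FObj T b" by (rule arr_in[OF Tf ab a(4,5)])
      have lh: "compose (topspace b) (sel a x) h \<in> cmaps b C.X" by (rule cmaps_comp[OF a(4) sx(1)])
      have "r b (sel b (FArr T a b h x)) = r b (compose (topspace b) (sel a x) h)"
        using wd[OF a(2) sel(1)[OF a(2) hx] lh] sel(2)[OF a(2) hx] r_nat[OF q ab a(4) sx(1)] sx(2) by simp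
      also have "\<dots> = FArr W a b h (r a (sel a x))" by (rule r_nat[OF r ab a(4) sx(1)])
      finally show "FArr W b c g (r b (sel b (FArr T a b h x))) = FArr W a c (compose (topspace c) h g) (r a (sel a x))"
        using arr_comp[OF Wf ab c a(4,3) r_in[OF ab(1) sx(1)]] by simp
    qed
    then have "\<forall>c\<in>ED. \<exists>H. (\<forall>y\<in>FObj T c. H y \<in> FObj W c) \<and> (\<forall>a\<in>small_ED \<kappa>. \<forall>h\<in>cmaps c a. \<forall>x\<in>FObj T a.
        H (FArr T a c h x) = FArr W a c h (r a (sel a x)))" by blast
    from bchoice[OF this] obtain H where H: "\<And>c y. c \<in> ED \<Longrightarrow> y \<in> FObj T c \<Longrightarrow> H c y \<in> FObj W c"
      "\<And>c a h x. c \<in> ED \<Longrightarrow> a \<in> small_ED \<kappa> \<Longrightarrow> h \<in> cmaps c a \<Longrightarrow> x \<in> FObj T a \<Longrightarrow>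
        H c (FArr T a c h x) = FArr W a c h (r a (sel a x))"
      by blast
    have h: "mk_hom T H \<in> Hom CondSet T W"
    proof (rule mk_hom[OF Tf H(1)])
      fix c c' :: "'u topology" and k y assume c: "c \<in> ED" "c' \<in> ED" "k \<in> cmaps c' c" and y: "y \<in> FObj T c"
      obtain a h x where a: "a \<in> small_ED \<kappa>" "h \<in> cmaps c a" "x \<in> FObj T a" "FArr T a c h x = y"
        using kan_surj[OF Tf small_ED_subset kan c(1) y] by blast
      have aE: "a \<in> ED" using a small_ED_subset by blast
      have "FArr T c c' k y = FArr T a c' (compose (topspace c') h k) x"
        using arr_comp[OF Tf aE c(1,2) a(2) c(3) a(3)] a(4) by simp
      then have "H c' (FArr T c c' k y) = FArr W a c' (compose (topspace c') h k) (r a (sel a x))"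
        using H(2)[OF c(2) a(1) cmaps_comp[OF c(3) a(2)] a(3)] by simp
      also have "\<dots> = FArr W c c' k (H c y)"
        using arr_comp[OF Wf aE c(1,2) a(2) c(3) r_in[OF aE sel(1)[OF a(1,3)]]] H(2)[OF c(1) a(1-3)] a(4) by simp
      finally show "H c' (FArr T c c' k y) = FArr W c c' k (H c y)" .
    qed
    show "\<exists>!h. h \<in> Hom CondSet T W \<and> Comp CondSet ?Z T W h q = r"
    proof (rule ex1I)
      have "Comp CondSet ?Z T W (mk_hom T H) q = r"
      proof (rule C.hom_unique[OF W hom_comp[OF Zf q h] r])
        fix e assume e: "e \<in> E"
        have SE: "fst e \<in> ED" using C.S_ED[OF e] .
        have Sk: "fst e \<in> small_ED \<kappa>" and x: "snd e \<in> FObj T (fst e)" using e by (auto simp: E_def Sk_def)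
        have inc: "C.inc e \<in> FObj ?Z (fst e)" using C.inc_cmaps[OF e] by (simp add: underline_def)
        have "H (fst e) (snd e) = H (fst e) (FArr T (fst e) (fst e) (\<lambda>s\<in>topspace (fst e). s) (snd e))"
          using arr_id[OF Tf SE x] by simp
        also have "\<dots> = FArr W (fst e) (fst e) (\<lambda>s\<in>topspace (fst e). s) (r (fst e) (sel (fst e) (snd e)))"
          by (rule H(2)[OF SE Sk cmaps_id x])
        also have "\<dots> = r (fst e) (sel (fst e) (snd e))"
          by (rule arr_id[OF Wf SE r_in[OF SE sel(1)[OF Sk x]]])
        also have "\<dots> = r (fst e) (C.inc e)"
          using wd[OF Sk sel(1)[OF Sk x] C.inc_cmaps[OF e]] sel(2)[OF Sk x] q_inc[OF e] by simp
        finally show "Comp CondSet ?Z T W (mk_hom T H) q (fst e) (C.inc e) = r (fst e) (C.inc e)"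
          using SE inc q_inc[OF e] x by simp
      qed
      then show "mk_hom T H \<in> Hom CondSet T W \<and> Comp CondSet ?Z T W (mk_hom T H) q = r" using h by blast
      fix h' assume h': "h' \<in> Hom CondSet T W \<and> Comp CondSet ?Z T W h' q = r"
      show "h' = mk_hom T H"
      proof (rule hom_ext[OF _ h])
        fix c :: "'u topology" and y assume c: "c \<in> ED" and y: "y \<in> FObj T c"
        obtain z where z: "z \<in> cmaps c C.X" "q c z = y" using q_surj[OF c y] by blast
        then have zU: "z \<in> FObj ?Z c" by (simp add: underline_def)
        have "Comp CondSet ?Z T W h' q c z = Comp CondSet ?Z T W (mk_hom T H) q c z"
          using h' \<open>Comp CondSet ?Z T W (mk_hom T H) q = r\<close> by simp
        then show "h' c y = mk_hom T H c y"
          unfolding Comp_CondSet_apply[OF c zU] z(2) .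
      qed (use h' in blast)
    qed
  qed
  have "\<exists>s\<in>Hom CondSet ?Z ?Y.
     Comp CondSet ?Z ?Y ?Z ?f s = Ident CondSet ?Z \<and>
     Comp CondSet ?Z ?Y ?Z ?g s = Ident CondSet ?Z"
    using s fs gs by blast
  with coeq proj Y Z f g
  have "is_coequalizer (set_cat UNIV)
     (FObj (hom_functor CondSet T) ?Y) (FObj (hom_functor CondSet T) ?Z)
     (FArr (hom_functor CondSet T) ?Y ?Z ?f)
     (FArr (hom_functor CondSet T) ?Y ?Z ?g)
     (FObj (hom_functor CondSet T) T) (FArr (hom_functor CondSet T) ?Z T q)"
    unfolding projective_object_def by blast
  then have setcoeq: "is_coequalizer (set_cat UNIV)
     (Hom CondSet T ?Y) (Hom CondSet T ?Z)
     (\<lambda>\<eta>\<in>Hom CondSet T ?Y. Comp CondSet T ?Y ?Z ?f \<eta>)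
     (\<lambda>\<eta>\<in>Hom CondSet T ?Y. Comp CondSet T ?Y ?Z ?g \<eta>)
     (Hom CondSet T T) (\<lambda>\<eta>\<in>Hom CondSet T ?Z. Comp CondSet T ?Z T q \<eta>)"
    by (simp add: hom_functor_def)
  obtain b0 b1 :: "'u \<Rightarrow> 'u" where b: "b0 \<noteq> b1" using two_set .
  \<comment> \<open>The surjectivity test takes place among sets of morphisms, so two distinct
    elements of the type of morphisms are required.\<close>
  then have "(\<lambda>(_ :: 'u topology) (_ :: 'u \<Rightarrow> 'u). b0) \<noteq> (\<lambda>_ _. b1)" by (auto simp: fun_eq_iff)
  from set_coequalizer_surj[OF setcoeq this hom_ident[OF Tf]]
  obtain t where "t \<in> Hom CondSet T ?Z" "Comp CondSet T ?Z T q t = Ident CondSet T"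
    using hom_comp[OF Tf _ f] hom_comp[OF Tf _ g] by auto
  then show ?thesis using C.X_locally_ED q by blast
qed

end

section \<open>Compact retracts of locally extremally disconnected spaces\<close>

text \<open>The analogue of \<open>set_coequalizer_surj\<close> for a cocone: the constant map and
  its modification at a missed point would both mediate the constant cocone.\<close>

lemma set_colimit_surj:
  fixes b0 b1 :: 'm
  assumes c: "is_colimit J (set_cat (UNIV :: 'm set set)) G L \<nu>" and b: "b0 \<noteq> b1" and y: "y \<in> L"
    and G: "\<And>i j u x. i \<in> Obj J \<Longrightarrow> j \<in> Obj J \<Longrightarrow> u \<in> Hom J i j \<Longrightarrow> x \<in> FObj G i \<Longrightarrow> FArr G i j u x \<in> FObj G j"
  shows "\<exists>j\<in>Obj J. \<exists>x\<in>FObj G j. \<nu> j x = y"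
proof (rule ccontr)
  assume no: "\<not> (\<exists>j\<in>Obj J. \<exists>x\<in>FObj G j. \<nu> j x = y)"
  let ?\<delta> = "\<lambda>j. \<lambda>x\<in>FObj G j. b0"
  have \<nu>: "\<nu> j \<in> FObj G j \<rightarrow>\<^sub>E L" if "j \<in> Obj J" for j
    using c that by (simp add: is_colimit_def is_cocone_def set_cat_def)
  have "compose (FObj G i) (\<lambda>x\<in>FObj G j. b0) (FArr G i j u) = (\<lambda>x\<in>FObj G i. b0)"
    if "i \<in> Obj J" "j \<in> Obj J" "u \<in> Hom J i j" for i j u
    unfolding compose_def using G[OF that] by (intro restrict_ext) simp
  then have "is_cocone J (set_cat UNIV) G {b0, b1} ?\<delta>"
    by (simp add: is_cocone_def set_cat_def)
  then have 1: "\<exists>!h. h \<in> Hom (set_cat UNIV) L {b0, b1} \<and> (\<forall>j\<in>Obj J. Comp (set_cat UNIV) (FObj G j) L {b0, b1} h (\<nu> j) = ?\<delta> j)"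
    using c unfolding is_colimit_def by blast
  have in_L: "\<nu> j x \<in> L" if "j \<in> Obj J" "x \<in> FObj G j" for j x
    using PiE_mem[OF \<nu>[OF that(1)] that(2)] .
  have "(\<lambda>z\<in>L. b0) = (\<lambda>z\<in>L. if z = y then b1 else b0)"
  proof (rule ex1_unique[OF 1])
    have "compose (FObj G j) (\<lambda>z\<in>L. b0) (\<nu> j) = ?\<delta> j" if "j \<in> Obj J" for j
      unfolding compose_def using in_L[OF that] by (intro restrict_ext) simp
    then show "(\<lambda>z\<in>L. b0) \<in> Hom (set_cat UNIV) L {b0, b1} \<and>
        (\<forall>j\<in>Obj J. Comp (set_cat UNIV) (FObj G j) L {b0, b1} (\<lambda>z\<in>L. b0) (\<nu> j) = ?\<delta> j)"
      by (simp add: set_cat_def)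
    have "compose (FObj G j) (\<lambda>z\<in>L. if z = y then b1 else b0) (\<nu> j) = ?\<delta> j" if "j \<in> Obj J" for j
      unfolding compose_def using in_L[OF that] no that by (intro restrict_ext) auto
    then show "(\<lambda>z\<in>L. if z = y then b1 else b0) \<in> Hom (set_cat UNIV) L {b0, b1} \<and>
        (\<forall>j\<in>Obj J. Comp (set_cat UNIV) (FObj G j) L {b0, b1} (\<lambda>z\<in>L. if z = y then b1 else b0) (\<nu> j) = ?\<delta> j)"
      by (simp add: set_cat_def)
  qed
  from fun_cong[OF this, of y] show False using b y by simp
qed

text \<open>The index categories in \<open>compact_object\<close> have their objects in
  \<open>'u\<close>, so the compact open sets are coded there by \<open>enc\<close>.\<close>

locale compact_opens = universe TU for TU :: "'u itself" +
  fixes X :: "'u topology" and enc :: "'u set \<Rightarrow> 'u"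
  assumes X: "locally_ED X" and enc: "inj_on enc {K. openin X K \<and> compactin X K}"
begin

definition "KK = {K. openin X K \<and> compactin X K}"

definition "dec = inv_into KK enc"

text \<open>The inclusion order as a category, with \<open>undefined\<close> as the only possible
  arrow; filteredness amounts to closure under binary unions.\<close>

definition J :: "('u, 'u) cat" where
  "J = \<lparr>Obj = enc ` KK, Hom = (\<lambda>i j. if dec i \<subseteq> dec j then {undefined} else {}),
        Ident = (\<lambda>_. undefined), Comp = (\<lambda>_ _ _ _ _. undefined)\<rparr>"

abbreviation "sub K \<equiv> subtopology X K"

text \<open>The transition map from \<open>i\<close> to \<open>j\<close> does not mention
  \<open>j\<close>: as an extensional function, the inclusion of a subspace is the same for every
  larger target.\<close>

definition "F = \<lparr>FObj = (\<lambda>i. underline (sub (dec i))), FArr = (\<lambda>i j (u :: 'u). ul_map (sub (dec i)) (rincl X (dec i)))\<rparr>"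

definition "\<iota> i = ul_map (sub (dec i)) (rincl X (dec i))"

lemma dec: "K \<in> KK \<Longrightarrow> dec (enc K) = K"
  using enc by (simp add: dec_def KK_def)

lemma dec_KK: "i \<in> Obj J \<Longrightarrow> dec i \<in> KK"
  by (auto simp: J_def dec)

lemma KK_Un: "K \<in> KK \<Longrightarrow> K' \<in> KK \<Longrightarrow> K \<union> K' \<in> KK"
  by (auto simp: KK_def intro: compactin_Un)

lemma sub_ED: "K \<in> KK \<Longrightarrow> sub K \<in> ED"
  using locally_ED_compact_open[OF X] by (simp add: KK_def)

lemma U_sub: "K \<in> KK \<Longrightarrow> underline (sub K) \<in> Obj CondSet"
  by (rule underline_CondSet[OF locally_ED_space[OF sub_ED]])

lemma incl_apply: "R \<in> ED \<Longrightarrow> f \<in> cmaps R (sub K) \<Longrightarrow> ul_map (sub K) (rincl X K) R f = f"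
  using cmaps_id_comp[of f R "sub K"] by (simp add: ul_map_def underline_def rincl_def)

lemma incl_hom: "K \<in> KK \<Longrightarrow> ul_map (sub K) (rincl X K) \<in> Hom CondSet (underline (sub K)) (underline X)"
  by (rule ul_map_hom[OF locally_ED_space[OF sub_ED] rincl_cmaps])

lemma incl_hom_sub:
  assumes "K \<in> KK" "K \<subseteq> K'"
  shows "ul_map (sub K) (rincl X K) \<in> Hom CondSet (underline (sub K)) (underline (sub K'))"
proof (rule ul_map_hom[OF locally_ED_space[OF sub_ED[OF assms(1)]]])
  show "rincl X K \<in> cmaps (sub K) (sub K')"
    using rincl_cmaps[of X K] assms(2) by (auto simp: cmaps_def continuous_map_in_subtopology rincl_def)
qed

lemma J_simps: "Obj J = enc ` KK" "Hom J i j = (if dec i \<subseteq> dec j then {undefined} else {})"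
  by (simp_all add: J_def)

lemma F_simps: "FObj F i = underline (sub (dec i))" "FArr F i j u = ul_map (sub (dec i)) (rincl X (dec i))"
  by (simp_all add: F_def)

lemma J_cat: "category J"
  by (auto simp: category_def J_def split: if_splits)

lemma J_small: "small_cat TYPE('u) J"
proof -
  have "KK \<subseteq> Pow (topspace X)" by (auto simp: KK_def dest: openin_subset)
  moreover have "small TYPE('u) (topspace X)" using X by (simp add: locally_ED_def)
  ultimately have "small TYPE('u) (Obj J)"
    unfolding J_simps by (intro small_image small_subset[OF _ small_Pow])
  then show ?thesis using J_cat by (simp add: small_cat_def J_simps(2) small_finite)
qed

lemma J_filtered: "filtered_cat J"
  unfolding filtered_cat_def
proof (intro conjI ballI J_cat)
  have "{} \<in> KK" by (simp add: KK_def)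
  then show "Obj J \<noteq> {}" by (auto simp: J_simps)
next
  fix i j assume "i \<in> Obj J" "j \<in> Obj J"
  then have "dec i \<union> dec j \<in> KK" using KK_Un dec_KK by blast
  then show "\<exists>k\<in>Obj J. Hom J i k \<noteq> {} \<and> Hom J j k \<noteq> {}"
    by (intro bexI[of _ "enc (dec i \<union> dec j)"]) (auto simp: J_simps dec)
next
  fix i j u v assume "i \<in> Obj J" "j \<in> Obj J" "u \<in> Hom J i j" "v \<in> Hom J i j"
  then show "\<exists>k\<in>Obj J. \<exists>w\<in>Hom J j k. Comp J i j k w u = Comp J i j k w v"
    by (intro bexI[of _ j] bexI[of _ undefined]) (auto simp: J_simps(2) J_def)
qed

lemma F_functor: "is_functor J CondSet F"
  unfolding is_functor_def
proof (intro conjI ballI)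
  fix i assume i: "i \<in> Obj J"
  note Ui = U_sub[OF dec_KK[OF i]]
  show "FObj F i \<in> Obj CondSet" unfolding F_simps by (rule Ui)
  show "FArr F i i (Ident J i) = Ident CondSet (FObj F i)"
    unfolding F_simps
    by (rule hom_ext[OF incl_hom_sub[OF dec_KK[OF i] order_refl] hom_ident[OF CondSet_functor[OF Ui]]])
      (simp add: underline_def incl_apply)
next
  fix i j u assume i: "i \<in> Obj J" and "u \<in> Hom J i j"
  then have "dec i \<subseteq> dec j" by (simp add: J_simps split: if_splits)
  then show "FArr F i j u \<in> Hom CondSet (FObj F i) (FObj F j)"
    unfolding F_simps by (rule incl_hom_sub[OF dec_KK[OF i]])
next
  fix i j k u v assume i: "i \<in> Obj J" and j: "j \<in> Obj J" and "u \<in> Hom J i j" "v \<in> Hom J j k"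
  then have d: "dec i \<subseteq> dec j" "dec j \<subseteq> dec k" by (simp_all add: J_simps split: if_splits)
  note h = incl_hom_sub[OF dec_KK[OF i] d(1)] incl_hom_sub[OF dec_KK[OF j] d(2)]
  have m: "f \<in> cmaps R (sub (dec j))" if "f \<in> cmaps R (sub (dec i))" for R f
    using that d(1) by (auto simp: cmaps_def continuous_map_in_subtopology)
  show "FArr F i k (Comp J i j k v u) = Comp CondSet (FObj F i) (FObj F j) (FObj F k) (FArr F j k v) (FArr F i j u)"
    unfolding F_simps
    by (rule hom_ext[OF incl_hom_sub[OF dec_KK[OF i] order_trans[OF d]]
          hom_comp[OF CondSet_functor[OF U_sub[OF dec_KK[OF i]]] h]])
      (simp add: underline_def incl_apply m)
qed

text \<open>A map \<open>R \<rightarrow> X\<close> lands in some compact open \<open>K\<close>, and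
  the cocone evaluates it there. Two choices of \<open>K\<close> give the same value, as both agree
  with the value at their union; hence the mediating map is well defined, and it is forced.\<close>

lemma colimit: "is_colimit J CondSet F (underline X) \<iota>"
  unfolding is_colimit_def
proof (intro conjI allI impI)
  have m: "f \<in> cmaps R (sub K')" if "f \<in> cmaps R (sub K)" "K \<subseteq> K'" for R f K K'
    using that by (auto simp: cmaps_def continuous_map_in_subtopology)
  have cocone_hom: "Comp CondSet (FObj F i) (FObj F j) W (\<delta> j) (FArr F i j undefined) = \<delta> i"
    if "is_cocone J CondSet F W \<delta>" "i \<in> Obj J" "j \<in> Obj J" "dec i \<subseteq> dec j" for W \<delta> i j
    using that by (simp add: is_cocone_def J_simps(2))
  show "is_cocone J CondSet F (underline X) \<iota>"
    unfolding is_cocone_def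
  proof (intro conjI ballI underline_CondSet[OF X])
    fix j assume j: "j \<in> Obj J"
    show "\<iota> j \<in> Hom CondSet (FObj F j) (underline X)"
      unfolding \<iota>_def F_simps by (rule incl_hom[OF dec_KK[OF j]])
  next
    fix i j u assume i: "i \<in> Obj J" and j: "j \<in> Obj J" and "u \<in> Hom J i j"
    then have d: "dec i \<subseteq> dec j" by (simp add: J_simps split: if_splits)
    show "Comp CondSet (FObj F i) (FObj F j) (underline X) (\<iota> j) (FArr F i j u) = \<iota> i"
      unfolding F_simps \<iota>_def
      by (rule hom_ext[OF hom_comp[OF CondSet_functor[OF U_sub[OF dec_KK[OF i]]] incl_hom_sub[OF dec_KK[OF i] d]
            incl_hom[OF dec_KK[OF j]]] incl_hom[OF dec_KK[OF i]]])
        (simp add: underline_def incl_apply m[OF _ d])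
  qed
  fix W \<delta> assume \<delta>: "is_cocone J CondSet F W \<delta>"
  then have W: "W \<in> Obj CondSet" by (simp add: is_cocone_def)
  have \<delta>hom: "\<delta> (enc K) \<in> Hom CondSet (underline (sub K)) W" if "K \<in> KK" for K
    using \<delta> that dec[OF that] by (auto simp: is_cocone_def J_simps(1) F_simps)
  have mono: "\<delta> (enc K) R f = \<delta> (enc K') R f"
    if K: "K \<in> KK" "K' \<in> KK" "K \<subseteq> K'" and R: "R \<in> ED" "f \<in> cmaps R (sub K)" for K K' R f
  proof -
    have "Comp CondSet (underline (sub K)) (underline (sub K')) W (\<delta> (enc K')) (ul_map (sub K) (rincl X K)) = \<delta> (enc K)"
      using cocone_hom[OF \<delta>, of "enc K" "enc K'"] K by (simp add: J_simps(1) F_simps dec)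
    from fun_cong[OF fun_cong[OF this, of R], of f] show ?thesis
      using R by (simp add: underline_def incl_apply)
  qed
  have indep: "\<delta> (enc K) R f = \<delta> (enc K') R f"
    if K: "K \<in> KK" "K' \<in> KK" and R: "R \<in> ED" "f \<in> cmaps R (sub K)" "f \<in> cmaps R (sub K')" for K K' R f
    using mono[OF K(1) KK_Un[OF K] _ R(1,2)] mono[OF K(2) KK_Un[OF K] _ R(1,3)] by simp
  define sel where "sel R f = (SOME K. K \<in> KK \<and> f \<in> cmaps R (sub K))" for R :: "'u topology" and f
  have sel: "sel R f \<in> KK" "f \<in> cmaps R (sub (sel R f))" if "R \<in> ED" "f \<in> cmaps R X" for R f
  proof -
    have "\<exists>K. K \<in> KK \<and> f \<in> cmaps R (sub K)"
      using cmaps_compact_open[OF X that] by (auto simp: KK_def)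
    from someI_ex[OF this] show "sel R f \<in> KK" "f \<in> cmaps R (sub (sel R f))" by (simp_all add: sel_def)
  qed
  define h where "h = mk_hom (underline X) (\<lambda>R f. \<delta> (enc (sel R f)) R f)"
  have sub_X: "f \<in> cmaps R X" if "f \<in> cmaps R (sub K)" for R f K
    using that by (auto simp: cmaps_def continuous_map_in_subtopology)
  have h: "h R f = \<delta> (enc K) R f" if "R \<in> ED" "K \<in> KK" "f \<in> cmaps R (sub K)" for R f K
  proof -
    have f: "f \<in> cmaps R X" by (rule sub_X[OF that(3)])
    then have "h R f = \<delta> (enc (sel R f)) R f" using that(1) by (simp add: h_def underline_def)
    also have "\<dots> = \<delta> (enc K) R f" by (rule indep[OF sel(1)[OF that(1) f] that(2,1) sel(2)[OF that(1) f] that(3)])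
    finally show ?thesis .
  qed
  have hH: "h \<in> Hom CondSet (underline X) W"
    unfolding h_def
  proof (rule mk_hom[OF CondSet_functor[OF underline_CondSet[OF X]]])
    fix R :: "'u topology" and f assume R: "R \<in> ED" and "f \<in> FObj (underline X) R"
    then have f: "f \<in> cmaps R X" by (simp add: underline_def)
    show "\<delta> (enc (sel R f)) R f \<in> FObj W R"
      using hom_in[OF \<delta>hom[OF sel(1)[OF R f]] R, of f] sel(2)[OF R f] by (simp add: underline_def)
  next
    fix R Q :: "'u topology" and g f assume R: "R \<in> ED" "Q \<in> ED" "g \<in> cmaps Q R" and "f \<in> FObj (underline X) R"
    then have f: "f \<in> cmaps R X" by (simp add: underline_def)
    let ?K = "sel R f"
    note s = sel[OF R(1) f]
    have fg: "compose (topspace Q) f g \<in> cmaps Q (sub ?K)" by (rule cmaps_comp[OF R(3) s(2)])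
    have "\<delta> (enc (sel Q (compose (topspace Q) f g))) Q (compose (topspace Q) f g) = \<delta> (enc ?K) Q (compose (topspace Q) f g)"
      by (rule indep[OF sel(1)[OF R(2) sub_X[OF fg]] s(1) R(2) sel(2)[OF R(2) sub_X[OF fg]] fg])
    also have "\<dots> = FArr W R Q g (\<delta> (enc ?K) R f)"
      using hom_nat[OF \<delta>hom[OF s(1)] R, of f] s(2) by (simp add: underline_def)
    finally show "\<delta> (enc (sel Q (FArr (underline X) R Q g f))) Q (FArr (underline X) R Q g f) = FArr W R Q g (\<delta> (enc ?K) R f)"
      using f by (simp add: underline_def)
  qed
  have comp_iff: "Comp CondSet (FObj F j) (underline X) W k (\<iota> j) = \<delta> j \<longleftrightarrow>
      (\<forall>R\<in>ED. \<forall>f\<in>cmaps R (sub (dec j)). k R f = \<delta> j R f)"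
    if k: "k \<in> Hom CondSet (underline X) W" and j: "j \<in> Obj J" for k j
  proof
    assume eq: "Comp CondSet (FObj F j) (underline X) W k (\<iota> j) = \<delta> j"
    show "\<forall>R\<in>ED. \<forall>f\<in>cmaps R (sub (dec j)). k R f = \<delta> j R f"
    proof (intro ballI)
      fix R :: "'u topology" and f assume "R \<in> ED" "f \<in> cmaps R (sub (dec j))"
      then show "k R f = \<delta> j R f"
        using fun_cong[OF fun_cong[OF eq, of R], of f] by (simp add: F_simps \<iota>_def underline_def incl_apply)
    qed
  next
    assume eq: "\<forall>R\<in>ED. \<forall>f\<in>cmaps R (sub (dec j)). k R f = \<delta> j R f"
    have "\<delta> j \<in> Hom CondSet (FObj F j) W" using \<delta> j by (simp add: is_cocone_def)
    then show "Comp CondSet (FObj F j) (underline X) W k (\<iota> j) = \<delta> j"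
      unfolding F_simps \<iota>_def
      by (intro hom_ext[OF hom_comp[OF CondSet_functor[OF U_sub[OF dec_KK[OF j]]] incl_hom[OF dec_KK[OF j]] k]])
        (use eq in \<open>simp_all add: underline_def incl_apply\<close>)
  qed
  show "\<exists>!h. h \<in> Hom CondSet (underline X) W \<and> (\<forall>j\<in>Obj J. Comp CondSet (FObj F j) (underline X) W h (\<iota> j) = \<delta> j)"
  proof (rule ex1I[of _ h])
    show "h \<in> Hom CondSet (underline X) W \<and> (\<forall>j\<in>Obj J. Comp CondSet (FObj F j) (underline X) W h (\<iota> j) = \<delta> j)"
    proof (intro conjI hH ballI)
      fix j assume j: "j \<in> Obj J"
      then have "enc (dec j) = j" by (auto simp: J_simps(1) dec)
      then show "Comp CondSet (FObj F j) (underline X) W h (\<iota> j) = \<delta> j"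
        unfolding comp_iff[OF hH j] using h[OF _ dec_KK[OF j]] by simp
    qed
    fix k assume k: "k \<in> Hom CondSet (underline X) W \<and> (\<forall>j\<in>Obj J. Comp CondSet (FObj F j) (underline X) W k (\<iota> j) = \<delta> j)"
    show "k = h"
    proof (rule hom_ext[OF _ hH])
      fix R :: "'u topology" and f assume R: "R \<in> ED" and "f \<in> FObj (underline X) R"
      then have f: "f \<in> cmaps R X" by (simp add: underline_def)
      note s = sel[OF R f]
      have e: "enc (sel R f) \<in> Obj J" using s(1) by (simp add: J_simps(1))
      have "k R f = \<delta> (enc (sel R f)) R f"
        using comp_iff[of k, OF _ e] k e R s by (simp add: dec)
      then show "k R f = h R f" using h[OF R s] by simp
    qed (use k in blast)
  qed
qed

end

section \<open>From a compact retract to a representing space\<close>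

context universe begin

text \<open>By compactness the section \<open>s\<close> into the filtered union factors through one
  Hom(-, K); restricting \<open>q\<close> to that \<open>K\<close> keeps the composite equal to the
  identity.\<close>

lemma compact_retract:
  fixes T :: "'u presheaf"
  assumes T: "T \<in> Obj CondSet" and comp: "compact_object TYPE('u) CondSet T" and X: "locally_ED X"
    and q: "q \<in> Hom CondSet (underline X) T" and s: "s \<in> Hom CondSet T (underline X)"
    and qs: "Comp CondSet T (underline X) T q s = Ident CondSet T"
  shows "\<exists>S\<in>ED. \<exists>p\<in>Hom CondSet (underline S) T. \<exists>i\<in>Hom CondSet T (underline S).
    Comp CondSet T (underline S) T p i = Ident CondSet T"
proof -
  note Tf = CondSet_functor[OF T]
  have "{K. openin X K \<and> compactin X K} \<subseteq> Pow (topspace X)" by (auto dest: openin_subset)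
  moreover have "small TYPE('u) (topspace X)" using X by (simp add: locally_ED_def)
  ultimately have "small TYPE('u) {K. openin X K \<and> compactin X K}"
    using small_subset small_Pow by blast
  then obtain enc :: "'u set \<Rightarrow> 'u" where enc: "inj_on enc {K. openin X K \<and> compactin X K}" by (rule small_iso)
  interpret C: compact_opens "TYPE('u)" X enc by unfold_locales (fact X, fact enc)
  have "is_colimit C.J (set_cat UNIV) (comp_func (hom_functor CondSet T) C.F)
      (FObj (hom_functor CondSet T) (underline X)) (\<lambda>j. FArr (hom_functor CondSet T) (FObj C.F j) (underline X) (C.\<iota> j))"
    using comp C.J_small C.J_filtered C.F_functor C.colimit unfolding compact_object_def by blast
  moreover obtain b0 b1 :: "'u \<Rightarrow> 'u" where b: "b0 \<noteq> b1" using two_set .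
  then have "(\<lambda>(_ :: 'u topology) (_ :: 'u \<Rightarrow> 'u). b0) \<noteq> (\<lambda>_ _. b1)" by (auto simp: fun_eq_iff)
  moreover have "s \<in> FObj (hom_functor CondSet T) (underline X)" using s by (simp add: hom_functor_def)
  ultimately have "\<exists>j\<in>Obj C.J. \<exists>x\<in>FObj (comp_func (hom_functor CondSet T) C.F) j.
      FArr (hom_functor CondSet T) (FObj C.F j) (underline X) (C.\<iota> j) x = s"
  proof (rule set_colimit_surj)
    fix i j u x
    assume i: "i \<in> Obj C.J" "j \<in> Obj C.J" "u \<in> Hom C.J i j" and "x \<in> FObj (comp_func (hom_functor CondSet T) C.F) i"
    then have x: "x \<in> Hom CondSet T (FObj C.F i)" by (simp add: comp_func_def hom_functor_def)
    have "FArr C.F i j u \<in> Hom CondSet (FObj C.F i) (FObj C.F j)"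
      using C.F_functor i by (simp add: is_functor_def)
    from hom_comp[OF Tf x this]
    show "FArr (comp_func (hom_functor CondSet T) C.F) i j u x \<in> FObj (comp_func (hom_functor CondSet T) C.F) j"
      using x by (simp add: comp_func_def hom_functor_def)
  qed
  then obtain j i where j: "j \<in> Obj C.J" and i: "i \<in> Hom CondSet T (FObj C.F j)"
    and si: "Comp CondSet T (FObj C.F j) (underline X) (C.\<iota> j) i = s"
    by (auto simp: comp_func_def hom_functor_def)
  let ?S = "subtopology X (C.dec j)"
  have i': "i \<in> Hom CondSet T (underline ?S)" using i by (simp add: C.F_simps)
  note SE = C.sub_ED[OF C.dec_KK[OF j]]
  note Uf = CondSet_functor[OF underline_CondSet[OF locally_ED_space[OF SE]]]
  have \<iota>: "C.\<iota> j \<in> Hom CondSet (underline ?S) (underline X)"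
    unfolding C.\<iota>_def by (rule C.incl_hom[OF C.dec_KK[OF j]])
  have "Comp CondSet T (underline ?S) T (Comp CondSet (underline ?S) (underline X) T q (C.\<iota> j)) i =
      Comp CondSet T (underline X) T q (Comp CondSet T (underline ?S) (underline X) (C.\<iota> j) i)"
    by (rule hom_assoc[OF Tf i'])
  also have "\<dots> = Ident CondSet T" using si qs by (simp add: C.F_simps)
  finally show ?thesis using SE i' hom_comp[OF Uf \<iota> q] by blast
qed

text \<open>By the Yoneda lemma the retraction is induced by an idempotent \<open>e\<close> of \<open>S\<close>; the image of
  \<open>e\<close> represents \<open>T\<close>.\<close>

lemma retract_representable:
  fixes T :: "'u presheaf"
  assumes T: "T \<in> Obj CondSet" and S: "S \<in> ED"
    and p: "p \<in> Hom CondSet (underline S) T" and i: "i \<in> Hom CondSet T (underline S)"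
    and pi: "Comp CondSet T (underline S) T p i = Ident CondSet T"
  shows "\<exists>S'\<in>ED. isomorphic_in CondSet T (underline S')"
proof -
  note Tf = CondSet_functor[OF T]
  define idS where "idS = (\<lambda>s\<in>topspace S. s)"
  have idS: "idS \<in> cmaps S S" by (simp add: idS_def cmaps_id)
  then have idU: "idS \<in> FObj (underline S) S" by (simp add: underline_def)
  define e where "e = i S (p S idS)"
  have e: "e \<in> cmaps S S"
    using hom_in[OF i S hom_in[OF p S idU]] by (simp add: e_def underline_def)
  \<comment> \<open>Every \<open>f\<close> is the restriction along \<open>f\<close> of the identity
    of \<open>S\<close>, so by naturality \<open>i\<close> after \<open>p\<close> is composition
    with the single map \<open>e\<close>.\<close>
  have ip: "i R (p R f) = compose (topspace R) e f" if R: "R \<in> ED" and f: "f \<in> cmaps R S" for R f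
  proof -
    have "FArr (underline S) S R f idS = f"
      using idS cmaps_id_comp[OF f] by (simp add: underline_def idS_def)
    then have "i R (p R f) = FArr (underline S) S R f e"
      using hom_nat[OF p S R f idU] hom_nat[OF i S R f hom_in[OF p S idU]] by (simp add: e_def)
    then show ?thesis using e by (simp add: underline_def)
  qed
  have p_i: "p R (i R x) = x" if "R \<in> ED" "x \<in> FObj T R" for R x
    using fun_cong[OF fun_cong[OF pi, of R], of x] that by simp
  have i_in: "i R x \<in> cmaps R S" if "R \<in> ED" "x \<in> FObj T R" for R x
    using hom_in[OF i that] by (simp add: underline_def)
  have e_i: "compose (topspace R) e (i R x) = i R x" if "R \<in> ED" "x \<in> FObj T R" for R x
    using ip[OF that(1) i_in[OF that]] p_i[OF that] by simp
  have ee: "e (e s) = e s" if "s \<in> topspace S" for s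
  proof -
    have "compose (topspace S) e e = e"
      using e_i[OF S hom_in[OF p S idU]] by (simp add: e_def)
    from fun_cong[OF this, of s] that show ?thesis by (simp add: compose_def)
  qed
  define S' where "S' = subtopology S (e ` topspace S)"
  have eS: "e ` topspace S \<subseteq> topspace S" using e by (auto dest: cmaps_in)
  have tS': "topspace S' = e ` topspace S" using eS by (auto simp: S'_def)
  have ec: "continuous_map S S e" using e by (simp add: cmaps_def)
  have "S' \<in> ED"
    unfolding ED_iff
  proof (intro conjI)
    show "small TYPE('u) (topspace S')" using S unfolding tS' ED_iff by (simp add: small_image)
    show "Hausdorff_space S'" using S by (simp add: S'_def ED_iff Hausdorff_space_subtopology)
    have "compactin S (e ` topspace S)"
      using S ec by (intro image_compactin[of S]) (simp_all add: ED_iff compact_space_def)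
    then show "compact_space S'" by (simp add: S'_def compact_space_subtopology)
    show "extremally_disconnected_space S'"
    proof (rule extremally_disconnected_retract[where i = "\<lambda>s. s" and r = e])
      show "extremally_disconnected_space S" using S by (simp add: ED_iff)
      show "continuous_map S' S (\<lambda>s. s)" by (simp add: S'_def continuous_map_from_subtopology)
      show "continuous_map S S' e" using ec by (auto simp: S'_def continuous_map_in_subtopology)
      show "e x = x" if "x \<in> topspace S'" for x using that ee by (auto simp: tS')
    qed
  qed
  then have S': "S' \<in> ED" .
  have US': "underline S' \<in> Obj CondSet" by (rule underline_CondSet[OF locally_ED_space[OF S']])
  note Uf = CondSet_functor[OF US']
  \<comment> \<open>Maps into the image of the idempotent are the maps fixed by \<open>e\<close>.
    These are exactly the values of \<open>i\<close>: each such value is fixed by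
    \<open>e_i\<close>, and a fixed \<open>f\<close> equals \<open>i\<close> of \<open>p f\<close>
    by \<open>ip\<close>.\<close>
  have in_S': "f \<in> cmaps R S' \<longleftrightarrow> f \<in> cmaps R S \<and> compose (topspace R) e f = f" for R f
  proof -
    have "f ` topspace R \<subseteq> e ` topspace S \<longleftrightarrow> compose (topspace R) e f = f" if "f \<in> cmaps R S"
    proof
      assume "f ` topspace R \<subseteq> e ` topspace S"
      then have "e (f x) = f x" if "x \<in> topspace R" for x using that ee by force
      then show "compose (topspace R) e f = f"
        using \<open>f \<in> cmaps R S\<close> by (auto simp: compose_def fun_eq_iff cmaps_def extensional_def)
    next
      assume eq: "compose (topspace R) e f = f"
      have "f x = e (f x)" if "x \<in> topspace R" for x using fun_cong[OF eq, of x] that by (simp add: compose_def)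
      then show "f ` topspace R \<subseteq> e ` topspace S" using cmaps_in[OF \<open>f \<in> cmaps R S\<close>] by blast
    qed
    then show ?thesis by (auto simp: S'_def cmaps_def continuous_map_in_subtopology)
  qed
  have i': "mk_hom T i \<in> Hom CondSet T (underline S')"
  proof (rule mk_hom[OF Tf])
    fix R :: "'u topology" and x assume R: "R \<in> ED" "x \<in> FObj T R"
    then show "i R x \<in> FObj (underline S') R" using i_in e_i by (simp add: underline_def in_S')
    fix Q :: "'u topology" and f assume Q: "Q \<in> ED" "f \<in> cmaps Q R"
    show "i Q (FArr T R Q f x) = FArr (underline S') R Q f (i R x)"
      using hom_nat[OF i R(1) Q R(2)] i_in[OF R] e_i[OF R] by (simp add: underline_def in_S')
  qed
  have p': "mk_hom (underline S') p \<in> Hom CondSet (underline S') T"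
  proof (rule mk_hom[OF Uf])
    fix R :: "'u topology" and f assume R: "R \<in> ED" "f \<in> FObj (underline S') R"
    then have f: "f \<in> FObj (underline S) R" "f \<in> FObj (underline S') R" by (simp_all add: underline_def in_S')
    show "p R f \<in> FObj T R" by (rule hom_in[OF p R(1) f(1)])
    fix Q :: "'u topology" and g assume Q: "Q \<in> ED" "g \<in> cmaps Q R"
    show "p Q (FArr (underline S') R Q g f) = FArr T R Q g (p R f)"
      using hom_nat[OF p R(1) Q f(1)] f by (simp add: underline_def)
  qed
  have "Comp CondSet T (underline S') T (mk_hom (underline S') p) (mk_hom T i) = Ident CondSet T"
  proof (rule hom_ext[OF hom_comp[OF Tf i' p'] hom_ident[OF Tf]])
    fix R :: "'u topology" and x assume R: "R \<in> ED" "x \<in> FObj T R"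
    have "i R x \<in> FObj (underline S') R" using hom_in[OF i' R] R by simp
    then show "Comp CondSet T (underline S') T (mk_hom (underline S') p) (mk_hom T i) R x = Ident CondSet T R x"
      using R p_i by simp
  qed
  moreover have "Comp CondSet (underline S') T (underline S') (mk_hom T i) (mk_hom (underline S') p) = Ident CondSet (underline S')"
  proof (rule hom_ext[OF hom_comp[OF Uf p' i'] hom_ident[OF Uf]])
    fix R :: "'u topology" and f assume R: "R \<in> ED" "f \<in> FObj (underline S') R"
    then have f: "f \<in> cmaps R S" "compose (topspace R) e f = f" by (simp_all add: underline_def in_S')
    have "p R f \<in> FObj T R" using hom_in[OF p' R] R by simp
    then show "Comp CondSet (underline S') T (underline S') (mk_hom T i) (mk_hom (underline S') p) R f = Ident CondSet (underline S') R f"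
      using R ip[OF R(1) f(1)] f(2) by simp
  qed
  ultimately have "isomorphic_in CondSet T (underline S')"
    unfolding isomorphic_in_def using T US' i' p' by blast
  then show ?thesis using S' by blast
qed

end

theorem theorem3p2p6:
  fixes T :: "'u presheaf"
  assumes "inaccessible (card_of (UNIV :: 'u set))"
    and "T \<in> Obj CondSet"
  shows "compact_object TYPE('u) CondSet T \<and> projective_object CondSet T \<longleftrightarrow>
    (\<exists>S :: 'u topology. S \<in> Obj ExtrDisc \<and> isomorphic_in CondSet T (underline S))"
proof -
  interpret universe "TYPE('u)" by unfold_locales (fact assms(1))
  show ?thesis
  proof
    assume cp: "compact_object TYPE('u) CondSet T \<and> projective_object CondSet T"
    then obtain X q s where "locally_ED X" "q \<in> Hom CondSet (underline X) T" "s \<in> Hom CondSet T (underline X)"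
      "Comp CondSet T (underline X) T q s = Ident CondSet T"
      using projective_retract[OF assms(2)] by blast
    from compact_retract[OF assms(2) _ this] cp obtain S p i where
      "S \<in> ED" "p \<in> Hom CondSet (underline S) T" "i \<in> Hom CondSet T (underline S)"
      "Comp CondSet T (underline S) T p i = Ident CondSet T"
      by blast
    from retract_representable[OF assms(2) this]
    show "\<exists>S. S \<in> Obj ExtrDisc \<and> isomorphic_in CondSet T (underline S)" by blast
  next
    assume "\<exists>S. S \<in> Obj ExtrDisc \<and> isomorphic_in CondSet T (underline S)"
    then obtain S where "S \<in> Obj ExtrDisc" "isomorphic_in CondSet T (underline S)" by blast
    then obtain u where "represented T S u" using isomorphic_represented by blast
    then show "compact_object TYPE('u) CondSet T \<and> projective_object CondSet T"
      using represented_compact represented_projective by blast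
  qed
qed

end
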